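(* Let $G$ be a finite group, let $\mathcal{R}$ be a complete set of inequivalent irreducible unitary complex matrix representations of $G$, and let $f\colon G\to\mathbb{C}$. The skew spectrum $\{\hat q_z(\rho)\}_{\rho\in\mathcal{R},\,z\in G}$ of $f$ and the bispectrum $(\hat b(\rho_1,\rho_2))_{\rho_1,\rho_2\in\mathcal{R}}$ of $f$ are unitarily equivalent, by virtue of the following: for each $z\in G$, the matrices $(\hat q_z(\rho))_{\rho\in\mathcal{R}}$ are the Fourier transform of the function $$q_z(x)=\sum_{y\in G} f(yx^{-1})^\ast\, f(yx^{-1}z)^\ast\, f(y)=b(x,z^{-1}x)=b\downharpoonleft_{z^{-1}}(x),\qquad x\in G,$$ where $b$ is the triple correlation of $f$, whose Fourier transform over $G\times G$ is the bispectrum, and the slices $\{b\downharpoonleft_{z}\}_{z\in G}$ together make up $b$.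
   Context: $G$ is a finite group. A complete set $\mathcal{R}$ of inequivalent irreducible unitary matrix representations contains exactly one representative $\rho\colon G\to\mathbb{C}^{d_\rho\times d_\rho}$ of each isomorphism class of irreducible complex representations, each chosen so that $\rho(x^{-1})=\rho(x)^\dagger$. Here $\dagger$ denotes conjugate transpose and $\ast$ as a superscript denotes complex conjugation. Fourier transform: for $g\colon G\to\mathbb{C}$ it is the collection of matrices $\hat g(\rho)=\sum_{x\in G}\rho(x)\,g(x)$, $\rho\in\mathcal{R}$. It is a unitary map with respect to the norms $\|g\|^2=\frac{1}{|G|}\sum_{x\in G}|g(x)|^2$ and $\|\hat g\|^2=\frac{1}{|G|^2}\sum_{\rho\in\mathcal{R}}d_\rho\|\hat g(\rho)\|_2^2$, where $\|\cdot\|_2$ is the Frobenius norm. For functions on $G\times G$ the Fourier transform is taken in the same way, the irreducible representations of $G\times G$ being the tensor products $(x_1,x_2)\mapsto\rho_1(x_1)\otimes\rho_2(x_2)$ with $\rho_1,\rho_2\in\mathcal{R}$. Clebsch-Gordan matrices: for $\rho_1,\rho_2\in\mathcal{R}$, $C_{\rho_1\rho_2}$ is a unitary matrix such that for all $x\in G$ $$\rho_1(x)\otimes\rho_2(x)=C_{\rho_1\rho_2}\Big[\bigoplus_{\rho\in\mathcal{R}}\rho(x)^{\oplus m_\rho}\Big]C_{\rho_1\rho_2}^\dagger,$$ where $m_\rho=m(\rho_1,\rho_2,\rho)$ is the multiplicity of $\rho$ in $\rho_1\otimes\rho_2$ and $M^{\oplus k}$ is the block diagonal sum of $k$ copies of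 $M$. Bispectrum of $f$: the matrices $$\hat b(\rho_1,\rho_2)=\big(\hat f(\rho_1)\otimes\hat f(\rho_2)\big)^\dagger\, C_{\rho_1\rho_2}\Big[\bigoplus_{\rho\in\mathcal{R}}\hat f(\rho)^{\oplus m_\rho}\Big]C_{\rho_1\rho_2}^\dagger,\qquad \rho_1,\rho_2\in\mathcal{R}.$$ Triple correlation of $f$: $b(x_1,x_2)=\sum_{y\in G} f(yx_1^{-1})^\ast\, f(yx_2^{-1})^\ast\, f(y)$ for $x_1,x_2\in G$. Left $z$-diagonal slice of a function $g\colon G\times G\to\mathbb{C}$, for $z\in G$: the function $g\downharpoonleft_{z}\colon G\to\mathbb{C}$ given by $g\downharpoonleft_{z}(x)=g(x,zx)$. Skew spectrum of $f$: for $z\in G$ let $r_z(x)=f(x)\,f(xz)$, $x\in G$; the skew spectrum is the collection of matrices $\hat q_z(\rho)=\hat r_z(\rho)^\dagger\,\hat f(\rho)$, $\rho\in\mathcal{R}$, $z\in G$. *)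

theory Defs
  imports
    "Jordan_Normal_Form.VS_Connect"
    "Jordan_Normal_Form.Schur_Decomposition"
begin

section \<open>Matrix preliminaries\<close>

definition unitary_mat :: "nat \<Rightarrow> complex mat \<Rightarrow> bool" where
  "unitary_mat n A \<longleftrightarrow> A \<in> carrier_mat n n \<and>
     A * mat_adjoint A = 1\<^sub>m n \<and> mat_adjoint A * A = 1\<^sub>m n"

definition kron :: "complex mat \<Rightarrow> complex mat \<Rightarrow> complex mat" (infixl "\<otimes>\<^sub>k" 70) where
  "A \<otimes>\<^sub>k B = mat (dim_row A * dim_row B) (dim_col A * dim_col B)
     (\<lambda>(i, j). A $$ (i div dim_row B, j div dim_col B) * B $$ (i mod dim_row B, j mod dim_col B))"

definition frobenius_sq :: "complex mat \<Rightarrow> real" where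
  "frobenius_sq A = (\<Sum>i<dim_row A. \<Sum>j<dim_col A. (cmod (A $$ (i, j)))\<^sup>2)"


section \<open>Complex matrix representations\<close>

type_synonym 'a mrep = "'a \<Rightarrow> complex mat"

text \<open>Only the values of a representation on the carrier of the group are relevant.\<close>

definition rep_degree :: "('a, 'b) monoid_scheme \<Rightarrow> 'a mrep \<Rightarrow> nat" where
  "rep_degree G \<rho> = dim_row (\<rho> \<one>\<^bsub>G\<^esub>)"

definition representation :: "('a, 'b) monoid_scheme \<Rightarrow> 'a mrep \<Rightarrow> bool" where
  "representation G \<rho> \<longleftrightarrow>
     \<rho> \<in> hom G (units_of (ring_mat TYPE(complex) (rep_degree G \<rho>) ()))"

definition irreducible_rep :: "('a, 'b) monoid_scheme \<Rightarrow> 'a mrep \<Rightarrow> bool" where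
  "irreducible_rep G \<rho> \<longleftrightarrow> representation G \<rho> \<and> rep_degree G \<rho> > 0 \<and>
     (\<forall>W. VectorSpace.subspace class_ring W (module_vec TYPE(complex) (rep_degree G \<rho>)) \<longrightarrow>
          (\<forall>x\<in>carrier G. \<forall>w\<in>W. \<rho> x *\<^sub>v w \<in> W) \<longrightarrow>
          W = {0\<^sub>v (rep_degree G \<rho>)} \<or> W = carrier_vec (rep_degree G \<rho>))"

definition unitary_rep :: "('a, 'b) monoid_scheme \<Rightarrow> 'a mrep \<Rightarrow> bool" where
  "unitary_rep G \<rho> \<longleftrightarrow> representation G \<rho> \<and>
     (\<forall>x\<in>carrier G. \<rho> (inv\<^bsub>G\<^esub> x) = mat_adjoint (\<rho> x))"

definition equivalent_rep :: "('a, 'b) monoid_scheme \<Rightarrow> 'a mrep \<Rightarrow> 'a mrep \<Rightarrow> bool" where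
  "equivalent_rep G \<rho> \<sigma> \<longleftrightarrow> rep_degree G \<rho> = rep_degree G \<sigma> \<and>
     (\<exists>P\<in>carrier_mat (rep_degree G \<rho>) (rep_degree G \<rho>).
        invertible_mat P \<and> (\<forall>x\<in>carrier G. \<sigma> x * P = P * \<rho> x))"

definition complete_unitary_irreps :: "('a, 'b) monoid_scheme \<Rightarrow> 'a mrep set \<Rightarrow> bool" where
  "complete_unitary_irreps G R \<longleftrightarrow>
     (\<forall>\<rho>\<in>R. irreducible_rep G \<rho> \<and> unitary_rep G \<rho>) \<and>
     (\<forall>\<sigma>. irreducible_rep G \<sigma> \<longrightarrow> (\<exists>!\<rho>. \<rho> \<in> R \<and> equivalent_rep G \<rho> \<sigma>))"

definition tensor_rep :: "'a mrep \<Rightarrow> 'b mrep \<Rightarrow> ('a \<times> 'b) mrep" where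
  "tensor_rep \<rho>\<^sub>1 \<rho>\<^sub>2 = (\<lambda>(x\<^sub>1, x\<^sub>2). \<rho>\<^sub>1 x\<^sub>1 \<otimes>\<^sub>k \<rho>\<^sub>2 x\<^sub>2)"


section \<open>Fourier transform\<close>

definition fourier :: "('a, 'b) monoid_scheme \<Rightarrow> ('a \<Rightarrow> complex) \<Rightarrow> 'a mrep \<Rightarrow> complex mat" where
  "fourier G g \<rho> = mat (rep_degree G \<rho>) (rep_degree G \<rho>)
     (\<lambda>(i, j). \<Sum>x\<in>carrier G. \<rho> x $$ (i, j) * g x)"

text \<open>
  Collections of matrices are extensional functions on an index set \<open>I\<close>. The index \<open>i\<close> carries a
  square matrix whose size is the degree of the representation \<open>rep i\<close> of \<open>G\<close>.
\<close>

definition spectral_space ::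
    "('a, 'b) monoid_scheme \<Rightarrow> 'i set \<Rightarrow> ('i \<Rightarrow> 'a mrep) \<Rightarrow> ('i \<Rightarrow> complex mat) set" where
  "spectral_space G I rep =
     (\<Pi>\<^sub>E i\<in>I. carrier_mat (rep_degree G (rep i)) (rep_degree G (rep i)))"

definition spectral_norm_sq ::
    "('a, 'b) monoid_scheme \<Rightarrow> 'i set \<Rightarrow> ('i \<Rightarrow> 'a mrep) \<Rightarrow> ('i \<Rightarrow> complex mat) \<Rightarrow> real" where
  "spectral_norm_sq G I rep A =
     1 / (real (Coset.order G))\<^sup>2 * (\<Sum>i\<in>I. real (rep_degree G (rep i)) * frobenius_sq (A i))"

text \<open>
  The squared norm of a family, indexed by the elements \<open>z\<close> of \<open>G\<close>, of Fourier transforms on \<open>G\<close>: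
  as for the norm of functions on \<open>G\<close>, the sum over \<open>z\<close> is normalised by the group order.
\<close>

definition slices_norm_sq ::
    "('a, 'b) monoid_scheme \<Rightarrow> 'a mrep set \<Rightarrow> ('a \<times> 'a mrep \<Rightarrow> complex mat) \<Rightarrow> real" where
  "slices_norm_sq G R Q =
     1 / real (Coset.order G) * (\<Sum>z\<in>carrier G. spectral_norm_sq G R (\<lambda>\<rho>. \<rho>) (\<lambda>\<rho>. Q (z, \<rho>)))"

definition unitary_map ::
    "'i set \<Rightarrow> ('i \<Rightarrow> complex mat) set \<Rightarrow> (('i \<Rightarrow> complex mat) \<Rightarrow> real) \<Rightarrow>
     'j set \<Rightarrow> ('j \<Rightarrow> complex mat) set \<Rightarrow> (('j \<Rightarrow> complex mat) \<Rightarrow> real) \<Rightarrow>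
     (('i \<Rightarrow> complex mat) \<Rightarrow> ('j \<Rightarrow> complex mat)) \<Rightarrow> bool" where
  "unitary_map I S normS J T normT U \<longleftrightarrow>
     bij_betw U S T \<and>
     (\<forall>A\<in>S. \<forall>B\<in>S. U (\<lambda>i\<in>I. A i + B i) = (\<lambda>j\<in>J. U A j + U B j)) \<and>
     (\<forall>c. \<forall>A\<in>S. U (\<lambda>i\<in>I. c \<cdot>\<^sub>m A i) = (\<lambda>j\<in>J. c \<cdot>\<^sub>m U A j)) \<and>
     (\<forall>A\<in>S. normT (U A) = normS A)"


section \<open>Bispectrum, triple correlation and skew spectrum\<close>

text \<open>
  The list \<open>Rs\<close> enumerates the complete set of irreducible representations; it fixes the order of
  the summands in the direct sums over that set.
\<close>

definition isotypic_sum ::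
    "'a mrep list \<Rightarrow> ('a mrep \<Rightarrow> nat) \<Rightarrow> ('a mrep \<Rightarrow> complex mat) \<Rightarrow> complex mat" where
  "isotypic_sum Rs m A = diag_block_mat (concat (map (\<lambda>\<rho>. replicate (m \<rho>) (A \<rho>)) Rs))"

text \<open>
  The multiplicities \<open>m\<close> are determined by the decomposition below, since the
  multiplicities in a decomposition into irreducibles are unique. The equation between degrees
  states that the matrix products are well-typed (matrix multiplication is total here).
\<close>

definition clebsch_gordan ::
    "('a, 'b) monoid_scheme \<Rightarrow> 'a mrep list \<Rightarrow> ('a mrep \<Rightarrow> 'a mrep \<Rightarrow> 'a mrep \<Rightarrow> nat) \<Rightarrow>
     ('a mrep \<Rightarrow> 'a mrep \<Rightarrow> complex mat) \<Rightarrow> bool" where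
  "clebsch_gordan G Rs m C \<longleftrightarrow> (\<forall>\<rho>\<^sub>1\<in>set Rs. \<forall>\<rho>\<^sub>2\<in>set Rs.
     (\<Sum>\<rho>\<leftarrow>Rs. m \<rho>\<^sub>1 \<rho>\<^sub>2 \<rho> * rep_degree G \<rho>) = rep_degree G \<rho>\<^sub>1 * rep_degree G \<rho>\<^sub>2 \<and>
     unitary_mat (rep_degree G \<rho>\<^sub>1 * rep_degree G \<rho>\<^sub>2) (C \<rho>\<^sub>1 \<rho>\<^sub>2) \<and>
     (\<forall>x\<in>carrier G. \<rho>\<^sub>1 x \<otimes>\<^sub>k \<rho>\<^sub>2 x =
        C \<rho>\<^sub>1 \<rho>\<^sub>2 * isotypic_sum Rs (m \<rho>\<^sub>1 \<rho>\<^sub>2) (\<lambda>\<rho>. \<rho> x) * mat_adjoint (C \<rho>\<^sub>1 \<rho>\<^sub>2)))"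

definition bispectrum ::
    "('a, 'b) monoid_scheme \<Rightarrow> 'a mrep list \<Rightarrow> ('a mrep \<Rightarrow> 'a mrep \<Rightarrow> 'a mrep \<Rightarrow> nat) \<Rightarrow>
     ('a mrep \<Rightarrow> 'a mrep \<Rightarrow> complex mat) \<Rightarrow> ('a \<Rightarrow> complex) \<Rightarrow> 'a mrep \<Rightarrow> 'a mrep \<Rightarrow> complex mat" where
  "bispectrum G Rs m C f \<rho>\<^sub>1 \<rho>\<^sub>2 =
     mat_adjoint (fourier G f \<rho>\<^sub>1 \<otimes>\<^sub>k fourier G f \<rho>\<^sub>2) *
     (C \<rho>\<^sub>1 \<rho>\<^sub>2 * isotypic_sum Rs (m \<rho>\<^sub>1 \<rho>\<^sub>2) (fourier G f) * mat_adjoint (C \<rho>\<^sub>1 \<rho>\<^sub>2))"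

definition triple_correlation ::
    "('a, 'b) monoid_scheme \<Rightarrow> ('a \<Rightarrow> complex) \<Rightarrow> 'a \<times> 'a \<Rightarrow> complex" where
  "triple_correlation G f = (\<lambda>(x\<^sub>1, x\<^sub>2). \<Sum>y\<in>carrier G.
     cnj (f (y \<otimes>\<^bsub>G\<^esub> inv\<^bsub>G\<^esub> x\<^sub>1)) * cnj (f (y \<otimes>\<^bsub>G\<^esub> inv\<^bsub>G\<^esub> x\<^sub>2)) * f y)"

definition left_slice ::
    "('a, 'b) monoid_scheme \<Rightarrow> 'a \<Rightarrow> ('a \<times> 'a \<Rightarrow> complex) \<Rightarrow> 'a \<Rightarrow> complex" where
  "left_slice G z g x = g (x, z \<otimes>\<^bsub>G\<^esub> x)"

definition skew_spectrum ::
    "('a, 'b) monoid_scheme \<Rightarrow> ('a \<Rightarrow> complex) \<Rightarrow> 'a \<Rightarrow> 'a mrep \<Rightarrow> complex mat" where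
  "skew_spectrum G f z \<rho> =
     mat_adjoint (fourier G (\<lambda>x. f x * f (x \<otimes>\<^bsub>G\<^esub> z)) \<rho>) * fourier G f \<rho>"

definition skew_correlation ::
    "('a, 'b) monoid_scheme \<Rightarrow> ('a \<Rightarrow> complex) \<Rightarrow> 'a \<Rightarrow> 'a \<Rightarrow> complex" where
  "skew_correlation G f z x = (\<Sum>y\<in>carrier G.
     cnj (f (y \<otimes>\<^bsub>G\<^esub> inv\<^bsub>G\<^esub> x)) * cnj (f (y \<otimes>\<^bsub>G\<^esub> inv\<^bsub>G\<^esub> x \<otimes>\<^bsub>G\<^esub> z)) * f y)"

end

(*
  Passing from g on G x G to its slices g(x, z^-1 x) merely rearranges values, hence is unitary
  for the normalised norms; conjugating with the Fourier transforms of G x G and of G gives U,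
  once both transforms are known to be unitary. Schur orthogonality of the matrix coefficients
  yields surjectivity and the norm identity, so only injectivity is needed in addition. The
  bracket in the bispectrum is the Fourier transform over G x G of f placed on the diagonal, so
  the bispectrum and the skew spectrum are both Fourier transforms of cross-correlations.
*)

theory Submission
  imports Defs "Jordan_Normal_Form.Spectral_Radius"
begin

section \<open>Adjoints, isometries and sums of matrices\<close>


text \<open>Unitarity has to hold on the whole space of matrix families over the product group, not
  just on spectra that come from some \<open>f\<close>. Inversion and Plancherel are therefore
  proved for arbitrary families. They rest on two facts, orthogonality of the matrix coefficients
  and injectivity of the transform, and both pass to tensor products by treating one coordinate at a
  time; the argument made for \<open>G\<close> thereby serves \<open>G \<times>\<times> G\<close> as
  well. Injectivity on \<open>G\<close> depends on finding an irreducible constituent inside a given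
  invariant space. Since representations are matrix valued, subspaces are handled as isometries
  \<open>A\<close> whose columns form an orthonormal basis, and compressing the action by
  \<open>A\<close> and its adjoint turns a minimal invariant subspace into a matrix representation
  again, to which completeness of \<open>R\<close> applies.\<close>

lemma mat_adjoint_dim [simp]:
  "dim_row (mat_adjoint A) = dim_col A" "dim_col (mat_adjoint A) = dim_row A"
  by (auto simp: mat_adjoint_def)

lemma mat_adjoint_index [simp]:
  fixes A :: "complex mat"
  assumes "i < dim_col A" "j < dim_row A"
  shows "mat_adjoint A $$ (i, j) = cnj (A $$ (j, i))"
  using assms by (simp add: mat_adjoint_def mat_of_rows_index)

lemma mat_adjoint_carrier [simp]:
  "A \<in> carrier_mat n m \<Longrightarrow> mat_adjoint A \<in> carrier_mat m n"
  by (metis carrier_matD carrier_matI mat_adjoint_dim)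

lemma mat_adjoint_mult:
  fixes A B :: "complex mat"
  assumes "A \<in> carrier_mat n m" "B \<in> carrier_mat m k"
  shows "mat_adjoint (A * B) = mat_adjoint B * mat_adjoint A"
  using assms by (intro eq_matI) (auto simp: scalar_prod_def mult.commute)

lemma mat_adjoint_smult:
  fixes A :: "complex mat"
  shows "mat_adjoint (c \<cdot>\<^sub>m A) = cnj c \<cdot>\<^sub>m mat_adjoint A"
  by (intro eq_matI) auto

lemma mat_eqI_mult_vec:
  fixes A B :: "complex mat"
  assumes A: "A \<in> carrier_mat n m" and B: "B \<in> carrier_mat n m"
    and eq: "\<And>v. v \<in> carrier_vec m \<Longrightarrow> A *\<^sub>v v = B *\<^sub>v v"
  shows "A = B"
proof (rule eq_matI)
  fix i j assume ij: "i < dim_row B" "j < dim_col B"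
  have "(A *\<^sub>v unit_vec m j) $ i = (B *\<^sub>v unit_vec m j) $ i" by (simp add: eq)
  then show "A $$ (i, j) = B $$ (i, j)" using A B ij by simp
qed (use A B in auto)

section \<open>Subspaces and their orthonormal bases\<close>

lemma subspace_vec_iff:
  "VectorSpace.subspace class_ring W (module_vec TYPE(complex) n) \<longleftrightarrow>
     W \<subseteq> carrier_vec n \<and> 0\<^sub>v n \<in> W \<and> (\<forall>v\<in>W. \<forall>w\<in>W. v + w \<in> W) \<and> (\<forall>c. \<forall>v\<in>W. c \<cdot>\<^sub>v v \<in> W)"
proof -
  interpret vec_space "TYPE(complex)" n .
  show ?thesis
    unfolding VectorSpace.subspace_def submodule_def
    using vectorspace_axioms module_axioms
    by (auto simp: module_vec_def class_ring_simps)
qed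

text \<open>Padding \<open>A\<close> with zero rows would make a square \<open>B\<close> with the
  same Gram matrix. A square left inverse is also a right inverse, but row \<open>n\<close> of
  \<open>B\<close> is zero, so the diagonal entry of \<open>B * mat_adjoint B\<close> there cannot
  be 1.\<close>

lemma isometry_cols_le:
  fixes A :: "complex mat"
  assumes A: "A \<in> carrier_mat n k" and iso: "mat_adjoint A * A = 1\<^sub>m k"
  shows "k \<le> n"
proof (rule ccontr)
  assume "\<not> k \<le> n"
  then have kn: "n < k" by simp
  define B where "B = mat k k (\<lambda>(i, j). if i < n then A $$ (i, j) else 0)"
  have B: "B \<in> carrier_mat k k" by (simp add: B_def)
  have "mat_adjoint B * B = mat_adjoint A * A"
  proof (rule eq_matI)
    fix i j assume "i < dim_row (mat_adjoint A * A)" "j < dim_col (mat_adjoint A * A)"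
    then have ij: "i < k" "j < k" using A by auto
    have "(mat_adjoint B * B) $$ (i, j) = (\<Sum>l<k. cnj (B $$ (l, i)) * B $$ (l, j))"
      using B ij by (simp add: scalar_prod_def atLeast0LessThan)
    also have "\<dots> = (\<Sum>l<n. cnj (A $$ (l, i)) * A $$ (l, j))"
      using ij kn by (intro sum.mono_neutral_cong_right) (auto simp: B_def)
    also have "\<dots> = (mat_adjoint A * A) $$ (i, j)"
      using A ij by (simp add: scalar_prod_def atLeast0LessThan)
    finally show "(mat_adjoint B * B) $$ (i, j) = (mat_adjoint A * A) $$ (i, j)" .
  qed (use A B in auto)
  then have "B * mat_adjoint B = 1\<^sub>m k"
    using mat_mult_left_right_inverse[of "mat_adjoint B" k B] B iso by simp
  then have "(B * mat_adjoint B) $$ (n, n) = 1" using kn by simp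
  moreover have "(B * mat_adjoint B) $$ (n, n) = 0"
    using kn B by (simp add: scalar_prod_def) (simp add: B_def)
  ultimately show False by simp
qed

text \<open>Gram-Schmidt by maximality: among the isometries with range inside \<open>W\<close>,
  whose column count is bounded by \<open>n\<close>, one with most columns must reach all of
  \<open>W\<close>. Otherwise the component of some \<open>w\<close> orthogonal to the range, once
  normalised, would serve as one more column. With the basis kept as the columns of
  \<open>A\<close>, coordinates are \<open>mat_adjoint A *\<^sub>v w\<close>.\<close>

lemma subspace_orthonormal_basis:
  assumes "VectorSpace.subspace class_ring W (module_vec TYPE(complex) n)"
  obtains k A where "A \<in> carrier_mat n k" "mat_adjoint A * A = 1\<^sub>m k"
    "W = {A *\<^sub>v v | v. v \<in> carrier_vec k}"
proof -
  have sub: "W \<subseteq> carrier_vec n" and zero: "0\<^sub>v n \<in> W"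
    and add: "\<And>v w. v \<in> W \<Longrightarrow> w \<in> W \<Longrightarrow> v + w \<in> W"
    and smult: "\<And>c v. v \<in> W \<Longrightarrow> c \<cdot>\<^sub>v v \<in> W"
    using assms unfolding subspace_vec_iff by auto
  let ?P = "\<lambda>k. \<exists>A\<in>carrier_mat n k. mat_adjoint A * A = 1\<^sub>m k \<and> (\<forall>v\<in>carrier_vec k. A *\<^sub>v v \<in> W)"
  \<comment> \<open>The empty basis, an \<open>n\<close> by 0 matrix, ensures that some column count
    is attained.\<close>
  have "?P 0"
  proof (intro bexI[of _ "0\<^sub>m n 0"] conjI ballI)
    fix v :: "complex vec" assume "v \<in> carrier_vec 0"
    then have "0\<^sub>m n 0 *\<^sub>v v = 0\<^sub>v n" by (intro eq_vecI) (auto simp: scalar_prod_def)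
    then show "0\<^sub>m n 0 *\<^sub>v v \<in> W" using zero by simp
  qed auto
  then have "?P (Greatest ?P)"
    by (rule GreatestI_nat[where b = n]) (auto intro: isometry_cols_le)
  then obtain k A where k: "k = Greatest ?P" and A: "A \<in> carrier_mat n k"
    and iso: "mat_adjoint A * A = 1\<^sub>m k" and rng: "\<And>v. v \<in> carrier_vec k \<Longrightarrow> A *\<^sub>v v \<in> W"
    by blast
  have max: "j \<le> k" if "?P j" for j
    unfolding k using that by (rule Greatest_le_nat[where b = n]) (auto intro: isometry_cols_le)
  have "w \<in> {A *\<^sub>v v | v. v \<in> carrier_vec k}" if w: "w \<in> W" for w
  proof (rule ccontr)
    assume notin: "w \<notin> {A *\<^sub>v v | v. v \<in> carrier_vec k}"
    have wc: "w \<in> carrier_vec n" using w sub by auto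
    define v where "v = mat_adjoint A *\<^sub>v w"
    have v: "v \<in> carrier_vec k" unfolding v_def by (rule mult_mat_vec_carrier[OF mat_adjoint_carrier[OF A] wc])
    \<comment> \<open>Residue of \<open>w\<close> after orthogonal projection onto the range of
      \<open>A\<close>; it is orthogonal to every column, and non-zero because \<open>w\<close> lies
      outside that range.\<close>
    define u where "u = w + (-1) \<cdot>\<^sub>v (A *\<^sub>v v)"
    have uW: "u \<in> W" unfolding u_def using add smult rng w v by auto
    have uc: "u \<in> carrier_vec n" using uW sub by auto
    have Au: "mat_adjoint A *\<^sub>v u = 0\<^sub>v k"
    proof -
      have "mat_adjoint A *\<^sub>v (A *\<^sub>v v) = v"
        using A v iso by (metis assoc_mult_mat_vec mat_adjoint_carrier one_mult_mat_vec)
      moreover have "mat_adjoint A *\<^sub>v u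
          = mat_adjoint A *\<^sub>v w + (-1) \<cdot>\<^sub>v (mat_adjoint A *\<^sub>v (A *\<^sub>v v))"
        unfolding u_def using A wc v
        by (subst mult_add_distrib_mat_vec[of _ k n]) (auto simp: mult_mat_vec[of _ k n])
      ultimately show ?thesis using v by (intro eq_vecI) (auto simp: v_def[symmetric])
    qed
    have une: "u \<noteq> 0\<^sub>v n"
    proof
      assume u0: "u = 0\<^sub>v n"
      have "w = A *\<^sub>v v"
      proof (rule eq_vecI)
        fix i assume i: "i < dim_vec (A *\<^sub>v v)"
        then have "u $ i = 0" using u0 A by simp
        then show "w $ i = (A *\<^sub>v v) $ i" using i A wc by (simp add: u_def)
      qed (use A wc in auto)
      then show False using notin v by auto
    qed
    define s where "s = (\<Sum>i<n. (cmod (u $ i))\<^sup>2)"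
    have "s > 0"
    proof -
      obtain i where "i < n" "u $ i \<noteq> 0" using une uc by (metis carrier_vecD eq_vecI index_zero_vec)
      then show ?thesis unfolding s_def by (intro sum_pos2[of _ i]) auto
    qed
    \<comment> \<open>Dividing by the norm of \<open>u\<close> gives the new last column of
      \<open>B\<close> length one.\<close>
    define c where "c = complex_of_real (1 / sqrt s)"
    define B where "B = mat n (Suc k) (\<lambda>(i, j). if j < k then A $$ (i, j) else c * u $ i)"
    have B: "B \<in> carrier_mat n (Suc k)" by (simp add: B_def)
    have orth: "(\<Sum>l<n. cnj (A $$ (l, i)) * u $ l) = 0" if "i < k" for i
    proof -
      have "(mat_adjoint A *\<^sub>v u) $ i = 0" using Au that by simp
      then show ?thesis using that A uc by (simp add: scalar_prod_def atLeast0LessThan)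
    qed
    then have orth': "(\<Sum>l<n. cnj (u $ l) * A $$ (l, i)) = 0" if "i < k" for i
    proof -
      have "cnj (\<Sum>l<n. cnj (A $$ (l, i)) * u $ l) = 0" using orth[OF that] by simp
      then show ?thesis by (simp add: mult.commute)
    qed
    have unit: "(\<Sum>l<n. cnj (c * u $ l) * (c * u $ l)) = 1"
    proof -
      have "(\<Sum>l<n. cnj (c * u $ l) * (c * u $ l)) = (\<Sum>l<n. cnj c * c * complex_of_real ((cmod (u $ l))\<^sup>2))"
        by (intro sum.cong refl) (simp add: complex_norm_square algebra_simps del: of_real_power)
      also have "\<dots> = cnj c * c * complex_of_real s" by (simp add: s_def sum_distrib_left)
      also have "\<dots> = complex_of_real (1 / sqrt s * (1 / sqrt s) * s)"
        by (simp only: c_def complex_cnj_complex_of_real of_real_mult)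
      also have "\<dots> = 1" using \<open>s > 0\<close> by simp
      finally show ?thesis .
    qed
    have "mat_adjoint B * B = 1\<^sub>m (Suc k)"
    proof (rule eq_matI)
      fix i j assume "i < dim_row (1\<^sub>m (Suc k) :: complex mat)" "j < dim_col (1\<^sub>m (Suc k) :: complex mat)"
      then have ij: "i < Suc k" "j < Suc k" by auto
      have *: "(mat_adjoint B * B) $$ (i, j) = (\<Sum>l<n. cnj (B $$ (l, i)) * B $$ (l, j))"
        using B ij by (simp add: scalar_prod_def atLeast0LessThan)
      have AA: "(\<Sum>l<n. cnj (A $$ (l, i)) * A $$ (l, j)) = (if i = j then 1 else 0)"
        if "i < k" "j < k"
      proof -
        have "(mat_adjoint A * A) $$ (i, j) = (if i = j then 1 else 0)" using that by (simp add: iso)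
        then show ?thesis using that A by (simp add: scalar_prod_def atLeast0LessThan)
      qed
      have "(\<Sum>l<n. cnj (B $$ (l, i)) * B $$ (l, j)) = (if i = j then 1 else 0)"
      proof (cases "i < k"; cases "j < k")
        assume "i < k" "j < k"
        then show ?thesis using AA by (simp add: B_def)
      next
        assume "i < k" "\<not> j < k"
        then have "(\<Sum>l<n. cnj (B $$ (l, i)) * B $$ (l, j)) = c * (\<Sum>l<n. cnj (A $$ (l, i)) * u $ l)"
          using ij by (simp add: B_def sum_distrib_left algebra_simps)
        then show ?thesis using orth \<open>i < k\<close> \<open>\<not> j < k\<close> by simp
      next
        assume "\<not> i < k" "j < k"
        then have "(\<Sum>l<n. cnj (B $$ (l, i)) * B $$ (l, j)) = cnj c * (\<Sum>l<n. cnj (u $ l) * A $$ (l, j))"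
          using ij by (simp add: B_def sum_distrib_left algebra_simps)
        then show ?thesis using orth' \<open>\<not> i < k\<close> \<open>j < k\<close> by simp
      next
        assume "\<not> i < k" "\<not> j < k"
        then show ?thesis using unit ij by (simp add: B_def)
      qed
      then show "(mat_adjoint B * B) $$ (i, j) = 1\<^sub>m (Suc k) $$ (i, j)" using * ij by simp
    qed (use B in auto)
    moreover have "B *\<^sub>v x \<in> W" if x: "x \<in> carrier_vec (Suc k)" for x
    proof -
      define y where "y = vec k (\<lambda>i. x $ i)"
      have "B *\<^sub>v x = A *\<^sub>v y + (c * x $ k) \<cdot>\<^sub>v u"
        using A B x uc
        by (intro eq_vecI) (auto simp: scalar_prod_def y_def B_def mult.commute mult.left_commute)
      then show ?thesis using add smult rng uW by (simp add: y_def)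
    qed
    ultimately have "?P (Suc k)" using B by blast
    then show False using max by fastforce
  qed
  then have "W = {A *\<^sub>v v | v. v \<in> carrier_vec k}" using rng by blast
  then show ?thesis using that A iso by blast
qed


text \<open>Matrices of every size share one type, so an empty sum has no canonical shape. The
  dimensions are therefore arguments, and the sum is taken entry by entry.\<close>

definition mat_sum :: "nat \<Rightarrow> nat \<Rightarrow> 'a set \<Rightarrow> ('a \<Rightarrow> complex mat) \<Rightarrow> complex mat" where
  "mat_sum nr nc S F = mat nr nc (\<lambda>(i, j). \<Sum>x\<in>S. F x $$ (i, j))"

lemma mat_sum_carrier [simp]: "mat_sum nr nc S F \<in> carrier_mat nr nc"
  by (simp add: mat_sum_def)

lemma mat_sum_dim [simp]: "dim_row (mat_sum nr nc S F) = nr" "dim_col (mat_sum nr nc S F) = nc"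
  by (simp_all add: mat_sum_def)

lemma mat_sum_index [simp]:
  "i < nr \<Longrightarrow> j < nc \<Longrightarrow> mat_sum nr nc S F $$ (i, j) = (\<Sum>x\<in>S. F x $$ (i, j))"
  by (simp add: mat_sum_def)

lemma mat_sum_cong [cong]:
  "nr = nr' \<Longrightarrow> nc = nc' \<Longrightarrow> S = T \<Longrightarrow> (\<And>x. x \<in> T \<Longrightarrow> F x = H x) \<Longrightarrow>
    mat_sum nr nc S F = mat_sum nr' nc' T H"
  by (auto simp: mat_sum_def)

lemma mult_mat_sum:
  assumes "M \<in> carrier_mat m nr" "\<And>x. x \<in> S \<Longrightarrow> F x \<in> carrier_mat nr nc"
  shows "M * mat_sum nr nc S F = mat_sum m nc S (\<lambda>x. M * F x)"
proof (rule eq_matI)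
  fix i j assume "i < dim_row (mat_sum m nc S (\<lambda>x. M * F x))" "j < dim_col (mat_sum m nc S (\<lambda>x. M * F x))"
  then have ij: "i < m" "j < nc" by auto
  have "(M * mat_sum nr nc S F) $$ (i, j) = (\<Sum>k<nr. M $$ (i, k) * (\<Sum>x\<in>S. F x $$ (k, j)))"
    using assms ij by (simp add: scalar_prod_def atLeast0LessThan)
  also have "\<dots> = (\<Sum>x\<in>S. \<Sum>k<nr. M $$ (i, k) * F x $$ (k, j))"
    by (simp add: sum_distrib_left sum.swap[of _ S])
  also have "\<dots> = mat_sum m nc S (\<lambda>x. M * F x) $$ (i, j)"
    using assms(1) assms(2)[THEN carrier_matD(1)] assms(2)[THEN carrier_matD(2)] ij
    by (simp add: scalar_prod_def atLeast0LessThan)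
  finally show "(M * mat_sum nr nc S F) $$ (i, j) = mat_sum m nc S (\<lambda>x. M * F x) $$ (i, j)" .
qed (use assms in auto)

lemma mat_sum_mult:
  assumes "M \<in> carrier_mat nc m" "\<And>x. x \<in> S \<Longrightarrow> F x \<in> carrier_mat nr nc"
  shows "mat_sum nr nc S F * M = mat_sum nr m S (\<lambda>x. F x * M)"
proof (rule eq_matI)
  fix i j assume "i < dim_row (mat_sum nr m S (\<lambda>x. F x * M))" "j < dim_col (mat_sum nr m S (\<lambda>x. F x * M))"
  then have ij: "i < nr" "j < m" by auto
  have "(mat_sum nr nc S F * M) $$ (i, j) = (\<Sum>k<nc. (\<Sum>x\<in>S. F x $$ (i, k)) * M $$ (k, j))"
    using assms ij by (simp add: scalar_prod_def atLeast0LessThan)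
  also have "\<dots> = (\<Sum>x\<in>S. \<Sum>k<nc. F x $$ (i, k) * M $$ (k, j))"
    by (simp add: sum_distrib_right sum.swap[of _ S])
  also have "\<dots> = mat_sum nr m S (\<lambda>x. F x * M) $$ (i, j)"
    using assms(1) assms(2)[THEN carrier_matD(1)] assms(2)[THEN carrier_matD(2)] ij
    by (simp add: scalar_prod_def atLeast0LessThan)
  finally show "(mat_sum nr nc S F * M) $$ (i, j) = mat_sum nr m S (\<lambda>x. F x * M) $$ (i, j)" .
qed (use assms in auto)

lemma mat_adjoint_mat_sum:
  assumes "\<And>x. x \<in> S \<Longrightarrow> F x \<in> carrier_mat nr nc"
  shows "mat_adjoint (mat_sum nr nc S F) = mat_sum nc nr S (\<lambda>x. mat_adjoint (F x))"
  using assms[THEN carrier_matD(1)] assms[THEN carrier_matD(2)] by (intro eq_matI) auto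

lemma mat_sum_bij_betw:
  assumes "bij_betw h S T"
  shows "mat_sum nr nc S (\<lambda>x. F (h x)) = mat_sum nr nc T F"
  unfolding mat_sum_def
  by (rule arg_cong[where f = "mat nr nc"]) (auto simp: fun_eq_iff sum.reindex_bij_betw[OF assms, symmetric])


section \<open>Representations\<close>

lemma representation_carrier:
  assumes "representation G \<rho>" "x \<in> carrier G"
  shows "\<rho> x \<in> carrier_mat (rep_degree G \<rho>) (rep_degree G \<rho>)"
  using assms unfolding representation_def hom_def units_of_def Units_def ring_mat_def by auto

lemma representation_mult:
  assumes "representation G \<rho>" "x \<in> carrier G" "y \<in> carrier G"
  shows "\<rho> (x \<otimes>\<^bsub>G\<^esub> y) = \<rho> x * \<rho> y"
  using assms unfolding representation_def hom_def units_of_def ring_mat_def by auto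

text \<open>Being a homomorphism into the units makes \<open>\<rho> \<one>\<close> an invertible
  idempotent, hence the identity.\<close>

lemma representation_one:
  assumes "group G" "representation G \<rho>"
  shows "\<rho> \<one>\<^bsub>G\<^esub> = 1\<^sub>m (rep_degree G \<rho>)"
proof -
  interpret group G by fact
  let ?n = "rep_degree G \<rho>"
  have c: "\<rho> \<one>\<^bsub>G\<^esub> \<in> carrier_mat ?n ?n" using representation_carrier[OF assms(2) one_closed] .
  obtain B where B: "B \<in> carrier_mat ?n ?n" "B * \<rho> \<one>\<^bsub>G\<^esub> = 1\<^sub>m ?n"
  proof -
    have "\<rho> \<one>\<^bsub>G\<^esub> \<in> Units (ring_mat TYPE(complex) ?n ())"
      using assms(2) by (auto simp: representation_def hom_def units_of_def)
    then show ?thesis using that by (auto simp: Units_def ring_mat_simps)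
  qed
  have "\<rho> \<one>\<^bsub>G\<^esub> = (B * \<rho> \<one>\<^bsub>G\<^esub>) * \<rho> \<one>\<^bsub>G\<^esub>" using B c by simp
  also have "\<dots> = B * (\<rho> \<one>\<^bsub>G\<^esub> * \<rho> \<one>\<^bsub>G\<^esub>)" by (rule assoc_mult_mat[OF B(1) c c])
  also have "\<rho> \<one>\<^bsub>G\<^esub> * \<rho> \<one>\<^bsub>G\<^esub> = \<rho> \<one>\<^bsub>G\<^esub>"
    using representation_mult[OF assms(2), of "\<one>\<^bsub>G\<^esub>" "\<one>\<^bsub>G\<^esub>"] by simp
  finally show ?thesis using B(2) by simp
qed

text \<open>Invertibility of each \<open>\<rho> x\<close> follows from multiplicativity, with
  \<open>\<rho> (inv x)\<close> as the inverse.\<close>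

lemma representationI:
  assumes "group G"
    and car: "\<And>x. x \<in> carrier G \<Longrightarrow> \<rho> x \<in> carrier_mat n n"
    and mult: "\<And>x y. x \<in> carrier G \<Longrightarrow> y \<in> carrier G \<Longrightarrow> \<rho> (x \<otimes>\<^bsub>G\<^esub> y) = \<rho> x * \<rho> y"
    and one: "\<rho> \<one>\<^bsub>G\<^esub> = 1\<^sub>m n"
  shows "representation G \<rho>" and "rep_degree G \<rho> = n"
proof -
  interpret group G by fact
  show n: "rep_degree G \<rho> = n" using one by (simp add: rep_degree_def)
  have "\<rho> x \<in> Units (ring_mat TYPE(complex) n ())" if "x \<in> carrier G" for x
  proof -
    have "\<rho> (inv\<^bsub>G\<^esub> x) * \<rho> x = 1\<^sub>m n" "\<rho> x * \<rho> (inv\<^bsub>G\<^esub> x) = 1\<^sub>m n"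
      using mult[of "inv\<^bsub>G\<^esub> x" x] mult[of x "inv\<^bsub>G\<^esub> x"] that one by auto
    then show ?thesis using car that unfolding Units_def ring_mat_def by auto
  qed
  then show "representation G \<rho>"
    unfolding representation_def n hom_def units_of_def using mult by (auto simp: ring_mat_def)
qed

section \<open>Fourier transform: linearity, translations and adjoints\<close>

lemma fourier_carrier [simp]: "fourier G g \<rho> \<in> carrier_mat (rep_degree G \<rho>) (rep_degree G \<rho>)"
  by (simp add: fourier_def)

lemma fourier_dim [simp]:
  "dim_row (fourier G g \<rho>) = rep_degree G \<rho>" "dim_col (fourier G g \<rho>) = rep_degree G \<rho>"
  by (simp_all add: fourier_def)

lemma fourier_eq_mat_sum:
  assumes "\<And>x. x \<in> carrier G \<Longrightarrow> \<rho> x \<in> carrier_mat (rep_degree G \<rho>) (rep_degree G \<rho>)"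
  shows "fourier G g \<rho> = mat_sum (rep_degree G \<rho>) (rep_degree G \<rho>) (carrier G) (\<lambda>x. g x \<cdot>\<^sub>m \<rho> x)"
  using assms[THEN carrier_matD(1)] assms[THEN carrier_matD(2)]
  by (intro eq_matI) (auto simp: fourier_def mult.commute)

lemma fourier_cong:
  assumes "\<And>x. x \<in> carrier G \<Longrightarrow> g x = h x"
  shows "fourier G g \<rho> = fourier G h \<rho>"
  using assms by (intro eq_matI) (auto simp: fourier_def)

lemma fourier_add: "fourier G (\<lambda>x. g x + h x) \<rho> = fourier G g \<rho> + fourier G h \<rho>"
  by (intro eq_matI) (auto simp: fourier_def algebra_simps sum.distrib)

lemma fourier_smult: "fourier G (\<lambda>x. c * g x) \<rho> = c \<cdot>\<^sub>m fourier G g \<rho>"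
  by (intro eq_matI) (auto simp: fourier_def sum_distrib_left algebra_simps)

text \<open>Reindexing the sum by left multiplication with \<open>x\<close> splits off the factor
  \<open>\<rho> x\<close>. As a consequence, the functions whose transform vanishes at
  \<open>\<rho>\<close> form a translation-invariant space.\<close>

lemma fourier_translate:
  assumes "group G" "representation G \<rho>" "x \<in> carrier G"
  shows "fourier G (\<lambda>y. g (inv\<^bsub>G\<^esub> x \<otimes>\<^bsub>G\<^esub> y)) \<rho> = \<rho> x * fourier G g \<rho>"
proof -
  interpret group G by fact
  let ?d = "rep_degree G \<rho>"
  note car = representation_carrier[OF assms(2)]
  have bij: "bij_betw (\<lambda>y. x \<otimes>\<^bsub>G\<^esub> y) (carrier G) (carrier G)"
    by (rule bij_betw_byWitness[where f' = "\<lambda>y. inv\<^bsub>G\<^esub> x \<otimes>\<^bsub>G\<^esub> y"])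
      (use assms(3) in \<open>auto simp: m_assoc[symmetric]\<close>)
  have "fourier G (\<lambda>y. g (inv\<^bsub>G\<^esub> x \<otimes>\<^bsub>G\<^esub> y)) \<rho>
      = mat_sum ?d ?d (carrier G) (\<lambda>y. g (inv\<^bsub>G\<^esub> x \<otimes>\<^bsub>G\<^esub> y) \<cdot>\<^sub>m \<rho> y)"
    by (rule fourier_eq_mat_sum) (rule car)
  also have "\<dots> = mat_sum ?d ?d (carrier G)
      (\<lambda>y. g (inv\<^bsub>G\<^esub> x \<otimes>\<^bsub>G\<^esub> (x \<otimes>\<^bsub>G\<^esub> y)) \<cdot>\<^sub>m \<rho> (x \<otimes>\<^bsub>G\<^esub> y))"
    by (rule mat_sum_bij_betw[OF bij, symmetric])
  also have "\<dots> = mat_sum ?d ?d (carrier G) (\<lambda>y. \<rho> x * (g y \<cdot>\<^sub>m \<rho> y))"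
  proof (intro mat_sum_cong refl)
    fix y assume y: "y \<in> carrier G"
    show "g (inv\<^bsub>G\<^esub> x \<otimes>\<^bsub>G\<^esub> (x \<otimes>\<^bsub>G\<^esub> y)) \<cdot>\<^sub>m \<rho> (x \<otimes>\<^bsub>G\<^esub> y) = \<rho> x * (g y \<cdot>\<^sub>m \<rho> y)"
      using y assms(3) car[OF y] car[OF assms(3)]
      by (simp add: m_assoc[symmetric] representation_mult[OF assms(2)] mult_smult_distrib[of _ ?d ?d])
  qed
  also have "\<dots> = \<rho> x * fourier G g \<rho>"
    using car assms(3) by (simp add: fourier_eq_mat_sum mult_mat_sum[of _ ?d])
  finally show ?thesis .
qed

text \<open>The involution of the group algebra becomes the matrix adjoint: reindex by inversion and
  use that \<open>\<rho> (inv x)\<close> is the adjoint of \<open>\<rho> x\<close>.\<close>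

lemma fourier_adjoint:
  assumes "group G" "unitary_rep G \<rho>"
  shows "fourier G (\<lambda>x. cnj (g (inv\<^bsub>G\<^esub> x))) \<rho> = mat_adjoint (fourier G g \<rho>)"
proof -
  interpret group G by fact
  let ?d = "rep_degree G \<rho>"
  have rep: "representation G \<rho>" using assms(2) by (simp add: unitary_rep_def)
  note car = representation_carrier[OF rep]
  have bij: "bij_betw (\<lambda>y. inv\<^bsub>G\<^esub> y) (carrier G) (carrier G)"
    by (rule bij_betw_byWitness[where f' = "\<lambda>y. inv\<^bsub>G\<^esub> y"]) auto
  have "fourier G (\<lambda>x. cnj (g (inv\<^bsub>G\<^esub> x))) \<rho>
      = mat_sum ?d ?d (carrier G) (\<lambda>x. cnj (g (inv\<^bsub>G\<^esub> x)) \<cdot>\<^sub>m \<rho> x)"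
    by (rule fourier_eq_mat_sum) (rule car)
  also have "\<dots> = mat_sum ?d ?d (carrier G) (\<lambda>x. cnj (g (inv\<^bsub>G\<^esub> (inv\<^bsub>G\<^esub> x))) \<cdot>\<^sub>m \<rho> (inv\<^bsub>G\<^esub> x))"
    by (rule mat_sum_bij_betw[OF bij, symmetric])
  also have "\<dots> = mat_sum ?d ?d (carrier G) (\<lambda>x. mat_adjoint (g x \<cdot>\<^sub>m \<rho> x))"
    using assms(2) by (intro mat_sum_cong refl) (simp add: unitary_rep_def mat_adjoint_smult)
  also have "\<dots> = mat_adjoint (fourier G g \<rho>)"
    using car by (simp add: fourier_eq_mat_sum mat_adjoint_mat_sum)
  finally show ?thesis .
qed

section \<open>Irreducible subrepresentations described by isometries\<close>

lemma isometry_left_inverse: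
  fixes A :: "complex mat"
  assumes A: "A \<in> carrier_mat n k" and iso: "mat_adjoint A * A = 1\<^sub>m k"
    and v: "v \<in> carrier_vec k"
  shows "mat_adjoint A *\<^sub>v (A *\<^sub>v v) = v"
  using assoc_mult_mat_vec[OF mat_adjoint_carrier[OF A] A v] iso v by simp

text \<open>\<open>A * mat_adjoint A\<close> is the orthogonal projection onto the range of
  \<open>A\<close>, so it fixes \<open>M * A\<close> once \<open>M\<close> preserves that range. The
  compression \<open>mat_adjoint A * (M * A)\<close> is then the matrix of the restricted map in the
  basis of columns.\<close>

lemma isometry_invariant_range:
  fixes A :: "complex mat"
  assumes A: "A \<in> carrier_mat n k" and iso: "mat_adjoint A * A = 1\<^sub>m k"
    and M: "M \<in> carrier_mat n n"
    and inv: "\<And>v. v \<in> carrier_vec k \<Longrightarrow> \<exists>w\<in>carrier_vec k. M *\<^sub>v (A *\<^sub>v v) = A *\<^sub>v w"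
  shows "M * A = A * (mat_adjoint A * (M * A))"
proof (rule mat_eqI_mult_vec)
  note A' = mat_adjoint_carrier[OF A]
  note MA = mult_carrier_mat[OF M A]
  fix v :: "complex vec" assume v: "v \<in> carrier_vec k"
  then obtain w where w: "w \<in> carrier_vec k" "M *\<^sub>v (A *\<^sub>v v) = A *\<^sub>v w" using inv by blast
  have "(M * A) *\<^sub>v v = A *\<^sub>v w" using assoc_mult_mat_vec[OF M A v] w by simp
  moreover have "(mat_adjoint A * (M * A)) *\<^sub>v v = w"
    using assoc_mult_mat_vec[OF A' MA v] \<open>(M * A) *\<^sub>v v = A *\<^sub>v w\<close>
      isometry_left_inverse[OF A iso w(1)] by simp
  ultimately show "(M * A) *\<^sub>v v = (A * (mat_adjoint A * (M * A))) *\<^sub>v v"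
    using assoc_mult_mat_vec[OF A mult_carrier_mat[OF A' MA] v] by simp
qed (use A M in auto)

text \<open>A non-zero invariant subspace of \<open>W\<close> of least dimension is irreducible: a
  proper non-zero invariant subspace of it would be a smaller candidate. Returning the intertwiner
  \<open>A\<close> instead of the bare subspace lets later arguments compute with the entries of
  \<open>\<sigma>\<close>.\<close>

lemma exists_irreducible_subrep:
  assumes "group G" and rep: "representation G P" and N: "rep_degree G P = N"
    and W: "VectorSpace.subspace class_ring W (module_vec TYPE(complex) N)"
    and inv: "\<And>x w. x \<in> carrier G \<Longrightarrow> w \<in> W \<Longrightarrow> P x *\<^sub>v w \<in> W"
    and nz: "W \<noteq> {0\<^sub>v N}"
  obtains \<sigma> A where "irreducible_rep G \<sigma>" "A \<in> carrier_mat N (rep_degree G \<sigma>)"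
    "mat_adjoint A * A = 1\<^sub>m (rep_degree G \<sigma>)"
    "\<And>v. v \<in> carrier_vec (rep_degree G \<sigma>) \<Longrightarrow> A *\<^sub>v v \<in> W"
    "\<And>x. x \<in> carrier G \<Longrightarrow> P x * A = A * \<sigma> x"
proof -
  interpret group G by fact
  have Pc: "P x \<in> carrier_mat N N" if "x \<in> carrier G" for x
    using representation_carrier[OF rep that] N by simp
  \<comment> \<open>An invariant subspace of dimension \<open>k\<close> inside \<open>W\<close>,
    encoded by an orthonormal basis \<open>A\<close>; the matrix \<open>S\<close> is the action of
    \<open>P x\<close> in that basis.\<close>
  let ?Q = "\<lambda>k. k > 0 \<and> (\<exists>A\<in>carrier_mat N k. mat_adjoint A * A = 1\<^sub>m k \<and>
    (\<forall>v\<in>carrier_vec k. A *\<^sub>v v \<in> W) \<and> (\<forall>x\<in>carrier G. \<exists>S\<in>carrier_mat k k. P x * A = A * S))"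
  have W0: "0\<^sub>v N \<in> W" using W by (simp add: subspace_vec_iff)
  have "\<exists>k. ?Q k"
  proof -
    obtain k A where A: "A \<in> carrier_mat N k" and iso: "mat_adjoint A * A = 1\<^sub>m k"
      and WA: "W = {A *\<^sub>v v | v. v \<in> carrier_vec k}"
      by (rule subspace_orthonormal_basis[OF W]) (rule that)
    have "k > 0"
    proof (rule ccontr)
      assume "\<not> k > 0"
      then have "A *\<^sub>v v = 0\<^sub>v N" if "v \<in> carrier_vec k" for v
        using A that by (intro eq_vecI) (auto simp: scalar_prod_def)
      then have "W \<subseteq> {0\<^sub>v N}" unfolding WA by blast
      then show False using nz W0 by blast
    qed
    moreover have "P x * A = A * (mat_adjoint A * (P x * A))" if x: "x \<in> carrier G" for x
      using inv[OF x] WA by (intro isometry_invariant_range[OF A iso Pc[OF x]]) blast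
    moreover have "mat_adjoint A * (P x * A) \<in> carrier_mat k k" if "x \<in> carrier G" for x
      using A Pc[OF that] by auto
    ultimately have "?Q k" using A iso WA by blast
    then show ?thesis ..
  qed
  then have "?Q (LEAST k. ?Q k)" by (rule LeastI_ex)
  then obtain n A where n: "n = (LEAST k. ?Q k)" and npos: "n > 0"
    and A: "A \<in> carrier_mat N n" and iso: "mat_adjoint A * A = 1\<^sub>m n"
    and AW: "\<And>v. v \<in> carrier_vec n \<Longrightarrow> A *\<^sub>v v \<in> W"
    and ex: "\<And>x. x \<in> carrier G \<Longrightarrow> \<exists>S\<in>carrier_mat n n. P x * A = A * S"
    by blast
  have least: "n \<le> k" if "?Q k" for k unfolding n using that by (rule Least_le)
  define \<sigma> where "\<sigma> x = mat_adjoint A * (P x * A)" for x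
  have \<sigma>c: "\<sigma> x \<in> carrier_mat n n" if "x \<in> carrier G" for x
    using A Pc[OF that] by (auto simp: \<sigma>_def)
  have eq: "P x * A = A * \<sigma> x" if x: "x \<in> carrier G" for x
  proof -
    \<comment> \<open>Multiplying \<open>P x * A = A * S\<close> by the adjoint of \<open>A\<close>
      shows that the compression \<open>\<sigma> x\<close> is the very matrix
      \<open>S\<close>.\<close>
    obtain S where S: "S \<in> carrier_mat n n" "P x * A = A * S" using ex[OF x] by blast
    have "\<sigma> x = mat_adjoint A * A * S"
      unfolding \<sigma>_def S using A S by (simp add: assoc_mult_mat[of _ n N _ n _ n])
    then show ?thesis using S iso by simp
  qed
  have mult: "\<sigma> (x \<otimes>\<^bsub>G\<^esub> y) = \<sigma> x * \<sigma> y" if x: "x \<in> carrier G" and y: "y \<in> carrier G" for x y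
  proof -
    have "P (x \<otimes>\<^bsub>G\<^esub> y) * A = P x * (A * \<sigma> y)"
      using A Pc[OF x] Pc[OF y] eq[OF y] representation_mult[OF rep x y] by simp
    also have "\<dots> = A * \<sigma> x * \<sigma> y"
      using A Pc[OF x] \<sigma>c[OF y] eq[OF x] by (simp add: assoc_mult_mat[symmetric, of _ N N _ n _ n])
    finally have "\<sigma> (x \<otimes>\<^bsub>G\<^esub> y) = mat_adjoint A * (A * (\<sigma> x * \<sigma> y))"
      unfolding \<sigma>_def[of "x \<otimes>\<^bsub>G\<^esub> y"] using A \<sigma>c[OF x] \<sigma>c[OF y] by simp
    also have "\<dots> = mat_adjoint A * A * (\<sigma> x * \<sigma> y)"
      using A \<sigma>c[OF x] \<sigma>c[OF y] by (simp add: assoc_mult_mat[of _ n N _ n _ n])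
    finally show ?thesis using iso \<sigma>c[OF x] \<sigma>c[OF y] by simp
  qed
  have one: "\<sigma> \<one>\<^bsub>G\<^esub> = 1\<^sub>m n"
    using representation_one[OF \<open>group G\<close> rep] A N iso by (simp add: \<sigma>_def)
  have rep\<sigma>: "representation G \<sigma>" "rep_degree G \<sigma> = n"
    using representationI[of G \<sigma> n] \<open>group G\<close> \<sigma>c mult one by blast+
  have "U = {0\<^sub>v n} \<or> U = carrier_vec n"
    if U: "VectorSpace.subspace class_ring U (module_vec TYPE(complex) n)"
      and Uinv: "\<forall>x\<in>carrier G. \<forall>w\<in>U. \<sigma> x *\<^sub>v w \<in> U" for U
  proof -
    \<comment> \<open>A \<open>\<sigma>\<close>-invariant subspace with basis \<open>B\<close> is
      carried by \<open>A\<close> to a \<open>P\<close>-invariant subspace of \<open>W\<close> with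
      basis \<open>A * B\<close>, to which the minimality of \<open>n\<close> applies.\<close>
    obtain k B where B: "B \<in> carrier_mat n k" and isoB: "mat_adjoint B * B = 1\<^sub>m k"
      and UB: "U = {B *\<^sub>v v | v. v \<in> carrier_vec k}"
      by (rule subspace_orthonormal_basis[OF U]) (rule that)
    have kn: "k \<le> n" using isometry_cols_le[OF B isoB] .
    show ?thesis
    proof (cases "k = 0")
      case True
      then have "B *\<^sub>v v = 0\<^sub>v n" if "v \<in> carrier_vec k" for v
        using B that by (intro eq_vecI) (auto simp: scalar_prod_def)
      then have "U \<subseteq> {0\<^sub>v n}" unfolding UB by blast
      then show ?thesis using U by (auto simp: subspace_vec_iff)
    next
      case False
      have AB: "A * B \<in> carrier_mat N k" using A B by simp
      have "mat_adjoint (A * B) * (A * B) = mat_adjoint B * (mat_adjoint A * A * B)"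
        using A B by (simp add: mat_adjoint_mult assoc_mult_mat[of _ k n _ N _ k]
            assoc_mult_mat[of _ n N _ n _ k])
      also have "\<dots> = 1\<^sub>m k" using iso isoB B by simp
      finally have isoAB: "mat_adjoint (A * B) * (A * B) = 1\<^sub>m k" .
      have "(A * B) *\<^sub>v v \<in> W" if "v \<in> carrier_vec k" for v
        using AW[of "B *\<^sub>v v"] A B that by (simp add: assoc_mult_mat_vec[of _ N n _ k])
      moreover have "\<exists>S\<in>carrier_mat k k. P x * (A * B) = A * B * S" if x: "x \<in> carrier G" for x
      proof
        let ?S = "mat_adjoint B * (\<sigma> x * B)"
        show S: "?S \<in> carrier_mat k k" using B \<sigma>c[OF x] by auto
        have "\<sigma> x * B = B * ?S"
          using Uinv x UB by (intro isometry_invariant_range[OF B isoB \<sigma>c[OF x]]) blast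
        moreover have "P x * (A * B) = A * (\<sigma> x * B)"
          using A B Pc[OF x] \<sigma>c[OF x] eq[OF x] by (simp add: assoc_mult_mat[symmetric, of _ N N _ n _ k])
        ultimately show "P x * (A * B) = A * B * ?S"
          using A B S by (simp add: assoc_mult_mat[of _ N n _ k _ k])
      qed
      ultimately have "?Q k" using False AB isoAB by blast
      then have "k = n" using least[of k] kn by simp
      then have "B * mat_adjoint B = 1\<^sub>m n"
        using mat_mult_left_right_inverse[of "mat_adjoint B" n B] B isoB by simp
      then have "v = B *\<^sub>v (mat_adjoint B *\<^sub>v v)" if "v \<in> carrier_vec n" for v
        using B that by (metis assoc_mult_mat_vec mat_adjoint_carrier one_mult_mat_vec)
      moreover have "mat_adjoint B *\<^sub>v v \<in> carrier_vec k" if "v \<in> carrier_vec n" for v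
        using B that by (metis mat_adjoint_carrier mult_mat_vec_carrier)
      ultimately have "carrier_vec n \<subseteq> U" unfolding UB by blast
      then show ?thesis using U by (auto simp: subspace_vec_iff)
    qed
  qed
  then have "irreducible_rep G \<sigma>"
    unfolding irreducible_rep_def rep\<sigma>(2) using rep\<sigma>(1) npos by blast
  then show thesis using that[of \<sigma> A] rep\<sigma>(2) A iso AW eq by simp
qed


section \<open>Schur orthogonality\<close>

lemma irreducible_repD:
  assumes "irreducible_rep G \<rho>"
  shows "representation G \<rho>" "rep_degree G \<rho> > 0"
    "\<And>W. VectorSpace.subspace class_ring W (module_vec TYPE(complex) (rep_degree G \<rho>)) \<Longrightarrow>
      (\<And>x w. x \<in> carrier G \<Longrightarrow> w \<in> W \<Longrightarrow> \<rho> x *\<^sub>v w \<in> W) \<Longrightarrow>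
      W = {0\<^sub>v (rep_degree G \<rho>)} \<or> W = carrier_vec (rep_degree G \<rho>)"
  using assms unfolding irreducible_rep_def by blast+

lemma mat_eq_zeroI:
  fixes T :: "complex mat"
  assumes T: "T \<in> carrier_mat n m" and zero: "\<And>v. v \<in> carrier_vec m \<Longrightarrow> T *\<^sub>v v = 0\<^sub>v n"
  shows "T = 0\<^sub>m n m"
proof (rule mat_eqI_mult_vec[OF T])
  fix v :: "complex vec" assume v: "v \<in> carrier_vec m"
  then have "0\<^sub>m n m *\<^sub>v v = 0\<^sub>v n" by (intro eq_vecI) auto
  then show "T *\<^sub>v v = 0\<^sub>m n m *\<^sub>v v" using zero[OF v] by simp
qed simp

text \<open>The kernel \<open>K\<close> of \<open>T\<close> is invariant under
  \<open>\<sigma>\<close> and its range \<open>R\<close> under \<open>\<rho>\<close>. If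
  \<open>T\<close> is non-zero, irreducibility makes the kernel trivial and the range everything,
  and a two-sided inverse is assembled column by column.\<close>

lemma schur_lemma:
  assumes \<rho>: "irreducible_rep G \<rho>" and \<sigma>: "irreducible_rep G \<sigma>"
    and n: "rep_degree G \<rho> = n" and m: "rep_degree G \<sigma> = m"
    and T: "T \<in> carrier_mat n m"
    and comm: "\<And>x. x \<in> carrier G \<Longrightarrow> \<rho> x * T = T * \<sigma> x"
  shows "T = 0\<^sub>m n m \<or> n = m \<and> invertible_mat T"
proof (cases "T = 0\<^sub>m n m")
  case False
  have \<rho>c: "\<rho> x \<in> carrier_mat n n" and \<sigma>c: "\<sigma> x \<in> carrier_mat m m" if "x \<in> carrier G" for x
    using representation_carrier[OF irreducible_repD(1)[OF \<rho>] that]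
      representation_carrier[OF irreducible_repD(1)[OF \<sigma>] that] n m by simp_all
  have T_eq: "\<rho> x *\<^sub>v (T *\<^sub>v v) = T *\<^sub>v (\<sigma> x *\<^sub>v v)" if "x \<in> carrier G" "v \<in> carrier_vec m" for x v
    using comm[OF that(1)] assoc_mult_mat_vec[OF \<rho>c[OF that(1)] T that(2)]
      assoc_mult_mat_vec[OF T \<sigma>c[OF that(1)] that(2)] by simp
  define K where "K = {v \<in> carrier_vec m. T *\<^sub>v v = 0\<^sub>v n}"
  have "K = {0\<^sub>v m} \<or> K = carrier_vec m"
  proof (rule irreducible_repD(3)[OF \<sigma>, unfolded m])
    show "VectorSpace.subspace class_ring K (module_vec TYPE(complex) m)"
      unfolding subspace_vec_iff K_def using T
      by (auto simp: mult_add_distrib_mat_vec[OF T] mult_mat_vec[OF T] intro!: eq_vecI)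
    show "\<sigma> x *\<^sub>v w \<in> K" if x: "x \<in> carrier G" and w: "w \<in> K" for x w
    proof -
      have "T *\<^sub>v (\<sigma> x *\<^sub>v w) = \<rho> x *\<^sub>v 0\<^sub>v n" using T_eq[OF x, of w] w by (simp add: K_def)
      also have "\<dots> = 0\<^sub>v n" using \<rho>c[OF x] by (intro eq_vecI) auto
      finally show ?thesis
        using w mult_mat_vec_carrier[OF \<sigma>c[OF x]] by (simp add: K_def)
    qed
  qed
  moreover have "K \<noteq> carrier_vec m"
  proof
    assume "K = carrier_vec m"
    then have "T = 0\<^sub>m n m"
      by (intro mat_eq_zeroI[OF T]) (auto simp: K_def)
    with False show "False" by simp
  qed
  ultimately have K: "K = {0\<^sub>v m}" by simp
  define R where "R = {T *\<^sub>v v | v. v \<in> carrier_vec m}"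
  have "R = {0\<^sub>v n} \<or> R = carrier_vec n"
  proof (rule irreducible_repD(3)[OF \<rho>, unfolded n])
    have "0\<^sub>v n \<in> R"
      unfolding R_def using T by (intro CollectI exI[of _ "0\<^sub>v m"]) (auto intro!: eq_vecI)
    moreover have "v + w \<in> R" if vw: "v \<in> R" "w \<in> R" for v w
    proof -
      obtain v' w' where "v' \<in> carrier_vec m" "w' \<in> carrier_vec m" "v = T *\<^sub>v v'" "w = T *\<^sub>v w'"
        using vw unfolding R_def by blast
      then show ?thesis unfolding R_def using mult_add_distrib_mat_vec[OF T]
        by (intro CollectI exI[of _ "v' + w'"]) auto
    qed
    moreover have "c \<cdot>\<^sub>v v \<in> R" if vR: "v \<in> R" for c v
    proof -
      obtain v' where "v' \<in> carrier_vec m" "v = T *\<^sub>v v'" using vR unfolding R_def by blast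
      then show ?thesis unfolding R_def using mult_mat_vec[OF T]
        by (intro CollectI exI[of _ "c \<cdot>\<^sub>v v'"]) auto
    qed
    moreover have "R \<subseteq> carrier_vec n" using mult_mat_vec_carrier[OF T] by (auto simp: R_def)
    ultimately show "VectorSpace.subspace class_ring R (module_vec TYPE(complex) n)"
      unfolding subspace_vec_iff by blast
    show "\<rho> x *\<^sub>v w \<in> R" if x: "x \<in> carrier G" and w: "w \<in> R" for x w
      using w T_eq[OF x] mult_mat_vec_carrier[OF \<sigma>c[OF x]] by (auto simp: R_def)
  qed
  moreover have "R \<noteq> {0\<^sub>v n}"
  proof
    assume R0: "R = {0\<^sub>v n}"
    have "T *\<^sub>v v = 0\<^sub>v n" if "v \<in> carrier_vec m" for v using R0 that unfolding R_def by blast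
    then have "T = 0\<^sub>m n m" by (intro mat_eq_zeroI[OF T]) auto
    with False show "False" by simp
  qed
  ultimately have R: "R = carrier_vec n" by simp
  have "\<exists>v\<in>carrier_vec m. T *\<^sub>v v = unit_vec n i" for i
  proof -
    have "unit_vec n i \<in> R" by (simp add: R)
    then show ?thesis unfolding R_def by force
  qed
  \<comment> \<open>Preimages of the unit vectors become the columns of a right inverse
    \<open>B\<close>.\<close>
  then obtain b where b: "\<And>i. b i \<in> carrier_vec m" "\<And>i. T *\<^sub>v b i = unit_vec n i" by metis
  define B where "B = mat m n (\<lambda>(i, j). b j $ i)"
  have B: "B \<in> carrier_mat m n" by (simp add: B_def)
  have TB: "T * B = 1\<^sub>m n"
  proof (rule eq_matI)
    fix i j assume "i < dim_row (1\<^sub>m n :: complex mat)" "j < dim_col (1\<^sub>m n :: complex mat)"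
    then have ij: "i < n" "j < n" by auto
    have "col B j = b j" using ij b(1)[of j] by (intro eq_vecI) (auto simp: B_def)
    then have "(T * B) $$ (i, j) = (T *\<^sub>v b j) $ i" using ij T B by simp
    then show "(T * B) $$ (i, j) = 1\<^sub>m n $$ (i, j)" using ij by (simp add: b)
  qed (use T B in auto)
  have BT: "B * T = 1\<^sub>m m"
  proof (rule mat_eqI_mult_vec)
    fix v :: "complex vec" assume v: "v \<in> carrier_vec m"
    let ?Tv = "T *\<^sub>v v"
    have Tv: "?Tv \<in> carrier_vec n" using mult_mat_vec_carrier[OF T v] .
    have BTv: "B *\<^sub>v ?Tv \<in> carrier_vec m" using mult_mat_vec_carrier[OF B Tv] .
    have "T *\<^sub>v (B *\<^sub>v ?Tv) = ?Tv" using assoc_mult_mat_vec[OF T B Tv] TB Tv by simp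
    \<comment> \<open>The difference between \<open>B *\<^sub>v ?Tv\<close> and \<open>v\<close> is
      sent to zero, and the kernel is trivial.\<close>
    then have "T *\<^sub>v (B *\<^sub>v ?Tv + (-1) \<cdot>\<^sub>v v) = ?Tv + (-1) \<cdot>\<^sub>v ?Tv"
      using v BTv by (simp add: mult_add_distrib_mat_vec[OF T] mult_mat_vec[OF T])
    also have "\<dots> = 0\<^sub>v n" using T by (intro eq_vecI) auto
    finally have "T *\<^sub>v (B *\<^sub>v ?Tv + (-1) \<cdot>\<^sub>v v) = 0\<^sub>v n" .
    then have "B *\<^sub>v ?Tv + (-1) \<cdot>\<^sub>v v \<in> K" using v BTv by (simp add: K_def)
    then have z: "B *\<^sub>v ?Tv + (-1) \<cdot>\<^sub>v v = 0\<^sub>v m" using K by simp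
    have "B *\<^sub>v ?Tv = v"
    proof (rule eq_vecI)
      fix i assume i: "i < dim_vec v"
      then have "(B *\<^sub>v ?Tv + (-1) \<cdot>\<^sub>v v) $ i = 0" using z v by simp
      then show "(B *\<^sub>v ?Tv) $ i = v $ i" using i v BTv by simp
    qed (use v B in auto)
    then show "B * T *\<^sub>v v = 1\<^sub>m m *\<^sub>v v" using assoc_mult_mat_vec[OF B T v] v by simp
  qed (use T B in auto)
  \<comment> \<open>The traces of \<open>T * B\<close> and \<open>B * T\<close> agree, so the two
    sizes are equal as complex numbers, hence as naturals.\<close>
  have "of_nat n = (\<Sum>i<n. (T * B) $$ (i, i))" by (simp add: TB)
  also have "\<dots> = (\<Sum>i<n. \<Sum>k<m. T $$ (i, k) * B $$ (k, i))"
    using T B by (simp add: scalar_prod_def atLeast0LessThan)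
  also have "\<dots> = (\<Sum>k<m. \<Sum>i<n. B $$ (k, i) * T $$ (i, k))"
    by (subst sum.swap) (simp add: mult.commute)
  also have "\<dots> = (\<Sum>k<m. (B * T) $$ (k, k))"
    using T B by (simp add: scalar_prod_def atLeast0LessThan)
  also have "\<dots> = (of_nat m :: complex)" by (simp add: BT)
  finally have nm: "n = m" by (simp only: of_nat_eq_iff)
  then have "invertible_mat T"
    unfolding invertible_mat_def inverts_mat_def using T B TB BT by auto
  with nm show ?thesis by simp
qed simp

text \<open>For an eigenvalue \<open>c\<close> of \<open>T\<close>, the matrix \<open>T - c\<close>
  still commutes with the action but is singular, so Schur's lemma makes it zero.\<close>

lemma schur_scalar:
  assumes \<rho>: "irreducible_rep G \<rho>" and d: "rep_degree G \<rho> = d"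
    and T: "T \<in> carrier_mat d d"
    and comm: "\<And>x. x \<in> carrier G \<Longrightarrow> \<rho> x * T = T * \<rho> x"
  obtains c where "T = c \<cdot>\<^sub>m 1\<^sub>m d"
proof -
  have \<rho>c: "\<rho> x \<in> carrier_mat d d" if "x \<in> carrier G" for x
    using representation_carrier[OF irreducible_repD(1)[OF \<rho>] that] d by simp
  have "d > 0" using irreducible_repD(2)[OF \<rho>] d by simp
  \<comment> \<open>Algebraic closedness of the complex numbers enters here; the spectrum is
    non-empty because the size is positive.\<close>
  then obtain c v where v: "v \<in> carrier_vec d" "v \<noteq> 0\<^sub>v d" "T *\<^sub>v v = c \<cdot>\<^sub>v v"
    using spectrum_non_empty[OF T] T unfolding spectrum_def eigenvalue_def eigenvector_def by auto
  define S where "S = T + (-c) \<cdot>\<^sub>m 1\<^sub>m d"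
  have S: "S \<in> carrier_mat d d" using T by (simp add: S_def)
  have "S = 0\<^sub>m d d \<or> d = d \<and> invertible_mat S"
  proof (rule schur_lemma[OF \<rho> \<rho> d d S])
    fix x assume x: "x \<in> carrier G"
    show "\<rho> x * S = S * \<rho> x"
      unfolding S_def using \<rho>c[OF x] T comm[OF x]
      by (simp add: mult_add_distrib_mat[OF \<rho>c[OF x]] add_mult_distrib_mat[of _ d d]
          mult_smult_distrib[of _ d d _ d] mult_smult_assoc_mat[of _ d d])
  qed
  moreover have "\<not> invertible_mat S"
  proof
    assume "invertible_mat S"
    then obtain B where B: "S * B = 1\<^sub>m d" "B * S = 1\<^sub>m (dim_row B)"
      using S unfolding invertible_mat_def inverts_mat_def by auto
    have "dim_col B = d" using arg_cong[OF B(1), of dim_col] by simp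
    moreover have "dim_row B = d" using arg_cong[OF B(2), of dim_col] S by simp
    ultimately have Bc: "B \<in> carrier_mat d d" by auto
    have "((-c) \<cdot>\<^sub>m 1\<^sub>m d) *\<^sub>v v = (-c) \<cdot>\<^sub>v v"
      using v(1) by (intro eq_vecI) auto
    then have "S *\<^sub>v v = T *\<^sub>v v + (-c) \<cdot>\<^sub>v v"
      unfolding S_def using add_mult_distrib_mat_vec[OF T _ v(1), of "(-c) \<cdot>\<^sub>m 1\<^sub>m d"] by simp
    then have "S *\<^sub>v v = 0\<^sub>v d" unfolding v(3) using v(1) by (intro eq_vecI) auto
    moreover have "v = B *\<^sub>v (S *\<^sub>v v)" using assoc_mult_mat_vec[OF Bc S v(1)] B Bc v by simp
    ultimately have "v = 0\<^sub>v d" using Bc by (auto intro!: eq_vecI)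
    with v show False by simp
  qed
  ultimately have S0: "S = 0\<^sub>m d d" by simp
  have "T = c \<cdot>\<^sub>m 1\<^sub>m d"
  proof (rule eq_matI)
    fix i j assume ij: "i < dim_row (c \<cdot>\<^sub>m 1\<^sub>m d)" "j < dim_col (c \<cdot>\<^sub>m 1\<^sub>m d)"
    then have "S $$ (i, j) = 0" using S0 by simp
    then show "T $$ (i, j) = (c \<cdot>\<^sub>m 1\<^sub>m d) $$ (i, j)" using ij T by (auto simp: S_def split: if_splits)
  qed (use T in auto)
  then show thesis by (rule that)
qed

text \<open>Reindexing the average by left multiplication with \<open>y\<close> absorbs the factor
  \<open>\<rho> y\<close> on the left and releases a factor \<open>\<sigma> y\<close> on the
  right.\<close>

lemma average_intertwines:
  assumes "group G" and \<rho>: "representation G \<rho>" and \<sigma>: "representation G \<sigma>"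
    and n: "rep_degree G \<rho> = n" and m: "rep_degree G \<sigma> = m"
    and E: "E \<in> carrier_mat n m" and y: "y \<in> carrier G"
  defines "T \<equiv> mat_sum n m (carrier G) (\<lambda>x. \<rho> x * E * \<sigma> (inv\<^bsub>G\<^esub> x))"
  shows "\<rho> y * T = T * \<sigma> y"
proof -
  interpret group G by fact
  have \<rho>c: "\<rho> x \<in> carrier_mat n n" and \<sigma>c: "\<sigma> x \<in> carrier_mat m m" if "x \<in> carrier G" for x
    using representation_carrier[OF \<rho> that] representation_carrier[OF \<sigma> that] n m by simp_all
  have bij: "bij_betw (\<lambda>x. y \<otimes>\<^bsub>G\<^esub> x) (carrier G) (carrier G)"
    by (rule bij_betw_byWitness[where f' = "\<lambda>x. inv\<^bsub>G\<^esub> y \<otimes>\<^bsub>G\<^esub> x"])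
      (use y in \<open>auto simp: m_assoc[symmetric]\<close>)
  have car: "\<rho> x * E * \<sigma> (inv\<^bsub>G\<^esub> x) \<in> carrier_mat n m" if "x \<in> carrier G" for x
    using \<rho>c[OF that] \<sigma>c[of "inv\<^bsub>G\<^esub> x"] E that by auto
  have "\<rho> y * T = mat_sum n m (carrier G) (\<lambda>x. \<rho> y * (\<rho> x * E * \<sigma> (inv\<^bsub>G\<^esub> x)))"
    unfolding T_def by (rule mult_mat_sum[OF \<rho>c[OF y] car])
  \<comment> \<open>Writing x^-1 as (y x)^-1 y makes the summand a function of the product y x,
    ready for reindexing.\<close>
  also have "\<dots> = mat_sum n m (carrier G)
      (\<lambda>x. \<rho> (y \<otimes>\<^bsub>G\<^esub> x) * E * \<sigma> (inv\<^bsub>G\<^esub> (y \<otimes>\<^bsub>G\<^esub> x) \<otimes>\<^bsub>G\<^esub> y))"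
  proof (intro mat_sum_cong refl)
    fix x assume x: "x \<in> carrier G"
    have i: "inv\<^bsub>G\<^esub> x \<in> carrier G" using x by simp
    have "inv\<^bsub>G\<^esub> (y \<otimes>\<^bsub>G\<^esub> x) \<otimes>\<^bsub>G\<^esub> y = inv\<^bsub>G\<^esub> x"
      using x y by (simp add: inv_mult_group m_assoc)
    moreover have "\<rho> y * (\<rho> x * E * \<sigma> (inv\<^bsub>G\<^esub> x)) = \<rho> y * \<rho> x * E * \<sigma> (inv\<^bsub>G\<^esub> x)"
      using \<rho>c[OF x] \<rho>c[OF y] \<sigma>c[OF i] E
      by (simp add: assoc_mult_mat[OF \<rho>c[OF y] mult_carrier_mat[OF \<rho>c[OF x] E] \<sigma>c[OF i]]
          assoc_mult_mat[OF \<rho>c[OF y] \<rho>c[OF x] E])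
    ultimately show "\<rho> y * (\<rho> x * E * \<sigma> (inv\<^bsub>G\<^esub> x))
        = \<rho> (y \<otimes>\<^bsub>G\<^esub> x) * E * \<sigma> (inv\<^bsub>G\<^esub> (y \<otimes>\<^bsub>G\<^esub> x) \<otimes>\<^bsub>G\<^esub> y)"
      by (simp add: representation_mult[OF \<rho> y x])
  qed
  also have "\<dots> = mat_sum n m (carrier G) (\<lambda>x. \<rho> x * E * \<sigma> (inv\<^bsub>G\<^esub> x \<otimes>\<^bsub>G\<^esub> y))"
    by (rule mat_sum_bij_betw[OF bij])
  also have "\<dots> = mat_sum n m (carrier G) (\<lambda>x. \<rho> x * E * \<sigma> (inv\<^bsub>G\<^esub> x) * \<sigma> y)"
  proof (intro mat_sum_cong refl)
    fix x assume x: "x \<in> carrier G"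
    have i: "inv\<^bsub>G\<^esub> x \<in> carrier G" using x by simp
    show "\<rho> x * E * \<sigma> (inv\<^bsub>G\<^esub> x \<otimes>\<^bsub>G\<^esub> y) = \<rho> x * E * \<sigma> (inv\<^bsub>G\<^esub> x) * \<sigma> y"
      by (simp add: representation_mult[OF \<sigma> i y]
          assoc_mult_mat[OF mult_carrier_mat[OF \<rho>c[OF x] E] \<sigma>c[OF i] \<sigma>c[OF y]])
  qed
  also have "\<dots> = T * \<sigma> y"
    unfolding T_def by (rule mat_sum_mult[OF \<sigma>c[OF y] car, symmetric])
  finally show ?thesis .
qed

section \<open>Orthogonality of matrix coefficients\<close>

definition elementary_mat :: "nat \<Rightarrow> nat \<Rightarrow> nat \<Rightarrow> nat \<Rightarrow> complex mat" where
  "elementary_mat n m a b = mat n m (\<lambda>(i, j). if i = a \<and> j = b then 1 else 0)"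

lemma elementary_mat_carrier [simp]: "elementary_mat n m a b \<in> carrier_mat n m"
  by (simp add: elementary_mat_def)

text \<open>A matrix unit between two matrices picks out one entry of each, so averaging it isolates
  a product of two matrix coefficients.\<close>

lemma mult_elementary_mult_index:
  assumes M: "M \<in> carrier_mat k n" and N: "N \<in> carrier_mat m l"
    and "a < n" "b < m" "i < k" "j < l"
  shows "(M * elementary_mat n m a b * N) $$ (i, j) = M $$ (i, a) * N $$ (b, j)"
proof -
  have E: "(M * elementary_mat n m a b) $$ (i, q) = (if q = b then M $$ (i, a) else 0)" if "q < m" for q
  proof -
    have "(M * elementary_mat n m a b) $$ (i, q)
        = (\<Sum>p<n. M $$ (i, p) * (if p = a \<and> q = b then 1 else 0))"
      using assms that by (simp add: scalar_prod_def atLeast0LessThan elementary_mat_def)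
    also have "\<dots> = (\<Sum>p<n. if p = a then (if q = b then M $$ (i, a) else 0) else 0)"
      by (intro sum.cong) auto
    finally show ?thesis using assms by simp
  qed
  have "(M * elementary_mat n m a b * N) $$ (i, j)
      = (\<Sum>q<m. (M * elementary_mat n m a b) $$ (i, q) * N $$ (q, j))"
    using assms by (simp add: scalar_prod_def atLeast0LessThan elementary_mat_def)
  also have "\<dots> = (\<Sum>q<m. if q = b then M $$ (i, a) * N $$ (b, j) else 0)"
    using E by (intro sum.cong) auto
  finally show ?thesis using assms by simp
qed

text \<open>Unitarity of \<open>\<sigma>\<close> turns entries of \<open>\<sigma> (inv x)\<close>
  into conjugated, transposed entries of \<open>\<sigma> x\<close>. The entries of an averaged
  matrix unit are thus inner products of coefficient functions.\<close>

lemma average_elementary_index: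
  assumes "group G" and \<rho>: "representation G \<rho>" and \<sigma>: "unitary_rep G \<sigma>"
    and n: "rep_degree G \<rho> = n" and m: "rep_degree G \<sigma> = m"
    and ij: "i < n" "a < n" "j < m" "b < m"
  shows "mat_sum n m (carrier G) (\<lambda>x. \<rho> x * elementary_mat n m a b * \<sigma> (inv\<^bsub>G\<^esub> x)) $$ (i, j)
    = (\<Sum>x\<in>carrier G. \<rho> x $$ (i, a) * cnj (\<sigma> x $$ (j, b)))"
proof -
  interpret group G by fact
  have \<sigma>': "representation G \<sigma>" using \<sigma> by (simp add: unitary_rep_def)
  have \<rho>c: "\<rho> x \<in> carrier_mat n n" and \<sigma>c: "\<sigma> x \<in> carrier_mat m m" if "x \<in> carrier G" for x
    using representation_carrier[OF \<rho> that] representation_carrier[OF \<sigma>' that] n m by simp_all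
  have "(\<rho> x * elementary_mat n m a b * \<sigma> (inv\<^bsub>G\<^esub> x)) $$ (i, j)
      = \<rho> x $$ (i, a) * cnj (\<sigma> x $$ (j, b))" if x: "x \<in> carrier G" for x
  proof -
    have "\<sigma> (inv\<^bsub>G\<^esub> x) = mat_adjoint (\<sigma> x)" using \<sigma> x by (simp add: unitary_rep_def)
    then show ?thesis
      using mult_elementary_mult_index[OF \<rho>c[OF x] \<sigma>c[of "inv\<^bsub>G\<^esub> x"], of a b i j] ij x \<sigma>c[OF x] by simp
  qed
  then show ?thesis using ij by simp
qed

text \<open>Serves the trace of an averaged matrix unit, where summing over the diagonal leaves an
  inner product of two columns of \<open>\<rho> x\<close>.\<close>

lemma unitary_rep_sum_cols:
  assumes "group G" "unitary_rep G \<rho>" "x \<in> carrier G" "a < rep_degree G \<rho>" "b < rep_degree G \<rho>"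
  shows "(\<Sum>i<rep_degree G \<rho>. \<rho> x $$ (i, a) * cnj (\<rho> x $$ (i, b))) = (if a = b then 1 else 0)"
proof -
  interpret group G by fact
  have rep: "representation G \<rho>" using assms(2) by (simp add: unitary_rep_def)
  have c: "\<rho> x \<in> carrier_mat (rep_degree G \<rho>) (rep_degree G \<rho>)"
    using representation_carrier[OF rep assms(3)] .
  have "mat_adjoint (\<rho> x) * \<rho> x = 1\<^sub>m (rep_degree G \<rho>)"
    using assms representation_mult[OF rep, of "inv\<^bsub>G\<^esub> x" x] representation_one[OF \<open>group G\<close> rep]
    by (simp add: unitary_rep_def)
  then have "(mat_adjoint (\<rho> x) * \<rho> x) $$ (b, a) = (if a = b then 1 else 0)" using assms by auto
  then show ?thesis using assms c by (simp add: scalar_prod_def atLeast0LessThan mult.commute)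
qed

text \<open>The averaged matrix unit at \<open>(a, b)\<close> intertwines \<open>\<rho>\<close> and
  \<open>\<sigma>\<close>. For distinct members of \<open>R\<close> it must vanish, by uniqueness of
  the representative of a class; for equal ones it is a scalar, found by taking traces.\<close>

lemma schur_orthogonality:
  assumes "group G" "finite (carrier G)" and R: "complete_unitary_irreps G R"
    and \<rho>R: "\<rho> \<in> R" and \<sigma>R: "\<sigma> \<in> R"
    and ij: "i < rep_degree G \<rho>" "a < rep_degree G \<rho>" "j < rep_degree G \<sigma>" "b < rep_degree G \<sigma>"
  shows "(\<Sum>x\<in>carrier G. \<rho> x $$ (i, a) * cnj (\<sigma> x $$ (j, b)))
    = (if \<rho> = \<sigma> \<and> i = j \<and> a = b then of_nat (card (carrier G)) / of_nat (rep_degree G \<rho>) else 0)"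
proof -
  interpret group G by fact
  have irr: "irreducible_rep G \<rho>" "irreducible_rep G \<sigma>" and unit: "unitary_rep G \<rho>" "unitary_rep G \<sigma>"
    using R \<rho>R \<sigma>R by (auto simp: complete_unitary_irreps_def)
  note rep = irr[THEN irreducible_repD(1)]
  define n where "n = rep_degree G \<rho>"
  define m where "m = rep_degree G \<sigma>"
  define T where "T = mat_sum n m (carrier G) (\<lambda>x. \<rho> x * elementary_mat n m a b * \<sigma> (inv\<^bsub>G\<^esub> x))"
  have T: "T \<in> carrier_mat n m" by (simp add: T_def)
  have ind: "T $$ (p, q) = (\<Sum>x\<in>carrier G. \<rho> x $$ (p, a) * cnj (\<sigma> x $$ (q, b)))"
    if "p < n" "q < m" for p q
    unfolding T_def using average_elementary_index[OF \<open>group G\<close> rep(1) unit(2) n_def[symmetric] m_def[symmetric]]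
      that ij by (simp add: n_def m_def)
  have comm: "\<rho> y * T = T * \<sigma> y" if "y \<in> carrier G" for y
    unfolding T_def
    by (rule average_intertwines[OF \<open>group G\<close> rep n_def[symmetric] m_def[symmetric] _ that]) simp
  show ?thesis
  proof (cases "\<rho> = \<sigma>")
    case False
    have "T = 0\<^sub>m n m"
    proof (rule ccontr)
      assume "T \<noteq> 0\<^sub>m n m"
      then have nm: "n = m" "invertible_mat T"
        using schur_lemma[OF irr n_def[symmetric] m_def[symmetric] T comm] by auto
      \<comment> \<open>An invertible \<open>T\<close> would make both \<open>\<sigma>\<close> and
        \<open>\<rho>\<close> representatives in \<open>R\<close> of the class of
        \<open>\<rho>\<close>.\<close>
      have "equivalent_rep G \<sigma> \<rho>"
        unfolding equivalent_rep_def using nm T comm by (auto simp: n_def m_def)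
      moreover have "equivalent_rep G \<rho> \<rho>"
        unfolding equivalent_rep_def
      proof (intro conjI bexI[of _ "1\<^sub>m n"] ballI)
        show "invertible_mat (1\<^sub>m n :: complex mat)"
          by (auto simp: invertible_mat_def inverts_mat_def intro: exI[of _ "1\<^sub>m n"])
        show "\<rho> x * 1\<^sub>m n = 1\<^sub>m n * \<rho> x" if "x \<in> carrier G" for x
          using representation_carrier[OF rep(1) that] by (simp add: n_def)
      qed (auto simp: n_def)
      ultimately show False
        using R \<rho>R \<sigma>R irr(1) False unfolding complete_unitary_irreps_def by blast
    qed
    then show ?thesis using ind[of i j] ij False by (simp add: n_def m_def)
  next
    case True
    then have nm: "n = m" by (simp add: n_def m_def)
    obtain c where c: "T = c \<cdot>\<^sub>m 1\<^sub>m n"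
      using schur_scalar[OF irr(1) n_def[symmetric], of T] T comm True nm by metis
    \<comment> \<open>Trace of \<open>T\<close>: the columns of each \<open>\<rho> x\<close> are
      orthonormal, so every group element contributes 1 or 0, and \<open>c\<close> is |G| / n or 0
      accordingly.\<close>
    have "of_nat n * c = (\<Sum>p<n. T $$ (p, p))" by (simp add: c)
    also have "\<dots> = (\<Sum>p<n. \<Sum>x\<in>carrier G. \<rho> x $$ (p, a) * cnj (\<rho> x $$ (p, b)))"
      using ind nm True by simp
    also have "\<dots> = (\<Sum>x\<in>carrier G. \<Sum>p<n. \<rho> x $$ (p, a) * cnj (\<rho> x $$ (p, b)))"
      by (rule sum.swap)
    also have "\<dots> = (\<Sum>x\<in>carrier G. if a = b then 1 else 0)"
      using unitary_rep_sum_cols[OF \<open>group G\<close> unit(1)] ij True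
      by (intro sum.cong) (auto simp: n_def)
    finally have "of_nat n * c = of_nat (card (carrier G)) * (if a = b then 1 else 0)" by simp
    moreover have "n > 0" using ij by (simp add: n_def)
    ultimately have "c = (if a = b then of_nat (card (carrier G)) / of_nat n else 0)"
      by (auto simp: field_simps split: if_splits)
    then show ?thesis using ind[of i j] ij True by (auto simp: n_def m_def c)
  qed
qed


section \<open>Injectivity of the Fourier transform\<close>

text \<open>The left regular representation in coordinates: \<open>h\<close> numbers the group
  elements, and \<open>x\<close> acts by a permutation matrix that sends the basis vector of
  \<open>h j\<close> to that of \<open>x \<otimes> h j\<close>.\<close>

definition regular_rep :: "('a, 'b) monoid_scheme \<Rightarrow> nat \<Rightarrow> (nat \<Rightarrow> 'a) \<Rightarrow> 'a mrep" where
  "regular_rep G N h x = mat N N (\<lambda>(i, j). if h i = x \<otimes>\<^bsub>G\<^esub> h j then 1 else 0)"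

lemma regular_rep_carrier [simp]: "regular_rep G N h x \<in> carrier_mat N N"
  by (simp add: regular_rep_def)

text \<open>Read through the numbering \<open>k\<close>, a vector is a function on the group. Later
  arguments use the action in this functional form instead of the matrix entries.\<close>

lemma regular_rep_mult_vec:
  assumes "group G" and h: "bij_betw h {..<N} (carrier G)" and x: "x \<in> carrier G"
    and v: "v \<in> carrier_vec N" and y: "y \<in> carrier G"
  defines "k \<equiv> inv_into {..<N} h"
  shows "(regular_rep G N h x *\<^sub>v v) $ k y = v $ k (inv\<^bsub>G\<^esub> x \<otimes>\<^bsub>G\<^esub> y)"
proof -
  interpret group G by fact
  have k: "k z < N" "h (k z) = z" if "z \<in> carrier G" for z
    using h that bij_betw_inv_into_right[OF h that] bij_betwE[OF bij_betw_inv_into[OF h]]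
    by (auto simp: k_def)
  have kh: "k (h i) = i" if "i < N" for i
    using bij_betw_inv_into_left[OF h] that by (simp add: k_def)
  have hc: "h i \<in> carrier G" if "i < N" for i using bij_betwE[OF h] that by simp
  have "(regular_rep G N h x *\<^sub>v v) $ k y
      = (\<Sum>j<N. (if h (k y) = x \<otimes>\<^bsub>G\<^esub> h j then 1 else 0) * v $ j)"
    using k[OF y] v by (simp add: regular_rep_def scalar_prod_def atLeast0LessThan)
  also have "\<dots> = (\<Sum>j<N. if j = k (inv\<^bsub>G\<^esub> x \<otimes>\<^bsub>G\<^esub> y) then v $ j else 0)"
  proof (rule sum.cong[OF refl])
    fix j assume "j \<in> {..<N}"
    then have j: "j < N" by simp
    have "h (k y) = x \<otimes>\<^bsub>G\<^esub> h j \<longleftrightarrow> h j = inv\<^bsub>G\<^esub> x \<otimes>\<^bsub>G\<^esub> y"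
      using x y k[OF y] hc[OF j] by (metis inv_closed inv_solve_left)
    also have "\<dots> \<longleftrightarrow> j = k (inv\<^bsub>G\<^esub> x \<otimes>\<^bsub>G\<^esub> y)"
      using kh[OF j] k[of "inv\<^bsub>G\<^esub> x \<otimes>\<^bsub>G\<^esub> y"] x y by auto
    finally show "(if h (k y) = x \<otimes>\<^bsub>G\<^esub> h j then 1 else 0) * v $ j
        = (if j = k (inv\<^bsub>G\<^esub> x \<otimes>\<^bsub>G\<^esub> y) then v $ j else 0)" by simp
  qed
  also have "\<dots> = v $ k (inv\<^bsub>G\<^esub> x \<otimes>\<^bsub>G\<^esub> y)" using k(1)[of "inv\<^bsub>G\<^esub> x \<otimes>\<^bsub>G\<^esub> y"] x y by simp
  finally show ?thesis .
qed

text \<open>Products are compared through their action on vectors, where the claim becomes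
  associativity of translations.\<close>

lemma regular_rep_representation:
  assumes "group G" and h: "bij_betw h {..<N} (carrier G)"
  shows "representation G (regular_rep G N h)" "rep_degree G (regular_rep G N h) = N"
proof -
  interpret group G by fact
  define k where "k = inv_into {..<N} h"
  note act = regular_rep_mult_vec[OF assms, folded k_def]
  have kh: "k (h i) = i" if "i < N" for i
    using bij_betw_inv_into_left[OF h] that by (simp add: k_def)
  have hc: "h i \<in> carrier G" if "i < N" for i using bij_betwE[OF h] that by simp
  have act': "(regular_rep G N h x *\<^sub>v v) $ i = v $ k (inv\<^bsub>G\<^esub> x \<otimes>\<^bsub>G\<^esub> h i)"
    if "x \<in> carrier G" "v \<in> carrier_vec N" "i < N" for x v i
    using act[OF that(1,2) hc[OF that(3)]] kh[OF that(3)] by simp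
  have pc: "regular_rep G N h x *\<^sub>v v \<in> carrier_vec N" if "v \<in> carrier_vec N" for x v
    by (rule mult_mat_vec_carrier[OF regular_rep_carrier that])
  have mult: "regular_rep G N h (x \<otimes>\<^bsub>G\<^esub> y) = regular_rep G N h x * regular_rep G N h y"
    if xy: "x \<in> carrier G" "y \<in> carrier G" for x y
  proof (rule mat_eqI_mult_vec[where n = N and m = N])
    fix v :: "complex vec" assume v: "v \<in> carrier_vec N"
    show "regular_rep G N h (x \<otimes>\<^bsub>G\<^esub> y) *\<^sub>v v = (regular_rep G N h x * regular_rep G N h y) *\<^sub>v v"
      unfolding assoc_mult_mat_vec[OF regular_rep_carrier regular_rep_carrier v]
    proof (rule eq_vecI)
      fix i assume "i < dim_vec (regular_rep G N h x *\<^sub>v (regular_rep G N h y *\<^sub>v v))"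
      then have i: "i < N" by (simp add: regular_rep_def)
      show "(regular_rep G N h (x \<otimes>\<^bsub>G\<^esub> y) *\<^sub>v v) $ i
          = (regular_rep G N h x *\<^sub>v (regular_rep G N h y *\<^sub>v v)) $ i"
        using act'[OF _ v i] act'[OF xy(1) pc[OF v] i, of y] act[OF xy(2) v] xy hc[OF i]
        by (simp add: inv_mult_group m_assoc)
    qed (simp add: regular_rep_def)
  qed (simp_all add: mult_carrier_mat[of _ N N])
  have one: "regular_rep G N h \<one>\<^bsub>G\<^esub> = 1\<^sub>m N"
  proof (rule mat_eqI_mult_vec[where n = N and m = N])
    fix v :: "complex vec" assume v: "v \<in> carrier_vec N"
    show "regular_rep G N h \<one>\<^bsub>G\<^esub> *\<^sub>v v = 1\<^sub>m N *\<^sub>v v"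
      using v act'[OF one_closed v] hc kh by (intro eq_vecI) (auto simp: regular_rep_def)
  qed auto
  show "representation G (regular_rep G N h)" "rep_degree G (regular_rep G N h) = N"
    by (rule representationI[of G "regular_rep G N h" N, OF \<open>group G\<close> regular_rep_carrier mult one];
        assumption)+
qed

text \<open>
  The functions annihilated by every representation in \<open>R\<close> form a space that is invariant under
  translations and under \<open>w \<mapsto> (\<lambda>x. cnj (w (inv x)))\<close>. An irreducible subrepresentation of it
  is equivalent to a member of \<open>R\<close>, hence is annihilated by convolution with every function of
  that space; convolving \<open>v\<close> with its own adjoint and evaluating at the identity gives \<open>v = 0\<close>.
\<close>

lemma fourier_injective:
  assumes "group G" and fin: "finite (carrier G)" and R: "complete_unitary_irreps G R"
    and g: "\<And>\<rho>. \<rho> \<in> R \<Longrightarrow> fourier G g \<rho> = 0\<^sub>m (rep_degree G \<rho>) (rep_degree G \<rho>)"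
    and x: "x \<in> carrier G"
  shows "g x = 0"
proof (rule ccontr)
  assume gx: "g x \<noteq> 0"
  interpret group G by fact
  define N where "N = card (carrier G)"
  obtain h where h: "bij_betw h {..<N} (carrier G)"
    using ex_bij_betw_nat_finite[OF fin] by (auto simp: N_def atLeast0LessThan)
  define k where "k = inv_into {..<N} h"
  have k: "k z < N" "h (k z) = z" if "z \<in> carrier G" for z
    using h that bij_betw_inv_into_right[OF h that] bij_betwE[OF bij_betw_inv_into[OF h]]
    by (auto simp: k_def)
  have kh: "k (h i) = i" if "i < N" for i
    using bij_betw_inv_into_left[OF h] that by (simp add: k_def)
  have hc: "h i \<in> carrier G" if "i < N" for i using bij_betwE[OF h] that by simp
  let ?P = "regular_rep G N h"
  note act = regular_rep_mult_vec[OF \<open>group G\<close> h, folded k_def]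
  let ?Z = "\<lambda>w. \<forall>\<rho>\<in>R. fourier G w \<rho> = 0\<^sub>m (rep_degree G \<rho>) (rep_degree G \<rho>)"
  have unit: "unitary_rep G \<rho>" and rep: "representation G \<rho>" if "\<rho> \<in> R" for \<rho>
    using R that by (auto simp: complete_unitary_irreps_def unitary_rep_def)
  define W where "W = {v \<in> carrier_vec N. ?Z (\<lambda>y. v $ k y)}"
  have "VectorSpace.subspace class_ring W (module_vec TYPE(complex) N)"
    unfolding subspace_vec_iff
  proof (intro conjI ballI allI)
    show "0\<^sub>v N \<in> W"
      unfolding W_def using k by (auto simp: fourier_def intro!: eq_matI sum.neutral)
    fix v w assume vw: "v \<in> W" "w \<in> W"
    have "fourier G (\<lambda>y. (v + w) $ k y) \<rho> = fourier G (\<lambda>y. v $ k y) \<rho> + fourier G (\<lambda>y. w $ k y) \<rho>" for \<rho>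
      unfolding fourier_add[symmetric] using vw k by (intro fourier_cong) (auto simp: W_def)
    then show "v + w \<in> W" using vw by (simp add: W_def)
  next
    fix c v assume v: "v \<in> W"
    have "fourier G (\<lambda>y. (c \<cdot>\<^sub>v v) $ k y) \<rho> = c \<cdot>\<^sub>m fourier G (\<lambda>y. v $ k y) \<rho>" for \<rho>
      unfolding fourier_smult[symmetric] using v k by (intro fourier_cong) (auto simp: W_def)
    then show "c \<cdot>\<^sub>v v \<in> W" using v by (simp add: W_def)
  qed (auto simp: W_def)
  moreover have "?P y *\<^sub>v w \<in> W" if y: "y \<in> carrier G" and w: "w \<in> W" for y w
  proof -
    have wc: "w \<in> carrier_vec N" using w by (simp add: W_def)
    have "fourier G (\<lambda>z. (?P y *\<^sub>v w) $ k z) \<rho> = 0\<^sub>m (rep_degree G \<rho>) (rep_degree G \<rho>)"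
      if \<rho>: "\<rho> \<in> R" for \<rho>
    proof -
      have "fourier G (\<lambda>z. (?P y *\<^sub>v w) $ k z) \<rho> = fourier G (\<lambda>z. w $ k (inv\<^bsub>G\<^esub> y \<otimes>\<^bsub>G\<^esub> z)) \<rho>"
        by (rule fourier_cong) (rule act[OF y wc])
      also have "\<dots> = \<rho> y * fourier G (\<lambda>z. w $ k z) \<rho>"
        by (rule fourier_translate[OF \<open>group G\<close> rep[OF \<rho>] y])
      finally show ?thesis
        using w \<rho> right_mult_zero_mat[OF representation_carrier[OF rep[OF \<rho>] y]] by (simp add: W_def)
    qed
    then show ?thesis using mult_mat_vec_carrier[OF regular_rep_carrier wc] by (simp add: W_def)
  qed
  moreover have "W \<noteq> {0\<^sub>v N}"
  proof
    assume W0: "W = {0\<^sub>v N}"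
    \<comment> \<open>The coordinate vector of \<open>g\<close> itself lies in \<open>W\<close> and
      is non-zero at \<open>x\<close>.\<close>
    define v where "v = vec N (\<lambda>i. g (h i))"
    have "fourier G (\<lambda>y. v $ k y) \<rho> = fourier G g \<rho>" for \<rho>
      using k by (intro fourier_cong) (simp add: v_def)
    then have "v \<in> W" using g by (simp add: W_def v_def)
    then have "v $ k x = 0" using W0 k[OF x] by simp
    then show False using gx k[OF x] by (simp add: v_def)
  qed
  ultimately obtain \<sigma> A where \<sigma>: "irreducible_rep G \<sigma>" and A: "A \<in> carrier_mat N (rep_degree G \<sigma>)"
    and iso: "mat_adjoint A * A = 1\<^sub>m (rep_degree G \<sigma>)"
    and AW: "\<And>v. v \<in> carrier_vec (rep_degree G \<sigma>) \<Longrightarrow> A *\<^sub>v v \<in> W"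
    and PA: "\<And>x. x \<in> carrier G \<Longrightarrow> ?P x * A = A * \<sigma> x"
    by (rule exists_irreducible_subrep[OF \<open>group G\<close> regular_rep_representation[OF \<open>group G\<close> h]])
      (assumption+, rule that)
  define n where "n = rep_degree G \<sigma>"
  have npos: "n > 0" using irreducible_repD(2)[OF \<sigma>] by (simp add: n_def)
  have \<sigma>c: "\<sigma> z \<in> carrier_mat n n" if "z \<in> carrier G" for z
    using representation_carrier[OF irreducible_repD(1)[OF \<sigma>] that] by (simp add: n_def)
  obtain \<rho> where \<rho>: "\<rho> \<in> R" and eqv: "equivalent_rep G \<rho> \<sigma>"
    using R \<sigma> unfolding complete_unitary_irreps_def by blast
  obtain Q where dn: "rep_degree G \<rho> = n" and Q: "Q \<in> carrier_mat n n" "invertible_mat Q"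
    and com: "\<And>z. z \<in> carrier G \<Longrightarrow> \<sigma> z * Q = Q * \<rho> z"
    using eqv unfolding equivalent_rep_def n_def by auto
  have \<rho>c: "\<rho> z \<in> carrier_mat n n" if "z \<in> carrier G" for z
    using representation_carrier[OF rep[OF \<rho>] that] dn by simp
  obtain Q' where Q': "Q' \<in> carrier_mat n n" "Q * Q' = 1\<^sub>m n"
  proof -
    obtain B where B: "Q * B = 1\<^sub>m n" "B * Q = 1\<^sub>m (dim_row B)"
      using Q unfolding invertible_mat_def inverts_mat_def by auto
    have "dim_col B = n" using arg_cong[OF B(1), of dim_col] by simp
    moreover have "dim_row B = n" using arg_cong[OF B(2), of dim_col] Q by simp
    ultimately show thesis using that[of B] B by auto
  qed
  \<comment> \<open>The intertwiner \<open>Q\<close> carries the vanishing of the transform from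
    \<open>\<rho>\<close> to the equivalent \<open>\<sigma>\<close>, which need not belong to
    \<open>R\<close>.\<close>
  have \<sigma>0: "fourier G w \<sigma> = 0\<^sub>m n n" if "?Z w" for w
  proof -
    have Fc: "fourier G w \<sigma> \<in> carrier_mat n n" by (simp add: n_def)
    have "fourier G w \<sigma> = mat_sum n n (carrier G) (\<lambda>z. w z \<cdot>\<^sub>m \<sigma> z)"
      unfolding n_def by (rule fourier_eq_mat_sum) (use \<sigma>c n_def in auto)
    then have "fourier G w \<sigma> * Q = mat_sum n n (carrier G) (\<lambda>z. (w z \<cdot>\<^sub>m \<sigma> z) * Q)"
      using \<sigma>c by (simp add: mat_sum_mult[OF Q(1)])
    also have "\<dots> = mat_sum n n (carrier G) (\<lambda>z. Q * (w z \<cdot>\<^sub>m \<rho> z))"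
    proof (intro mat_sum_cong refl)
      fix z assume z: "z \<in> carrier G"
      show "w z \<cdot>\<^sub>m \<sigma> z * Q = Q * (w z \<cdot>\<^sub>m \<rho> z)"
        using mult_smult_assoc_mat[OF \<sigma>c[OF z] Q(1)] mult_smult_distrib[OF Q(1) \<rho>c[OF z]] com[OF z]
        by simp
    qed
    also have "\<dots> = Q * fourier G w \<rho>"
      using \<rho>c by (simp add: fourier_eq_mat_sum[of G \<rho>] dn mult_mat_sum[OF Q(1)])
    also have "\<dots> = 0\<^sub>m n n" using that \<rho> Q dn by simp
    finally have "fourier G w \<sigma> * Q = 0\<^sub>m n n" .
    then have "fourier G w \<sigma> * (Q * Q') = 0\<^sub>m n n"
      using assoc_mult_mat[OF Fc Q(1) Q'(1)] Q' by simp
    then show ?thesis using Q'(2) right_mult_one_mat[OF Fc] by simp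
  qed
  \<comment> \<open>First basis vector of the subrepresentation, non-zero because \<open>A\<close>
    is injective.\<close>
  define v where "v = A *\<^sub>v unit_vec n 0"
  have vW: "v \<in> W" unfolding v_def by (rule AW) (simp add: n_def)
  then have vc: "v \<in> carrier_vec N" by (simp add: W_def)
  define w where "w = (\<lambda>y. cnj (v $ k (inv\<^bsub>G\<^esub> y)))"
  have "?Z w"
  proof
    fix \<tau> assume \<tau>: "\<tau> \<in> R"
    have "fourier G w \<tau> = mat_adjoint (fourier G (\<lambda>y. v $ k y) \<tau>)"
      unfolding w_def by (rule fourier_adjoint[OF \<open>group G\<close> unit[OF \<tau>]])
    also have "\<dots> = 0\<^sub>m (rep_degree G \<tau>) (rep_degree G \<tau>)"
      using vW \<tau> by (auto simp: W_def intro!: eq_matI)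
    finally show "fourier G w \<tau> = 0\<^sub>m (rep_degree G \<tau>) (rep_degree G \<tau>)" .
  qed
  note w0 = \<sigma>0[OF this]
  \<comment> \<open>The value of \<open>v\<close> at z^-1 is the value at the identity of its
    translate by \<open>z\<close>. Since \<open>A\<close> intertwines, this is a fixed linear
    combination of the entries in column 0 of \<open>\<sigma> z\<close>.\<close>
  have Pv: "v $ k (inv\<^bsub>G\<^esub> z) = (\<Sum>j<n. A $$ (k \<one>\<^bsub>G\<^esub>, j) * \<sigma> z $$ (j, 0))" if z: "z \<in> carrier G" for z
  proof -
    have An: "A \<in> carrier_mat N n" using A by (simp add: n_def)
    have "?P z *\<^sub>v v = (A * \<sigma> z) *\<^sub>v unit_vec n 0"
      unfolding v_def PA[OF z, symmetric]
      by (rule assoc_mult_mat_vec[OF regular_rep_carrier An, symmetric]) simp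
    also have "\<dots> = col (A * \<sigma> z) 0"
      using An \<sigma>c[OF z] npos by (intro eq_vecI) (simp_all del: assoc_mult_mat_vec)
    finally have "(?P z *\<^sub>v v) $ k \<one>\<^bsub>G\<^esub> = (A * \<sigma> z) $$ (k \<one>\<^bsub>G\<^esub>, 0)"
      using An \<sigma>c[OF z] k[OF one_closed] npos by simp
    then show ?thesis
      using act[OF z vc one_closed] z An \<sigma>c[OF z] k[OF one_closed] npos
      by (simp add: scalar_prod_def atLeast0LessThan)
  qed
  \<comment> \<open>The pairing with \<open>w\<close> is therefore a combination of entries of the
    transform of \<open>w\<close> at \<open>\<sigma>\<close>, all zero, while term by term it is the
    squared norm of \<open>v\<close>.\<close>
  have "(\<Sum>z\<in>carrier G. w z * v $ k (inv\<^bsub>G\<^esub> z))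
      = (\<Sum>z\<in>carrier G. \<Sum>j<n. A $$ (k \<one>\<^bsub>G\<^esub>, j) * (\<sigma> z $$ (j, 0) * w z))"
    using Pv by (intro sum.cong refl) (simp add: sum_distrib_left algebra_simps)
  also have "\<dots> = (\<Sum>j<n. A $$ (k \<one>\<^bsub>G\<^esub>, j) * fourier G w \<sigma> $$ (j, 0))"
    using npos by (subst sum.swap) (simp add: sum_distrib_left fourier_def n_def[symmetric])
  also have "\<dots> = 0" using npos by (simp add: w0)
  finally have "(\<Sum>z\<in>carrier G. w z * v $ k (inv\<^bsub>G\<^esub> z)) = 0" .
  moreover have "(\<Sum>z\<in>carrier G. w z * v $ k (inv\<^bsub>G\<^esub> z))
      = complex_of_real (\<Sum>z\<in>carrier G. (cmod (v $ k (inv\<^bsub>G\<^esub> z)))\<^sup>2)"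
    unfolding of_real_sum by (intro sum.cong refl)
      (simp add: w_def complex_norm_square mult.commute del: of_real_power)
  ultimately have "(\<Sum>z\<in>carrier G. (cmod (v $ k (inv\<^bsub>G\<^esub> z)))\<^sup>2) = 0" by (metis of_real_eq_0_iff)
  then have v0: "v $ k (inv\<^bsub>G\<^esub> z) = 0" if "z \<in> carrier G" for z
    using that fin by (simp add: sum_nonneg_eq_0_iff)
  have "v = 0\<^sub>v N"
  proof (rule eq_vecI)
    fix i assume "i < dim_vec (0\<^sub>v N :: complex vec)"
    then have i: "i < N" by simp
    show "v $ i = 0\<^sub>v N $ i" using v0[of "inv\<^bsub>G\<^esub> (h i)"] hc[OF i] kh[OF i] i by simp
  qed (use vc in auto)
  \<comment> \<open>The left inverse of \<open>A\<close> recovers \<open>unit_vec n 0\<close> from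
    \<open>v\<close>, and this is non-zero since \<open>n > 0\<close>.\<close>
  then have "mat_adjoint A *\<^sub>v v = 0\<^sub>v n" using A by (auto simp: n_def intro!: eq_vecI)
  moreover have "mat_adjoint A *\<^sub>v v = unit_vec n 0"
    unfolding v_def using isometry_left_inverse[OF A iso, of "unit_vec n 0"] by (simp add: n_def)
  ultimately have "unit_vec n 0 = (0\<^sub>v n :: complex vec)" by simp
  from arg_cong[OF this, of "\<lambda>v. v $ 0"] show False using npos by simp
qed


section \<open>Kronecker products and tensor representations\<close>

lemma kron_dim [simp]:
  "dim_row (A \<otimes>\<^sub>k B) = dim_row A * dim_row B" "dim_col (A \<otimes>\<^sub>k B) = dim_col A * dim_col B"
  by (simp_all add: kron_def)

lemma kron_carrier:
  "A \<in> carrier_mat a b \<Longrightarrow> B \<in> carrier_mat c d \<Longrightarrow> A \<otimes>\<^sub>k B \<in> carrier_mat (a * c) (b * d)"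
  by auto

lemma kron_index:
  "i < dim_row A * dim_row B \<Longrightarrow> j < dim_col A * dim_col B \<Longrightarrow> (A \<otimes>\<^sub>k B) $$ (i, j) =
     A $$ (i div dim_row B, j div dim_col B) * B $$ (i mod dim_row B, j mod dim_col B)"
  by (simp add: kron_def)

lemma div_mod_less_mult:
  assumes "(i::nat) < m * n"
  shows "i div n < m" "i mod n < n"
  using assms by (auto simp: less_mult_imp_div_less intro!: mod_less_divisor gr0I)

lemma mult_add_less_mult:
  assumes "(i::nat) < m" "j < n"
  shows "i * n + j < m * n"
proof -
  have "i * n + j < Suc i * n" using assms by simp
  also have "\<dots> \<le> m * n" using assms by (intro mult_right_mono) auto
  finally show ?thesis .
qed

text \<open>Bridge between the flattened index of a Kronecker product and a pair of indices: the
  quotient belongs to the left factor, the remainder to the right one.\<close>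

lemma sum_lessThan_mult_div_mod:
  fixes f :: "nat \<Rightarrow> nat \<Rightarrow> 'c :: comm_monoid_add"
  shows "(\<Sum>k<m * n. f (k div n) (k mod n)) = (\<Sum>i<m. \<Sum>j<n. f i j)"
proof -
  have "bij_betw (\<lambda>(i, j). i * n + j) ({..<m} \<times> {..<n}) {..<m * n}"
    by (rule bij_betw_byWitness[where f' = "\<lambda>k. (k div n, k mod n)"])
      (auto simp: div_mod_less_mult mult_add_less_mult)
  from sum.reindex_bij_betw[OF this, of "\<lambda>k. f (k div n) (k mod n)"]
  have "(\<Sum>k<m * n. f (k div n) (k mod n))
      = (\<Sum>(i, j)\<in>{..<m} \<times> {..<n}. f ((i * n + j) div n) ((i * n + j) mod n))"
    by (simp add: case_prod_unfold)
  also have "\<dots> = (\<Sum>(i, j)\<in>{..<m} \<times> {..<n}. f i j)" by (intro sum.cong) auto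
  finally show ?thesis by (simp add: sum.cartesian_product)
qed

text \<open>The sum over the flattened inner index factors into one sum per tensor factor.\<close>

lemma kron_mult:
  assumes A: "A \<in> carrier_mat a b" and B: "B \<in> carrier_mat a' b'"
    and C: "C \<in> carrier_mat b c" and D: "D \<in> carrier_mat b' c'"
  shows "(A \<otimes>\<^sub>k B) * (C \<otimes>\<^sub>k D) = (A * C) \<otimes>\<^sub>k (B * D)"
proof (rule eq_matI)
  fix i j assume "i < dim_row ((A * C) \<otimes>\<^sub>k (B * D))" "j < dim_col ((A * C) \<otimes>\<^sub>k (B * D))"
  then have ij: "i < a * a'" "j < c * c'" using assms by auto
  note dm = div_mod_less_mult[OF ij(1)] div_mod_less_mult[OF ij(2)]
  have "((A \<otimes>\<^sub>k B) * (C \<otimes>\<^sub>k D)) $$ (i, j) = (\<Sum>k<b * b'. (A \<otimes>\<^sub>k B) $$ (i, k) * (C \<otimes>\<^sub>k D) $$ (k, j))"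
    using assms ij by (simp add: scalar_prod_def atLeast0LessThan)
  also have "\<dots> = (\<Sum>k<b * b'. (\<lambda>p q. (A $$ (i div a', p) * C $$ (p, j div c')) *
      (B $$ (i mod a', q) * D $$ (q, j mod c'))) (k div b') (k mod b'))"
    using assms ij by (intro sum.cong refl) (auto simp: kron_index)
  also have "\<dots> = (\<Sum>p<b. \<Sum>q<b'. (A $$ (i div a', p) * C $$ (p, j div c')) *
      (B $$ (i mod a', q) * D $$ (q, j mod c')))"
    by (rule sum_lessThan_mult_div_mod)
  also have "\<dots> = (\<Sum>p<b. A $$ (i div a', p) * C $$ (p, j div c')) *
      (\<Sum>q<b'. B $$ (i mod a', q) * D $$ (q, j mod c'))"
    by (simp add: sum_product)
  also have "\<dots> = (A * C) $$ (i div a', j div c') * (B * D) $$ (i mod a', j mod c')"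
    using assms dm by (simp add: scalar_prod_def atLeast0LessThan)
  also have "\<dots> = ((A * C) \<otimes>\<^sub>k (B * D)) $$ (i, j)"
    using assms ij by (simp add: kron_index)
  finally show "((A \<otimes>\<^sub>k B) * (C \<otimes>\<^sub>k D)) $$ (i, j) = ((A * C) \<otimes>\<^sub>k (B * D)) $$ (i, j)" .
qed (use assms in auto)

lemma mat_adjoint_kron: "mat_adjoint (A \<otimes>\<^sub>k B) = mat_adjoint A \<otimes>\<^sub>k mat_adjoint B"
  by (intro eq_matI) (auto simp: kron_index div_mod_less_mult)

lemma kron_one: "1\<^sub>m m \<otimes>\<^sub>k 1\<^sub>m n = 1\<^sub>m (m * n)"
proof (rule eq_matI)
  fix i j assume "i < dim_row (1\<^sub>m (m * n) :: complex mat)" "j < dim_col (1\<^sub>m (m * n) :: complex mat)"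
  then have ij: "i < m * n" "j < m * n" by auto
  have "i = j \<longleftrightarrow> i div n = j div n \<and> i mod n = j mod n" by (metis div_mult_mod_eq)
  then show "(1\<^sub>m m \<otimes>\<^sub>k 1\<^sub>m n) $$ (i, j) = (1\<^sub>m (m * n) :: complex mat) $$ (i, j)"
    using ij div_mod_less_mult[OF ij(1)] div_mod_less_mult[OF ij(2)] by (auto simp: kron_index)
qed auto

text \<open>Multiplicativity is the mixed-product rule \<open>kron_mult\<close>; unitarity holds
  because inverse and adjoint both act on each factor separately.\<close>

lemma tensor_rep_unitary:
  assumes "group G" "group H" and \<rho>: "unitary_rep G \<rho>" and \<sigma>: "unitary_rep H \<sigma>"
  shows "unitary_rep (G \<times>\<times> H) (tensor_rep \<rho> \<sigma>)"
    and "rep_degree (G \<times>\<times> H) (tensor_rep \<rho> \<sigma>) = rep_degree G \<rho> * rep_degree H \<sigma>"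
proof -
  interpret G: group G by fact
  interpret H: group H by fact
  let ?n = "rep_degree G \<rho>" and ?m = "rep_degree H \<sigma>"
  have rep: "representation G \<rho>" "representation H \<sigma>" using \<rho> \<sigma> by (auto simp: unitary_rep_def)
  note car = representation_carrier[OF rep(1)] representation_carrier[OF rep(2)]
  have c: "tensor_rep \<rho> \<sigma> x \<in> carrier_mat (?n * ?m) (?n * ?m)" if "x \<in> carrier (G \<times>\<times> H)" for x
    using that kron_carrier[OF car] by (auto simp: tensor_rep_def DirProd_def)
  have m: "tensor_rep \<rho> \<sigma> (x \<otimes>\<^bsub>G \<times>\<times> H\<^esub> y) = tensor_rep \<rho> \<sigma> x * tensor_rep \<rho> \<sigma> y"
    if xy: "x \<in> carrier (G \<times>\<times> H)" "y \<in> carrier (G \<times>\<times> H)" for x y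
    using xy by (auto simp: tensor_rep_def DirProd_def representation_mult[OF rep(1)]
        representation_mult[OF rep(2)] intro!: kron_mult[OF car car, symmetric])
  have o: "tensor_rep \<rho> \<sigma> \<one>\<^bsub>G \<times>\<times> H\<^esub> = 1\<^sub>m (?n * ?m)"
    by (simp add: tensor_rep_def DirProd_def kron_one representation_one[OF \<open>group G\<close> rep(1)]
        representation_one[OF \<open>group H\<close> rep(2)])
  note R = representationI[of "G \<times>\<times> H" "tensor_rep \<rho> \<sigma>",
      OF DirProd_group[OF \<open>group G\<close> \<open>group H\<close>] c m o]
  have rep2: "representation (G \<times>\<times> H) (tensor_rep \<rho> \<sigma>)" by (rule R(1); assumption)
  have "tensor_rep \<rho> \<sigma> (inv\<^bsub>G \<times>\<times> H\<^esub> x) = mat_adjoint (tensor_rep \<rho> \<sigma> x)"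
    if x: "x \<in> carrier (G \<times>\<times> H)" for x
  proof -
    obtain g h where gh: "x = (g, h)" "g \<in> carrier G" "h \<in> carrier H"
      using x by (auto simp: DirProd_def)
    then show ?thesis
      using \<rho> \<sigma> by (simp add: inv_DirProd[OF \<open>group G\<close> \<open>group H\<close>] tensor_rep_def unitary_rep_def
          mat_adjoint_kron)
  qed
  then show "unitary_rep (G \<times>\<times> H) (tensor_rep \<rho> \<sigma>)" using rep2 by (simp add: unitary_rep_def)
  show "rep_degree (G \<times>\<times> H) (tensor_rep \<rho> \<sigma>) = ?n * ?m" by (rule R(2); assumption)
qed

lemma tensor_rep_index:
  assumes "representation G \<rho>" "representation H \<sigma>" "x \<in> carrier G" "y \<in> carrier H"
    and "a < rep_degree G \<rho> * rep_degree H \<sigma>" "b < rep_degree G \<rho> * rep_degree H \<sigma>"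
  shows "tensor_rep \<rho> \<sigma> (x, y) $$ (a, b)
    = \<rho> x $$ (a div rep_degree H \<sigma>, b div rep_degree H \<sigma>)
      * \<sigma> y $$ (a mod rep_degree H \<sigma>, b mod rep_degree H \<sigma>)"
  using assms representation_carrier[OF assms(1,3)] representation_carrier[OF assms(2,4)]
  by (simp add: tensor_rep_def kron_index)


section \<open>The convolution theorem\<close>

lemma bij_betw_inv_mult:
  assumes "group G" "y \<in> carrier G"
  shows "bij_betw (\<lambda>x. inv\<^bsub>G\<^esub> x \<otimes>\<^bsub>G\<^esub> y) (carrier G) (carrier G)"
proof -
  interpret group G by fact
  show ?thesis
    by (rule bij_betw_byWitness[where f' = "\<lambda>u. y \<otimes>\<^bsub>G\<^esub> inv\<^bsub>G\<^esub> u"])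
      (use assms(2) in \<open>auto simp: inv_mult_group m_assoc[symmetric], auto simp: m_assoc\<close>)
qed

lemma fourier_translate_right:
  assumes "group G" "representation G \<rho>" "y \<in> carrier G"
  shows "fourier G (\<lambda>u. g (u \<otimes>\<^bsub>G\<^esub> inv\<^bsub>G\<^esub> y)) \<rho> = fourier G g \<rho> * \<rho> y"
proof -
  interpret group G by fact
  let ?d = "rep_degree G \<rho>"
  note car = representation_carrier[OF assms(2)]
  have bij: "bij_betw (\<lambda>x. x \<otimes>\<^bsub>G\<^esub> y) (carrier G) (carrier G)"
    by (rule bij_betw_byWitness[where f' = "\<lambda>x. x \<otimes>\<^bsub>G\<^esub> inv\<^bsub>G\<^esub> y"])
      (use assms(3) in \<open>auto simp: m_assoc\<close>)
  have "fourier G (\<lambda>u. g (u \<otimes>\<^bsub>G\<^esub> inv\<^bsub>G\<^esub> y)) \<rho>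
      = mat_sum ?d ?d (carrier G) (\<lambda>u. g (u \<otimes>\<^bsub>G\<^esub> inv\<^bsub>G\<^esub> y) \<cdot>\<^sub>m \<rho> u)"
    by (rule fourier_eq_mat_sum) (rule car)
  also have "\<dots> = mat_sum ?d ?d (carrier G)
      (\<lambda>x. g (x \<otimes>\<^bsub>G\<^esub> y \<otimes>\<^bsub>G\<^esub> inv\<^bsub>G\<^esub> y) \<cdot>\<^sub>m \<rho> (x \<otimes>\<^bsub>G\<^esub> y))"
    by (rule mat_sum_bij_betw[OF bij, symmetric])
  also have "\<dots> = mat_sum ?d ?d (carrier G) (\<lambda>x. g x \<cdot>\<^sub>m \<rho> x * \<rho> y)"
  proof (intro mat_sum_cong refl)
    fix x assume x: "x \<in> carrier G"
    show "g (x \<otimes>\<^bsub>G\<^esub> y \<otimes>\<^bsub>G\<^esub> inv\<^bsub>G\<^esub> y) \<cdot>\<^sub>m \<rho> (x \<otimes>\<^bsub>G\<^esub> y) = g x \<cdot>\<^sub>m \<rho> x * \<rho> y"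
      using x assms(3) mult_smult_assoc_mat[OF car[OF x] car[OF assms(3)]]
      by (simp add: m_assoc representation_mult[OF assms(2)])
  qed
  also have "\<dots> = fourier G g \<rho> * \<rho> y"
    using mat_sum_mult[OF car[OF assms(3)], of "carrier G" "\<lambda>x. g x \<cdot>\<^sub>m \<rho> x" ?d] car
    by (simp add: fourier_eq_mat_sum)
  finally show ?thesis .
qed

text \<open>When the right factor is expanded as a sum over \<open>y\<close>, each
  \<open>\<rho> y\<close> is absorbed into the left factor as a right translation. Collecting terms
  leaves a convolution.\<close>

lemma fourier_mult_fourier:
  assumes "group G" "representation G \<rho>"
  shows "fourier G a \<rho> * fourier G b \<rho>
    = fourier G (\<lambda>u. \<Sum>y\<in>carrier G. a (u \<otimes>\<^bsub>G\<^esub> inv\<^bsub>G\<^esub> y) * b y) \<rho>"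
proof -
  let ?d = "rep_degree G \<rho>"
  note car = representation_carrier[OF assms(2)]
  have "fourier G a \<rho> * fourier G b \<rho>
      = mat_sum ?d ?d (carrier G) (\<lambda>y. fourier G a \<rho> * (b y \<cdot>\<^sub>m \<rho> y))"
    using car by (subst fourier_eq_mat_sum[of G \<rho> b]) (auto intro: mult_mat_sum)
  also have "\<dots> = mat_sum ?d ?d (carrier G) (\<lambda>y. b y \<cdot>\<^sub>m fourier G (\<lambda>u. a (u \<otimes>\<^bsub>G\<^esub> inv\<^bsub>G\<^esub> y)) \<rho>)"
    using mult_smult_distrib[OF fourier_carrier car]
    by (intro mat_sum_cong refl) (simp add: fourier_translate_right[OF assms])
  also have "\<dots> = fourier G (\<lambda>u. \<Sum>y\<in>carrier G. a (u \<otimes>\<^bsub>G\<^esub> inv\<^bsub>G\<^esub> y) * b y) \<rho>"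
  proof (rule eq_matI)
    fix i j assume "i < dim_row (fourier G (\<lambda>u. \<Sum>y\<in>carrier G. a (u \<otimes>\<^bsub>G\<^esub> inv\<^bsub>G\<^esub> y) * b y) \<rho>)"
      "j < dim_col (fourier G (\<lambda>u. \<Sum>y\<in>carrier G. a (u \<otimes>\<^bsub>G\<^esub> inv\<^bsub>G\<^esub> y) * b y) \<rho>)"
    then have ij: "i < ?d" "j < ?d" by auto
    have "mat_sum ?d ?d (carrier G) (\<lambda>y. b y \<cdot>\<^sub>m fourier G (\<lambda>u. a (u \<otimes>\<^bsub>G\<^esub> inv\<^bsub>G\<^esub> y)) \<rho>) $$ (i, j)
        = (\<Sum>y\<in>carrier G. \<Sum>u\<in>carrier G. \<rho> u $$ (i, j) * (a (u \<otimes>\<^bsub>G\<^esub> inv\<^bsub>G\<^esub> y) * b y))"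
      using ij by (simp add: fourier_def sum_distrib_left algebra_simps)
    also have "\<dots> = fourier G (\<lambda>u. \<Sum>y\<in>carrier G. a (u \<otimes>\<^bsub>G\<^esub> inv\<^bsub>G\<^esub> y) * b y) \<rho> $$ (i, j)"
      using ij by (subst sum.swap) (simp add: fourier_def sum_distrib_left)
    finally show "mat_sum ?d ?d (carrier G) (\<lambda>y. b y \<cdot>\<^sub>m fourier G (\<lambda>u. a (u \<otimes>\<^bsub>G\<^esub> inv\<^bsub>G\<^esub> y)) \<rho>) $$ (i, j)
        = fourier G (\<lambda>u. \<Sum>y\<in>carrier G. a (u \<otimes>\<^bsub>G\<^esub> inv\<^bsub>G\<^esub> y) * b y) \<rho> $$ (i, j)" .
  qed auto
  finally show ?thesis .
qed

text \<open>The adjoint is the transform of u \<mapsto> cnj (r (u^-1)), so the product is the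
  transform of a convolution. The group is arbitrary: it is \<open>G\<close> for the skew spectrum
  and the product group for the bispectrum.\<close>

lemma fourier_cross_correlation:
  assumes "group G" "unitary_rep G \<rho>"
  shows "mat_adjoint (fourier G r \<rho>) * fourier G g \<rho>
    = fourier G (\<lambda>u. \<Sum>y\<in>carrier G. cnj (r (y \<otimes>\<^bsub>G\<^esub> inv\<^bsub>G\<^esub> u)) * g y) \<rho>"
proof -
  interpret group G by fact
  have rep: "representation G \<rho>" using assms by (simp add: unitary_rep_def)
  have "mat_adjoint (fourier G r \<rho>) * fourier G g \<rho>
      = fourier G (\<lambda>u. \<Sum>y\<in>carrier G. cnj (r (inv\<^bsub>G\<^esub> (u \<otimes>\<^bsub>G\<^esub> inv\<^bsub>G\<^esub> y))) * g y) \<rho>"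
    unfolding fourier_adjoint[OF assms, symmetric] by (rule fourier_mult_fourier[OF assms(1) rep])
  also have "\<dots> = fourier G (\<lambda>u. \<Sum>y\<in>carrier G. cnj (r (y \<otimes>\<^bsub>G\<^esub> inv\<^bsub>G\<^esub> u)) * g y) \<rho>"
    by (intro fourier_cong sum.cong refl) (simp add: inv_mult_group)
  finally show ?thesis .
qed

lemma skew_spectrum_eq_fourier:
  assumes "group G" "unitary_rep G \<rho>"
  shows "skew_spectrum G f z \<rho> = fourier G (skew_correlation G f z) \<rho>"
  unfolding skew_spectrum_def fourier_cross_correlation[OF assms]
  by (intro fourier_cong) (simp add: skew_correlation_def)

text \<open>The point is y x^-1 z = y (z^-1 x)^-1, which is why the slice index is the inverse of
  \<open>z\<close>.\<close>

lemma skew_correlation_eq_triple_correlation: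
  assumes "group G" "z \<in> carrier G" "x \<in> carrier G"
  shows "skew_correlation G f z x = triple_correlation G f (x, inv\<^bsub>G\<^esub> z \<otimes>\<^bsub>G\<^esub> x)"
proof -
  interpret group G by fact
  show ?thesis
    using assms by (auto simp: skew_correlation_def triple_correlation_def inv_mult_group m_assoc
        intro!: sum.cong)
qed


section \<open>The bispectrum\<close>

text \<open>A block-diagonal matrix depends linearly on its blocks, so the sum over \<open>y\<close>
  may be taken outside. The total size \<open>s\<close> is generalised in the induction because
  removing the first block shrinks it.\<close>

lemma diag_block_mat_fourier:
  assumes "\<And>\<rho>. \<rho> \<in> set L \<Longrightarrow> representation G \<rho>"
    and s: "s = (\<Sum>\<rho>\<leftarrow>L. rep_degree G \<rho>)"
  shows "diag_block_mat (map (fourier G f) L)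
    = mat_sum s s (carrier G) (\<lambda>y. f y \<cdot>\<^sub>m diag_block_mat (map (\<lambda>\<rho>. \<rho> y) L))"
  using assms
proof (induction L arbitrary: s)
  case Nil
  then show ?case by (auto intro!: eq_matI)
next
  case (Cons \<rho> L)
  define t where "t = (\<Sum>\<rho>\<leftarrow>L. rep_degree G \<rho>)"
  let ?d = "rep_degree G \<rho>"
  have IH: "diag_block_mat (map (fourier G f) L)
    = mat_sum t t (carrier G) (\<lambda>y. f y \<cdot>\<^sub>m diag_block_mat (map (\<lambda>\<rho>. \<rho> y) L))"
    using Cons.IH[OF _ t_def] Cons.prems(1) by simp
  have car: "\<tau> y \<in> carrier_mat (rep_degree G \<tau>) (rep_degree G \<tau>)"
    if "\<tau> \<in> set (\<rho> # L)" "y \<in> carrier G" for \<tau> y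
    using representation_carrier[OF Cons.prems(1)[OF that(1)] that(2)] .
  have \<rho>c: "\<rho> y \<in> carrier_mat ?d ?d" if "y \<in> carrier G" for y using car[of \<rho> y] that by simp
  have dims: "dim_row (diag_block_mat (map (\<lambda>\<rho>. \<rho> y) L)) = t"
    "dim_col (diag_block_mat (map (\<lambda>\<rho>. \<rho> y) L)) = t" if y: "y \<in> carrier G" for y
    unfolding dim_diag_block_mat t_def map_map comp_def
    by (auto simp: carrier_matD[OF car[OF _ y]] intro!: arg_cong[where f = sum_list])
  have s: "s = ?d + t" using Cons.prems(2) by (simp add: t_def)
  show ?case
  proof (rule eq_matI)
    fix i j assume "i < dim_row (mat_sum s s (carrier G) (\<lambda>y. f y \<cdot>\<^sub>m diag_block_mat (map (\<lambda>\<rho>. \<rho> y) (\<rho> # L))))"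
      "j < dim_col (mat_sum s s (carrier G) (\<lambda>y. f y \<cdot>\<^sub>m diag_block_mat (map (\<lambda>\<rho>. \<rho> y) (\<rho> # L))))"
    then have ij: "i < ?d + t" "j < ?d + t" using s by auto
    \<comment> \<open>\<open>L\<close> and \<open>R\<close> split both sides into the same four
      blocks, with zeros off the diagonal.\<close>
    have L: "diag_block_mat (map (fourier G f) (\<rho> # L)) $$ (i, j)
      = (if i < ?d then if j < ?d then fourier G f \<rho> $$ (i, j) else 0
         else if j < ?d then 0 else diag_block_mat (map (fourier G f) L) $$ (i - ?d, j - ?d))"
      using ij by (auto simp: Let_def IH)
    have R: "diag_block_mat (map (\<lambda>\<rho>. \<rho> y) (\<rho> # L)) $$ (i, j)
      = (if i < ?d then if j < ?d then \<rho> y $$ (i, j) else 0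
         else if j < ?d then 0 else diag_block_mat (map (\<lambda>\<rho>. \<rho> y) L) $$ (i - ?d, j - ?d))"
      if y: "y \<in> carrier G" for y
      using ij \<rho>c[OF y] dims[OF y] by (auto simp: Let_def)
    have "mat_sum s s (carrier G) (\<lambda>y. f y \<cdot>\<^sub>m diag_block_mat (map (\<lambda>\<rho>. \<rho> y) (\<rho> # L))) $$ (i, j)
      = (\<Sum>y\<in>carrier G. f y * diag_block_mat (map (\<lambda>\<rho>. \<rho> y) (\<rho> # L)) $$ (i, j))"
      using ij s dims \<rho>c[THEN carrier_matD(1)] \<rho>c[THEN carrier_matD(2)]
      by (auto simp: Let_def intro!: sum.cong)
    also have "\<dots> = (\<Sum>y\<in>carrier G. f y * (if i < ?d then if j < ?d then \<rho> y $$ (i, j) else 0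
         else if j < ?d then 0 else diag_block_mat (map (\<lambda>\<rho>. \<rho> y) L) $$ (i - ?d, j - ?d)))"
      by (intro sum.cong refl) (simp only: R)
    also have "\<dots> = diag_block_mat (map (fourier G f) (\<rho> # L)) $$ (i, j)"
      unfolding L using ij dims by (auto simp: IH fourier_def mult.commute)
    finally show "diag_block_mat (map (fourier G f) (\<rho> # L)) $$ (i, j)
      = mat_sum s s (carrier G) (\<lambda>y. f y \<cdot>\<^sub>m diag_block_mat (map (\<lambda>\<rho>. \<rho> y) (\<rho> # L))) $$ (i, j)" by simp
  qed (auto simp: Let_def IH s)
qed

text \<open>Repeating the representations first and applying \<open>A\<close> afterwards turns the
  isotypic sum into a map over one list \<open>L\<close>, the same for \<open>fourier G f\<close>
  and for evaluation at \<open>y\<close>.\<close>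

lemma isotypic_sum_fourier:
  assumes "\<And>\<rho>. \<rho> \<in> set Rs \<Longrightarrow> representation G \<rho>"
    and s: "s = (\<Sum>\<rho>\<leftarrow>Rs. m \<rho> * rep_degree G \<rho>)"
  shows "isotypic_sum Rs m (fourier G f)
    = mat_sum s s (carrier G) (\<lambda>y. f y \<cdot>\<^sub>m isotypic_sum Rs m (\<lambda>\<rho>. \<rho> y))"
    and "y \<in> carrier G \<Longrightarrow> isotypic_sum Rs m (\<lambda>\<rho>. \<rho> y) \<in> carrier_mat s s"
proof -
  define L where "L = concat (map (\<lambda>\<rho>. replicate (m \<rho>) \<rho>) Rs)"
  have iso: "isotypic_sum Rs m A = diag_block_mat (map A L)" for A
    by (simp add: isotypic_sum_def L_def map_concat comp_def)
  have setL: "\<rho> \<in> set Rs" if "\<rho> \<in> set L" for \<rho> using that by (auto simp: L_def)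
  have sL: "s = (\<Sum>\<rho>\<leftarrow>L. rep_degree G \<rho>)"
    unfolding s L_def by (induction Rs) (auto simp: sum_list_replicate)
  show "isotypic_sum Rs m (fourier G f)
    = mat_sum s s (carrier G) (\<lambda>y. f y \<cdot>\<^sub>m isotypic_sum Rs m (\<lambda>\<rho>. \<rho> y))"
    unfolding iso by (rule diag_block_mat_fourier[OF assms(1)[OF setL] sL])
  assume y: "y \<in> carrier G"
  have "dim_row (\<rho> y) = rep_degree G \<rho>" "dim_col (\<rho> y) = rep_degree G \<rho>" if "\<rho> \<in> set L" for \<rho>
    using representation_carrier[OF assms(1)[OF setL[OF that]] y] by auto
  then show "isotypic_sum Rs m (\<lambda>\<rho>. \<rho> y) \<in> carrier_mat s s"
    unfolding iso sL
    by (intro carrier_matI) (auto simp: dim_diag_block_mat comp_def intro!: arg_cong[where f = sum_list])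
qed

text \<open>
  The bracket in the definition of the bispectrum is the Fourier transform over \<open>G \<times> G\<close> of the
  function that equals \<open>f\<close> on the diagonal and vanishes off it.
\<close>

lemma bispectrum_eq_fourier:
  assumes "group G" and fin: "finite (carrier G)"
    and unit: "\<And>\<rho>. \<rho> \<in> set Rs \<Longrightarrow> unitary_rep G \<rho>"
    and cg: "clebsch_gordan G Rs m C"
    and \<rho>: "\<rho>\<^sub>1 \<in> set Rs" "\<rho>\<^sub>2 \<in> set Rs"
  shows "bispectrum G Rs m C f \<rho>\<^sub>1 \<rho>\<^sub>2 = fourier (G \<times>\<times> G) (triple_correlation G f) (tensor_rep \<rho>\<^sub>1 \<rho>\<^sub>2)"
proof -
  interpret group G by fact
  let ?d1 = "rep_degree G \<rho>\<^sub>1" and ?d2 = "rep_degree G \<rho>\<^sub>2"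
  let ?s = "?d1 * ?d2" and ?\<tau> = "tensor_rep \<rho>\<^sub>1 \<rho>\<^sub>2" and ?GG = "G \<times>\<times> G"
  define K where "K = C \<rho>\<^sub>1 \<rho>\<^sub>2"
  define J where "J y = isotypic_sum Rs (m \<rho>\<^sub>1 \<rho>\<^sub>2) (\<lambda>\<rho>. \<rho> y)" for y
  have rep: "representation G \<rho>" if "\<rho> \<in> set Rs" for \<rho> using unit[OF that] by (simp add: unitary_rep_def)
  have deg: "?s = (\<Sum>\<rho>\<leftarrow>Rs. m \<rho>\<^sub>1 \<rho>\<^sub>2 \<rho> * rep_degree G \<rho>)" and K: "K \<in> carrier_mat ?s ?s"
    and dec: "\<And>x. x \<in> carrier G \<Longrightarrow> \<rho>\<^sub>1 x \<otimes>\<^sub>k \<rho>\<^sub>2 x = K * J x * mat_adjoint K"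
    using cg \<rho> unfolding clebsch_gordan_def unitary_mat_def K_def J_def by auto
  note \<tau> = tensor_rep_unitary[OF \<open>group G\<close> \<open>group G\<close> unit[OF \<rho>(1)] unit[OF \<rho>(2)]]
  have \<tau>rep: "representation ?GG ?\<tau>" using \<tau>(1) by (simp add: unitary_rep_def)
  have \<tau>c: "?\<tau> p \<in> carrier_mat ?s ?s" if "p \<in> carrier ?GG" for p
    using representation_carrier[OF \<tau>rep that] by (simp add: \<tau>(2))
  have J: "J y \<in> carrier_mat ?s ?s" if "y \<in> carrier G" for y
    unfolding J_def by (rule isotypic_sum_fourier(2)[OF rep deg that])
  \<comment> \<open>Functions on the product group whose transforms are the two factors of the
    bispectrum: f tensor f, and f on the diagonal.\<close>
  let ?r = "\<lambda>(x\<^sub>1, x\<^sub>2). f x\<^sub>1 * f x\<^sub>2"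
  let ?g = "\<lambda>(y\<^sub>1, y\<^sub>2). if y\<^sub>1 = y\<^sub>2 then f y\<^sub>1 else 0"
  have car: "carrier ?GG = carrier G \<times> carrier G" by (simp add: DirProd_def)
  have 1: "fourier G f \<rho>\<^sub>1 \<otimes>\<^sub>k fourier G f \<rho>\<^sub>2 = fourier ?GG ?r ?\<tau>"
  proof (rule eq_matI)
    fix i j assume "i < dim_row (fourier ?GG ?r ?\<tau>)" "j < dim_col (fourier ?GG ?r ?\<tau>)"
    then have ij: "i < ?s" "j < ?s" by (auto simp: \<tau>(2))
    have "(fourier G f \<rho>\<^sub>1 \<otimes>\<^sub>k fourier G f \<rho>\<^sub>2) $$ (i, j)
        = (\<Sum>x\<in>carrier G. \<rho>\<^sub>1 x $$ (i div ?d2, j div ?d2) * f x) *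
          (\<Sum>x\<in>carrier G. \<rho>\<^sub>2 x $$ (i mod ?d2, j mod ?d2) * f x)"
      using ij div_mod_less_mult[OF ij(1)] div_mod_less_mult[OF ij(2)]
      by (simp add: kron_index) (simp add: fourier_def)
    also have "\<dots> = (\<Sum>(x\<^sub>1, x\<^sub>2)\<in>carrier G \<times> carrier G. ?\<tau> (x\<^sub>1, x\<^sub>2) $$ (i, j) * (f x\<^sub>1 * f x\<^sub>2))"
      unfolding sum_product sum.cartesian_product
      using tensor_rep_index[OF rep[OF \<rho>(1)] rep[OF \<rho>(2)] _ _ ij]
      by (intro sum.cong refl) (auto simp: algebra_simps)
    also have "\<dots> = fourier ?GG ?r ?\<tau> $$ (i, j)"
      using ij by (simp add: fourier_def \<tau>(2) car case_prod_unfold)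
    finally show "(fourier G f \<rho>\<^sub>1 \<otimes>\<^sub>k fourier G f \<rho>\<^sub>2) $$ (i, j) = fourier ?GG ?r ?\<tau> $$ (i, j)" .
  qed (auto simp: \<tau>(2))
  have "K * isotypic_sum Rs (m \<rho>\<^sub>1 \<rho>\<^sub>2) (fourier G f) * mat_adjoint K
      = K * mat_sum ?s ?s (carrier G) (\<lambda>y. f y \<cdot>\<^sub>m J y) * mat_adjoint K"
    by (simp only: J_def isotypic_sum_fourier(1)[OF rep deg])
  also have "\<dots> = mat_sum ?s ?s (carrier G) (\<lambda>y. K * (f y \<cdot>\<^sub>m J y)) * mat_adjoint K"
    using mult_mat_sum[OF K, of "carrier G" "\<lambda>y. f y \<cdot>\<^sub>m J y" ?s] J by simp
  also have "\<dots> = mat_sum ?s ?s (carrier G) (\<lambda>y. K * (f y \<cdot>\<^sub>m J y) * mat_adjoint K)"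
    using J K by (intro mat_sum_mult[of _ ?s]) auto
  \<comment> \<open>The Clebsch-Gordan identity is read from right to left: conjugating the block
    matrix of \<open>y\<close> by \<open>K\<close> restores the tensor product at \<open>y\<close>,
    which is the value of \<open>?\<tau>\<close> at \<open>(y, y)\<close>.\<close>
  also have "\<dots> = mat_sum ?s ?s (carrier G) (\<lambda>y. f y \<cdot>\<^sub>m ?\<tau> (y, y))"
  proof (intro mat_sum_cong refl)
    fix y assume y: "y \<in> carrier G"
    have "K * (f y \<cdot>\<^sub>m J y) * mat_adjoint K = f y \<cdot>\<^sub>m (K * J y * mat_adjoint K)"
      using mult_smult_distrib[OF K J[OF y]]
        mult_smult_assoc_mat[OF mult_carrier_mat[OF K J[OF y]] mat_adjoint_carrier[OF K]] by simp
    then show "K * (f y \<cdot>\<^sub>m J y) * mat_adjoint K = f y \<cdot>\<^sub>m ?\<tau> (y, y)"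
      using dec[OF y] by (simp add: tensor_rep_def)
  qed
  also have "\<dots> = fourier ?GG ?g ?\<tau>"
  proof (rule eq_matI)
    fix i j assume "i < dim_row (fourier ?GG ?g ?\<tau>)" "j < dim_col (fourier ?GG ?g ?\<tau>)"
    then have ij: "i < ?s" "j < ?s" by (auto simp: \<tau>(2))
    have "fourier ?GG ?g ?\<tau> $$ (i, j)
        = (\<Sum>y\<in>carrier G. \<Sum>y'\<in>carrier G. ?\<tau> (y, y') $$ (i, j) * (if y = y' then f y else 0))"
      using ij by (simp add: fourier_def \<tau>(2) car sum.cartesian_product case_prod_unfold)
    also have "\<dots> = (\<Sum>y\<in>carrier G. \<Sum>y'\<in>carrier G. if y = y' then ?\<tau> (y, y) $$ (i, j) * f y else 0)"
      by (intro sum.cong refl) auto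
    also have "\<dots> = (\<Sum>y\<in>carrier G. ?\<tau> (y, y) $$ (i, j) * f y)"
      using fin by simp
    also have "\<dots> = mat_sum ?s ?s (carrier G) (\<lambda>y. f y \<cdot>\<^sub>m ?\<tau> (y, y)) $$ (i, j)"
      using ij \<tau>c car by (auto simp: mult.commute carrier_matD[OF \<tau>c] intro!: sum.cong)
    finally show "mat_sum ?s ?s (carrier G) (\<lambda>y. f y \<cdot>\<^sub>m ?\<tau> (y, y)) $$ (i, j)
        = fourier ?GG ?g ?\<tau> $$ (i, j)" by simp
  qed (auto simp: \<tau>(2))
  finally have 2: "K * isotypic_sum Rs (m \<rho>\<^sub>1 \<rho>\<^sub>2) (fourier G f) * mat_adjoint K = fourier ?GG ?g ?\<tau>" .
  have "bispectrum G Rs m C f \<rho>\<^sub>1 \<rho>\<^sub>2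
      = fourier ?GG (\<lambda>u. \<Sum>y\<in>carrier ?GG. cnj (?r (y \<otimes>\<^bsub>?GG\<^esub> inv\<^bsub>?GG\<^esub> u)) * ?g y) ?\<tau>"
    unfolding bispectrum_def 1 K_def[symmetric] 2
    by (rule fourier_cross_correlation[OF DirProd_group[OF \<open>group G\<close> \<open>group G\<close>] \<tau>(1)])
  also have "\<dots> = fourier ?GG (triple_correlation G f) ?\<tau>"
  proof (rule fourier_cong)
    fix u assume "u \<in> carrier ?GG"
    then obtain u\<^sub>1 u\<^sub>2 where u: "u = (u\<^sub>1, u\<^sub>2)" "u\<^sub>1 \<in> carrier G" "u\<^sub>2 \<in> carrier G" by (auto simp: car)
    have "(\<Sum>y\<in>carrier ?GG. cnj (?r (y \<otimes>\<^bsub>?GG\<^esub> inv\<^bsub>?GG\<^esub> u)) * ?g y)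
        = (\<Sum>y\<in>carrier G. \<Sum>y'\<in>carrier G. cnj (f (y \<otimes>\<^bsub>G\<^esub> inv\<^bsub>G\<^esub> u\<^sub>1) * f (y' \<otimes>\<^bsub>G\<^esub> inv\<^bsub>G\<^esub> u\<^sub>2)) *
            (if y = y' then f y else 0))"
      unfolding car sum.cartesian_product u(1) inv_DirProd[OF \<open>group G\<close> \<open>group G\<close> u(2,3)]
      by (intro sum.cong refl) (auto simp: DirProd_def)
    \<comment> \<open>Off-diagonal terms vanish, which collapses the double sum to the single sum of
      the triple correlation.\<close>
    also have "\<dots> = (\<Sum>y\<in>carrier G. \<Sum>y'\<in>carrier G. if y = y' then
        cnj (f (y \<otimes>\<^bsub>G\<^esub> inv\<^bsub>G\<^esub> u\<^sub>1)) * cnj (f (y \<otimes>\<^bsub>G\<^esub> inv\<^bsub>G\<^esub> u\<^sub>2)) * f y else 0)"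
      by (intro sum.cong refl) auto
    also have "\<dots> = triple_correlation G f u" using fin by (simp add: triple_correlation_def u)
    finally show "(\<Sum>y\<in>carrier ?GG. cnj (?r (y \<otimes>\<^bsub>?GG\<^esub> inv\<^bsub>?GG\<^esub> u)) * ?g y) = triple_correlation G f u" .
  qed
  finally show ?thesis .
qed


section \<open>Fourier inversion and the Plancherel formula\<close>

text \<open>The inversion formula: 1/|G| times the sum of d tr(A_i rep_i(x)^dagger), with the traces
  written out in entries. The index set is abstract so that the formula covers both \<open>R\<close>
  and pairs from \<open>R\<close>.\<close>

definition inv_fourier ::
    "('a, 'b) monoid_scheme \<Rightarrow> 'i set \<Rightarrow> ('i \<Rightarrow> 'a mrep) \<Rightarrow> ('i \<Rightarrow> complex mat) \<Rightarrow> 'a \<Rightarrow> complex" where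
  "inv_fourier G I rep A x = 1 / of_nat (card (carrier G)) *
     (\<Sum>i\<in>I. of_nat (rep_degree G (rep i)) *
       (\<Sum>a<rep_degree G (rep i). \<Sum>b<rep_degree G (rep i). A i $$ (a, b) * cnj (rep i x $$ (a, b))))"

lemma inv_fourier_add:
  assumes "A \<in> spectral_space G I rep" "B \<in> spectral_space G I rep"
  shows "inv_fourier G I rep (\<lambda>i\<in>I. A i + B i) x = inv_fourier G I rep A x + inv_fourier G I rep B x"
proof -
  have car: "A i \<in> carrier_mat (rep_degree G (rep i)) (rep_degree G (rep i))"
    "B i \<in> carrier_mat (rep_degree G (rep i)) (rep_degree G (rep i))" if "i \<in> I" for i
    using assms that by (auto simp: spectral_space_def)
  show ?thesis
    unfolding inv_fourier_def distrib_left[symmetric] sum.distrib[symmetric]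
    using car by (intro arg_cong[where f = "(*) _"] sum.cong refl)
      (auto simp: distrib_left[symmetric] sum.distrib[symmetric] carrier_matD[OF car(2)]
        algebra_simps intro!: arg_cong[where f = "(*) _"] sum.cong)
qed

lemma inv_fourier_smult:
  assumes "A \<in> spectral_space G I rep"
  shows "inv_fourier G I rep (\<lambda>i\<in>I. c \<cdot>\<^sub>m A i) x = c * inv_fourier G I rep A x"
proof -
  have car: "A i \<in> carrier_mat (rep_degree G (rep i)) (rep_degree G (rep i))" if "i \<in> I" for i
    using assms that by (auto simp: spectral_space_def)
  show ?thesis
    unfolding inv_fourier_def sum_distrib_left
    by (intro sum.cong refl) (auto simp: carrier_matD[OF car] algebra_simps)
qed

text \<open>What inversion and Plancherel use about a family of representations. Neither
  \<open>orth\<close> nor \<open>inj\<close> mentions multiplication in the group, so both can be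
  verified on a product group coordinate by coordinate.\<close>

locale fourier_basis =
  fixes G :: "('a, 'b) monoid_scheme" and I :: "'i set" and rep :: "'i \<Rightarrow> 'a mrep"
  assumes fin_G: "finite (carrier G)" and nonempty_G: "carrier G \<noteq> {}" and fin_I: "finite I"
    and orth: "\<And>i j a b c e. i \<in> I \<Longrightarrow> j \<in> I \<Longrightarrow>
      a < rep_degree G (rep i) \<Longrightarrow> b < rep_degree G (rep i) \<Longrightarrow>
      c < rep_degree G (rep j) \<Longrightarrow> e < rep_degree G (rep j) \<Longrightarrow>
      (\<Sum>x\<in>carrier G. rep i x $$ (a, b) * cnj (rep j x $$ (c, e)))
      = (if i = j \<and> a = c \<and> b = e then of_nat (card (carrier G)) / of_nat (rep_degree G (rep i)) else 0)"
    and inj: "\<And>g x. (\<And>i. i \<in> I \<Longrightarrow>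
        fourier G g (rep i) = 0\<^sub>m (rep_degree G (rep i)) (rep_degree G (rep i))) \<Longrightarrow>
      x \<in> carrier G \<Longrightarrow> g x = 0"
begin

abbreviation deg :: "'i \<Rightarrow> nat" where "deg i \<equiv> rep_degree G (rep i)"

lemma card_pos: "card (carrier G) > 0"
  using fin_G nonempty_G by (simp add: card_gt_0_iff)

lemma fourier_in_spectral_space: "(\<lambda>i\<in>I. fourier G g (rep i)) \<in> spectral_space G I rep"
  by (auto simp: spectral_space_def)

text \<open>Exchanging sums leaves inner products of coefficients. Orthogonality keeps the one term
  with \<open>j = i\<close> and matching entries, and the weight deg/|G| cancels the squared norm
  |G|/deg. In particular every family of matrices is a transform.\<close>

lemma fourier_inv_fourier:
  assumes A: "A \<in> spectral_space G I rep" and i: "i \<in> I"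
  shows "fourier G (inv_fourier G I rep A) (rep i) = A i"
proof (rule eq_matI)
  have Ai: "A i \<in> carrier_mat (deg i) (deg i)" using A i by (auto simp: spectral_space_def)
  fix a b assume "a < dim_row (A i)" "b < dim_col (A i)"
  then have ab: "a < deg i" "b < deg i" using Ai by auto
  let ?N = "of_nat (card (carrier G)) :: complex"
  have "fourier G (inv_fourier G I rep A) (rep i) $$ (a, b)
    = (\<Sum>x\<in>carrier G. \<Sum>j\<in>I. \<Sum>c<deg j. \<Sum>e<deg j. of_nat (deg j) / ?N * A j $$ (c, e) *
        (rep i x $$ (a, b) * cnj (rep j x $$ (c, e))))"
    using ab by (simp add: fourier_def inv_fourier_def sum_distrib_left algebra_simps)
  also have "\<dots> = (\<Sum>j\<in>I. \<Sum>c<deg j. \<Sum>e<deg j. of_nat (deg j) / ?N * A j $$ (c, e) *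
        (\<Sum>x\<in>carrier G. rep i x $$ (a, b) * cnj (rep j x $$ (c, e))))"
    unfolding sum_distrib_left
    by (subst sum.swap, intro sum.cong refl, subst sum.swap, intro sum.cong refl, rule sum.swap)
  also have "\<dots> = (\<Sum>j\<in>I. \<Sum>c<deg j. \<Sum>e<deg j. if i = j \<and> a = c \<and> b = e then A i $$ (a, b) else 0)"
  proof (intro sum.cong refl)
    fix j c e assume j: "j \<in> I" and c: "c \<in> {..<deg j}" and e: "e \<in> {..<deg j}"
    \<comment> \<open>The index \<open>c\<close> lies below \<open>deg j\<close>, so the degree may
      be cancelled.\<close>
    have "deg j \<noteq> 0" using c by auto
    then show "of_nat (deg j) / ?N * A j $$ (c, e) *
        (\<Sum>x\<in>carrier G. rep i x $$ (a, b) * cnj (rep j x $$ (c, e)))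
      = (if i = j \<and> a = c \<and> b = e then A i $$ (a, b) else 0)"
      using orth[OF i j ab] c e card_pos by auto
  qed
  also have "\<dots> = (\<Sum>j\<in>I. if i = j then A i $$ (a, b) else 0)"
  proof (intro sum.cong refl)
    fix j assume "j \<in> I"
    show "(\<Sum>c<deg j. \<Sum>e<deg j. if i = j \<and> a = c \<and> b = e then A i $$ (a, b) else 0)
      = (if i = j then A i $$ (a, b) else 0)"
    proof (cases "i = j")
      case True
      have "(\<Sum>c<deg i. \<Sum>e<deg i. if a = c \<and> b = e then A i $$ (a, b) else 0)
        = (\<Sum>c<deg i. if a = c then A i $$ (a, b) else 0)"
      proof (intro sum.cong refl)
        fix c
        show "(\<Sum>e<deg i. if a = c \<and> b = e then A i $$ (a, b) else 0)
          = (if a = c then A i $$ (a, b) else 0)"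
          using ab by (cases "a = c") auto
      qed
      with True ab show ?thesis by simp
    qed simp
  qed
  also have "\<dots> = A i $$ (a, b)" using i fin_I by simp
  finally show "fourier G (inv_fourier G I rep A) (rep i) $$ (a, b) = A i $$ (a, b)" .
qed (use assms in \<open>auto simp: spectral_space_def dest: PiE_mem\<close>)

text \<open>\<open>g\<close> and its reconstruction have the same transform by
  \<open>fourier_inv_fourier\<close>, and injectivity makes them equal.\<close>

lemma inv_fourier_fourier:
  assumes x: "x \<in> carrier G"
  shows "inv_fourier G I rep (\<lambda>i\<in>I. fourier G g (rep i)) x = g x"
proof -
  let ?h = "inv_fourier G I rep (\<lambda>i\<in>I. fourier G g (rep i))"
  \<comment> \<open>The difference is written with a factor -1 so that \<open>fourier_add\<close>
    and \<open>fourier_smult\<close> apply.\<close>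
  have "?h x + (-1) * g x = 0"
  proof (rule inj[OF _ x])
    fix i assume i: "i \<in> I"
    have "fourier G ?h (rep i) = fourier G g (rep i)"
      using fourier_inv_fourier[OF fourier_in_spectral_space i, of g] i by simp
    then show "fourier G (\<lambda>x. ?h x + (-1) * g x) (rep i) = 0\<^sub>m (deg i) (deg i)"
      unfolding fourier_add fourier_smult by (auto intro!: eq_matI)
  qed
  then show ?thesis by simp
qed

text \<open>Plancherel, stated from the matrix side because the unitary map starts there. One factor
  of |g(x)|^2 is expanded by the inversion formula; summing the other against conjugated
  coefficients returns conjugated entries of \<open>A\<close>.\<close>

lemma spectral_norm_sq_inv_fourier:
  assumes A: "A \<in> spectral_space G I rep"
  shows "spectral_norm_sq G I rep A
    = 1 / real (card (carrier G)) * (\<Sum>x\<in>carrier G. (cmod (inv_fourier G I rep A x))\<^sup>2)"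
proof -
  let ?N = "of_nat (card (carrier G)) :: complex"
  let ?g = "inv_fourier G I rep A"
  have car: "A i \<in> carrier_mat (deg i) (deg i)" if "i \<in> I" for i
    using A that by (auto simp: spectral_space_def)
  have Ag: "cnj (A i $$ (a, b)) = (\<Sum>x\<in>carrier G. cnj (rep i x $$ (a, b)) * cnj (?g x))"
    if i: "i \<in> I" and ab: "a < deg i" "b < deg i" for i a b
  proof -
    have "A i $$ (a, b) = (\<Sum>x\<in>carrier G. rep i x $$ (a, b) * ?g x)"
      unfolding fourier_inv_fourier[OF A i, symmetric] using ab by (simp add: fourier_def)
    then show ?thesis by simp
  qed
  \<comment> \<open>Naming the conjugate factor hides it from the unfolding of
    \<open>inv_fourier_def\<close>, so that just one of the two factors is expanded.\<close>
  define h where "h x = cnj (?g x)" for x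
  have "complex_of_real (\<Sum>x\<in>carrier G. (cmod (?g x))\<^sup>2) = (\<Sum>x\<in>carrier G. ?g x * h x)"
    unfolding of_real_sum complex_norm_square h_def ..
  also have "\<dots> = (\<Sum>x\<in>carrier G. \<Sum>i\<in>I. \<Sum>a<deg i. \<Sum>b<deg i.
      of_nat (deg i) / ?N * A i $$ (a, b) * (cnj (rep i x $$ (a, b)) * h x))"
    unfolding inv_fourier_def
    by (simp add: sum_distrib_left sum_distrib_right algebra_simps)
  also have "\<dots> = (\<Sum>i\<in>I. \<Sum>a<deg i. \<Sum>b<deg i. of_nat (deg i) / ?N * A i $$ (a, b) *
      (\<Sum>x\<in>carrier G. cnj (rep i x $$ (a, b)) * h x))"
    unfolding sum_distrib_left
    by (subst sum.swap, intro sum.cong refl, subst sum.swap, intro sum.cong refl, rule sum.swap)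
  also have "\<dots> = (\<Sum>i\<in>I. \<Sum>a<deg i. \<Sum>b<deg i.
      complex_of_real (real (deg i) / real (card (carrier G)) * (cmod (A i $$ (a, b)))\<^sup>2))"
    by (intro sum.cong refl) (simp add: Ag[symmetric] h_def complex_norm_square del: of_real_power)
  also have "\<dots> = complex_of_real (\<Sum>i\<in>I. \<Sum>a<deg i. \<Sum>b<deg i.
      real (deg i) / real (card (carrier G)) * (cmod (A i $$ (a, b)))\<^sup>2)"
    by (simp only: of_real_sum)
  finally have *: "(\<Sum>x\<in>carrier G. (cmod (?g x))\<^sup>2) = (\<Sum>i\<in>I. \<Sum>a<deg i. \<Sum>b<deg i.
      real (deg i) / real (card (carrier G)) * (cmod (A i $$ (a, b)))\<^sup>2)"
    by (simp only: of_real_eq_iff)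
  show ?thesis
    unfolding * spectral_norm_sq_def frobenius_sq_def Coset.order_def
    by (auto simp: carrier_matD[OF car] sum_distrib_left power2_eq_square field_simps intro!: sum.cong)
qed

lemma spectral_norm_sq_fourier:
  "spectral_norm_sq G I rep (\<lambda>i\<in>I. fourier G g (rep i))
    = 1 / real (card (carrier G)) * (\<Sum>x\<in>carrier G. (cmod (g x))\<^sup>2)"
  using spectral_norm_sq_inv_fourier[OF fourier_in_spectral_space, of g]
  by (simp add: inv_fourier_fourier)

end

section \<open>Bases from irreducible representations and from tensor products\<close>

lemma fourier_basis_irreps:
  assumes "group G" "finite (carrier G)" "complete_unitary_irreps G R" "finite R"
  shows "fourier_basis G R (\<lambda>\<rho>. \<rho>)"
proof
  show "carrier G \<noteq> {}" using assms(1) by (metis empty_iff group.is_monoid monoid.one_closed)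
  show "(\<Sum>x\<in>carrier G. \<rho> x $$ (a, b) * cnj (\<sigma> x $$ (c, e)))
      = (if \<rho> = \<sigma> \<and> a = c \<and> b = e then of_nat (card (carrier G)) / of_nat (rep_degree G \<rho>) else 0)"
    if "\<rho> \<in> R" "\<sigma> \<in> R" "a < rep_degree G \<rho>" "b < rep_degree G \<rho>" "c < rep_degree G \<sigma>" "e < rep_degree G \<sigma>"
    for \<rho> \<sigma> a b c e
    by (rule schur_orthogonality[OF assms(1-3) that(1,2,3,4,5,6)])
  show "g x = 0" if "\<And>\<rho>. \<rho> \<in> R \<Longrightarrow> fourier G g \<rho> = 0\<^sub>m (rep_degree G \<rho>) (rep_degree G \<rho>)" "x \<in> carrier G"
    for g x
    by (rule fourier_injective[OF assms(1-3) that])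
qed (use assms in auto)

text \<open>Inner products of product coefficients factor over the two groups. For injectivity,
  transform in the first variable alone: the resulting function of the second variable has entries
  of the full transform as its own coefficients, so it vanishes, and then so does
  \<open>g\<close>.\<close>

lemma fourier_basis_tensor:
  assumes G: "group G" "finite (carrier G)" "complete_unitary_irreps G R" "finite R"
    and H: "group H" "finite (carrier H)" "complete_unitary_irreps H S" "finite S"
  shows "fourier_basis (G \<times>\<times> H) (R \<times> S) (\<lambda>(\<rho>, \<sigma>). tensor_rep \<rho> \<sigma>)"
proof -
  interpret G: fourier_basis G R "\<lambda>\<rho>. \<rho>" by (rule fourier_basis_irreps[OF G])
  interpret H: fourier_basis H S "\<lambda>\<sigma>. \<sigma>" by (rule fourier_basis_irreps[OF H])
  have car: "carrier (G \<times>\<times> H) = carrier G \<times> carrier H" by (simp add: DirProd_def)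
  have unitG: "unitary_rep G \<rho>" if "\<rho> \<in> R" for \<rho> using G(3) that by (simp add: complete_unitary_irreps_def)
  have unitH: "unitary_rep H \<sigma>" if "\<sigma> \<in> S" for \<sigma> using H(3) that by (simp add: complete_unitary_irreps_def)
  have repG: "representation G \<rho>" if "\<rho> \<in> R" for \<rho> using unitG[OF that] by (simp add: unitary_rep_def)
  have repH: "representation H \<sigma>" if "\<sigma> \<in> S" for \<sigma> using unitH[OF that] by (simp add: unitary_rep_def)
  have deg: "rep_degree (G \<times>\<times> H) (tensor_rep \<rho> \<sigma>) = rep_degree G \<rho> * rep_degree H \<sigma>"
    if "\<rho> \<in> R" "\<sigma> \<in> S" for \<rho> \<sigma>
    by (rule tensor_rep_unitary(2)[OF G(1) H(1) unitG[OF that(1)] unitH[OF that(2)]])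
  show ?thesis
  proof
    show "finite (carrier (G \<times>\<times> H))" using G(2) H(2) by (simp add: car)
    show "carrier (G \<times>\<times> H) \<noteq> {}" using G.nonempty_G H.nonempty_G by (simp add: car)
    show "finite (R \<times> S)" using G(4) H(4) by simp
  next
    fix i j a b c e
    assume "i \<in> R \<times> S" "j \<in> R \<times> S"
      and ab: "a < rep_degree (G \<times>\<times> H) (case i of (\<rho>, \<sigma>) \<Rightarrow> tensor_rep \<rho> \<sigma>)"
        "b < rep_degree (G \<times>\<times> H) (case i of (\<rho>, \<sigma>) \<Rightarrow> tensor_rep \<rho> \<sigma>)"
      and ce: "c < rep_degree (G \<times>\<times> H) (case j of (\<rho>, \<sigma>) \<Rightarrow> tensor_rep \<rho> \<sigma>)"
        "e < rep_degree (G \<times>\<times> H) (case j of (\<rho>, \<sigma>) \<Rightarrow> tensor_rep \<rho> \<sigma>)"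
    then obtain \<rho> \<sigma> \<rho>' \<sigma>' where ij: "i = (\<rho>, \<sigma>)" "j = (\<rho>', \<sigma>')"
      and in_RS: "\<rho> \<in> R" "\<sigma> \<in> S" "\<rho>' \<in> R" "\<sigma>' \<in> S" by blast
    let ?n = "rep_degree G \<rho>" and ?m = "rep_degree H \<sigma>" and ?n' = "rep_degree G \<rho>'" and ?m' = "rep_degree H \<sigma>'"
    have ab': "a < ?n * ?m" "b < ?n * ?m" and ce': "c < ?n' * ?m'" "e < ?n' * ?m'"
      using ab ce deg in_RS ij by auto
    note dm = div_mod_less_mult[OF ab'(1)] div_mod_less_mult[OF ab'(2)]
      div_mod_less_mult[OF ce'(1)] div_mod_less_mult[OF ce'(2)]
    have "(\<Sum>p\<in>carrier (G \<times>\<times> H). tensor_rep \<rho> \<sigma> p $$ (a, b) * cnj (tensor_rep \<rho>' \<sigma>' p $$ (c, e)))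
      = (\<Sum>(x, y)\<in>carrier G \<times> carrier H.
          (\<rho> x $$ (a div ?m, b div ?m) * cnj (\<rho>' x $$ (c div ?m', e div ?m'))) *
          (\<sigma> y $$ (a mod ?m, b mod ?m) * cnj (\<sigma>' y $$ (c mod ?m', e mod ?m'))))"
      unfolding car
      using tensor_rep_index[OF repG[OF in_RS(1)] repH[OF in_RS(2)] _ _ ab']
        tensor_rep_index[OF repG[OF in_RS(3)] repH[OF in_RS(4)] _ _ ce']
      by (intro sum.cong refl) auto
    also have "\<dots> = (\<Sum>x\<in>carrier G. \<rho> x $$ (a div ?m, b div ?m) * cnj (\<rho>' x $$ (c div ?m', e div ?m'))) *
        (\<Sum>y\<in>carrier H. \<sigma> y $$ (a mod ?m, b mod ?m) * cnj (\<sigma>' y $$ (c mod ?m', e mod ?m')))"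
      unfolding sum_product sum.cartesian_product ..
    also have "\<dots> = (if \<rho> = \<rho>' \<and> a div ?m = c div ?m' \<and> b div ?m = e div ?m' then
          of_nat (card (carrier G)) / of_nat ?n else 0) *
        (if \<sigma> = \<sigma>' \<and> a mod ?m = c mod ?m' \<and> b mod ?m = e mod ?m' then
          of_nat (card (carrier H)) / of_nat ?m else 0)"
      using G.orth[OF in_RS(1,3), of "a div ?m" "b div ?m" "c div ?m'" "e div ?m'"]
        H.orth[OF in_RS(2,4), of "a mod ?m" "b mod ?m" "c mod ?m'" "e mod ?m'"] dm by simp
    also have "\<dots> = (if i = j \<and> a = c \<and> b = e then of_nat (card (carrier (G \<times>\<times> H))) /
        of_nat (rep_degree (G \<times>\<times> H) (tensor_rep \<rho> \<sigma>)) else 0)"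
    proof -
      \<comment> \<open>Flattened indices are equal when quotient and remainder are; the conditions
        with \<open>?m'\<close> agree with these once \<open>\<sigma> = \<sigma>'\<close> makes the
        two divisors equal.\<close>
      have "a = c \<longleftrightarrow> a div ?m = c div ?m \<and> a mod ?m = c mod ?m"
        "b = e \<longleftrightarrow> b div ?m = e div ?m \<and> b mod ?m = e mod ?m" by (metis div_mult_mod_eq)+
      then show ?thesis
        by (auto simp: ij deg in_RS car card_cartesian_product)
    qed
    finally show "(\<Sum>x\<in>carrier (G \<times>\<times> H). (case i of (\<rho>, \<sigma>) \<Rightarrow> tensor_rep \<rho> \<sigma>) x $$ (a, b) *
        cnj ((case j of (\<rho>, \<sigma>) \<Rightarrow> tensor_rep \<rho> \<sigma>) x $$ (c, e)))
      = (if i = j \<and> a = c \<and> b = e then of_nat (card (carrier (G \<times>\<times> H))) /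
          of_nat (rep_degree (G \<times>\<times> H) (case i of (\<rho>, \<sigma>) \<Rightarrow> tensor_rep \<rho> \<sigma>)) else 0)"
      by (simp add: ij)
  next
    fix g p
    assume zero: "\<And>i. i \<in> R \<times> S \<Longrightarrow> fourier (G \<times>\<times> H) g (case i of (\<rho>, \<sigma>) \<Rightarrow> tensor_rep \<rho> \<sigma>)
        = 0\<^sub>m (rep_degree (G \<times>\<times> H) (case i of (\<rho>, \<sigma>) \<Rightarrow> tensor_rep \<rho> \<sigma>))
             (rep_degree (G \<times>\<times> H) (case i of (\<rho>, \<sigma>) \<Rightarrow> tensor_rep \<rho> \<sigma>))"
      and "p \<in> carrier (G \<times>\<times> H)"
    then obtain x y where p: "p = (x, y)" "x \<in> carrier G" "y \<in> carrier H" by (auto simp: car)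
    have part: "(\<Sum>x\<in>carrier G. \<rho> x $$ (a, b) * g (x, y)) = 0"
      if \<rho>: "\<rho> \<in> R" and ab: "a < rep_degree G \<rho>" "b < rep_degree G \<rho>" and y: "y \<in> carrier H" for \<rho> a b y
    proof (rule H.inj[OF _ y])
      fix \<sigma> assume \<sigma>: "\<sigma> \<in> S"
      let ?n = "rep_degree G \<rho>" and ?m = "rep_degree H \<sigma>"
      show "fourier H (\<lambda>y. \<Sum>x\<in>carrier G. \<rho> x $$ (a, b) * g (x, y)) \<sigma> = 0\<^sub>m ?m ?m"
      proof (rule eq_matI)
        fix c e assume "c < dim_row (0\<^sub>m ?m ?m :: complex mat)" "e < dim_col (0\<^sub>m ?m ?m :: complex mat)"
        then have ce: "c < ?m" "e < ?m" by auto
        \<comment> \<open>Position in the Kronecker product where entry \<open>(a, b)\<close> of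
          \<open>\<rho>\<close> meets entry \<open>(c, e)\<close> of
          \<open>\<sigma>\<close>.\<close>
        have lt: "a * ?m + c < ?n * ?m" "b * ?m + e < ?n * ?m"
          using ab ce by (auto intro: mult_add_less_mult)
        have "fourier H (\<lambda>y. \<Sum>x\<in>carrier G. \<rho> x $$ (a, b) * g (x, y)) \<sigma> $$ (c, e)
            = (\<Sum>y\<in>carrier H. \<Sum>x\<in>carrier G. tensor_rep \<rho> \<sigma> (x, y) $$ (a * ?m + c, b * ?m + e) * g (x, y))"
          using ce lt by (auto simp: fourier_def sum_distrib_left tensor_rep_index[OF repG[OF \<rho>] repH[OF \<sigma>]]
              algebra_simps intro!: sum.cong)
        also have "\<dots> = fourier (G \<times>\<times> H) g (tensor_rep \<rho> \<sigma>) $$ (a * ?m + c, b * ?m + e)"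
          using lt by (subst sum.swap) (simp add: fourier_def deg[OF \<rho> \<sigma>] car sum.cartesian_product
              case_prod_unfold)
        also have "\<dots> = 0" using zero[of "(\<rho>, \<sigma>)"] \<rho> \<sigma> lt by (simp add: deg)
        finally show "fourier H (\<lambda>y. \<Sum>x\<in>carrier G. \<rho> x $$ (a, b) * g (x, y)) \<sigma> $$ (c, e)
            = 0\<^sub>m ?m ?m $$ (c, e)" using ce by simp
      qed auto
    qed
    have "g (x, y) = 0"
    proof (rule G.inj[OF _ p(2), of "\<lambda>x. g (x, y)"])
      fix \<rho> assume \<rho>: "\<rho> \<in> R"
      show "fourier G (\<lambda>x. g (x, y)) \<rho> = 0\<^sub>m (rep_degree G \<rho>) (rep_degree G \<rho>)"
        using part[OF \<rho> _ _ p(3)] by (intro eq_matI) (auto simp: fourier_def)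
    qed
    then show "g p = 0" by (simp add: p)
  qed
qed


section \<open>Slices\<close>

lemma left_slice_add: "left_slice G z (\<lambda>p. g p + h p) = (\<lambda>x. left_slice G z g x + left_slice G z h x)"
  by (simp add: left_slice_def fun_eq_iff)

lemma left_slice_smult: "left_slice G z (\<lambda>p. c * g p) = (\<lambda>x. c * left_slice G z g x)"
  by (simp add: left_slice_def fun_eq_iff)

lemma left_slice_cong:
  assumes "group G" "z \<in> carrier G" "x \<in> carrier G" "\<And>p. p \<in> carrier (G \<times>\<times> G) \<Longrightarrow> g p = h p"
  shows "left_slice G z g x = left_slice G z h x"
proof -
  interpret group G by fact
  show ?thesis using assms by (simp add: left_slice_def DirProd_def)
qed

text \<open>For fixed \<open>x\<close>, the map z \<mapsto> z^-1 x permutes the group, so the slices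
  visit every point of the product exactly once.\<close>

lemma sum_left_slices:
  fixes F :: "complex \<Rightarrow> real"
  assumes "group G"
  shows "(\<Sum>z\<in>carrier G. \<Sum>x\<in>carrier G. F (left_slice G (inv\<^bsub>G\<^esub> z) g x))
    = (\<Sum>p\<in>carrier (G \<times>\<times> G). F (g p))"
proof -
  have "(\<Sum>z\<in>carrier G. \<Sum>x\<in>carrier G. F (left_slice G (inv\<^bsub>G\<^esub> z) g x))
      = (\<Sum>x\<in>carrier G. \<Sum>z\<in>carrier G. F (g (x, inv\<^bsub>G\<^esub> z \<otimes>\<^bsub>G\<^esub> x)))"
    unfolding left_slice_def by (rule sum.swap)
  also have "\<dots> = (\<Sum>x\<in>carrier G. \<Sum>y\<in>carrier G. F (g (x, y)))"
  proof (rule sum.cong[OF refl])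
    fix x assume x: "x \<in> carrier G"
    show "(\<Sum>z\<in>carrier G. F (g (x, inv\<^bsub>G\<^esub> z \<otimes>\<^bsub>G\<^esub> x))) = (\<Sum>y\<in>carrier G. F (g (x, y)))"
      by (rule sum.reindex_bij_betw[OF bij_betw_inv_mult[OF assms x], of "\<lambda>y. F (g (x, y))"])
  qed
  finally show ?thesis by (simp add: sum.cartesian_product DirProd_def)
qed


lemma spectral_space_eqI:
  assumes "A \<in> spectral_space G I rep" "B \<in> spectral_space G I rep" "\<And>i. i \<in> I \<Longrightarrow> A i = B i"
  shows "A = B"
  using assms unfolding spectral_space_def by (meson PiE_ext)

text \<open>\<open>U\<close> is \<open>F\<close> followed by \<open>V\<close>: inversion recovers a
  function on the product group, and then each slice is transformed. Bijectivity is checked on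
  functions, where a point determines the slice it lies on.\<close>

lemma slices_unitary_map:
  assumes "group G" "finite (carrier G)" "complete_unitary_irreps G R" "finite R"
  obtains U where
    "unitary_map
      (R \<times> R)
      (spectral_space (G \<times>\<times> G) (R \<times> R) (\<lambda>(\<rho>\<^sub>1, \<rho>\<^sub>2). tensor_rep \<rho>\<^sub>1 \<rho>\<^sub>2))
      (spectral_norm_sq (G \<times>\<times> G) (R \<times> R) (\<lambda>(\<rho>\<^sub>1, \<rho>\<^sub>2). tensor_rep \<rho>\<^sub>1 \<rho>\<^sub>2))
      (carrier G \<times> R)
      (spectral_space G (carrier G \<times> R) (\<lambda>(z, \<rho>). \<rho>))
      (slices_norm_sq G R)
      U"
    "\<And>g. U (\<lambda>(\<rho>\<^sub>1, \<rho>\<^sub>2)\<in>R \<times> R. fourier (G \<times>\<times> G) g (tensor_rep \<rho>\<^sub>1 \<rho>\<^sub>2)) =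
        (\<lambda>(z, \<rho>)\<in>carrier G \<times> R. fourier G (left_slice G (inv\<^bsub>G\<^esub> z) g) \<rho>)"
proof -
  interpret group G by fact
  let ?GG = "G \<times>\<times> G" and ?RR = "R \<times> R" and ?\<tau> = "\<lambda>(\<rho>\<^sub>1, \<rho>\<^sub>2). tensor_rep \<rho>\<^sub>1 \<rho>\<^sub>2"
  let ?S = "spectral_space ?GG ?RR ?\<tau>" and ?T = "spectral_space G (carrier G \<times> R) (\<lambda>(z, \<rho>). \<rho>)"
  interpret G: fourier_basis G R "\<lambda>\<rho>. \<rho>" by (rule fourier_basis_irreps[OF assms])
  interpret GG: fourier_basis ?GG ?RR ?\<tau> by (rule fourier_basis_tensor[OF assms assms])
  have car: "carrier ?GG = carrier G \<times> carrier G" by (simp add: DirProd_def)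
  define F where "F = inv_fourier ?GG ?RR ?\<tau>"
  define V where "V g = (\<lambda>(z, \<rho>)\<in>carrier G \<times> R. fourier G (left_slice G (inv\<^bsub>G\<^esub> z) g) \<rho>)" for g
  define U where "U A = V (F A)" for A
  \<comment> \<open>Inversion recovers a function on the carrier, so \<open>V\<close> must be seen
    to depend only on the values there.\<close>
  have V_cong: "V g = V h" if "\<And>p. p \<in> carrier ?GG \<Longrightarrow> g p = h p" for g h
    unfolding V_def using left_slice_cong[OF \<open>group G\<close> _ _ that]
    by (intro restrict_ext) (auto intro: fourier_cong)
  have V_apply: "V g (z, \<rho>) = fourier G (left_slice G (inv\<^bsub>G\<^esub> z) g) \<rho>"
    if "z \<in> carrier G" "\<rho> \<in> R" for g z \<rho>
    using that by (simp add: V_def)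
  have V_T: "V g \<in> ?T" for g by (auto simp: V_def spectral_space_def)
  \<comment> \<open>Each slice can be read back from its transform, which makes \<open>V\<close>
    injective on functions over the carrier.\<close>
  have V_slice: "left_slice G (inv\<^bsub>G\<^esub> z) g x = inv_fourier G R (\<lambda>\<rho>. \<rho>) (\<lambda>\<rho>\<in>R. V g (z, \<rho>)) x"
    if "z \<in> carrier G" "x \<in> carrier G" for g z x
  proof -
    have "(\<lambda>\<rho>\<in>R. V g (z, \<rho>)) = (\<lambda>\<rho>\<in>R. fourier G (left_slice G (inv\<^bsub>G\<^esub> z) g) \<rho>)"
      using V_apply[OF that(1)] by (intro restrict_ext) simp
    then show ?thesis using G.inv_fourier_fourier[OF that(2)] by simp
  qed
  have V_inj: "g (x\<^sub>1, x\<^sub>2) = h (x\<^sub>1, x\<^sub>2)" if "V g = V h" "x\<^sub>1 \<in> carrier G" "x\<^sub>2 \<in> carrier G" for g h x\<^sub>1 x\<^sub>2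
  proof -
    \<comment> \<open>Index of the slice through the given point, from solving z^-1 x1 = x2 for
      z.\<close>
    let ?z = "x\<^sub>1 \<otimes>\<^bsub>G\<^esub> inv\<^bsub>G\<^esub> x\<^sub>2"
    have z: "?z \<in> carrier G" using that by simp
    have "inv\<^bsub>G\<^esub> ?z \<otimes>\<^bsub>G\<^esub> x\<^sub>1 = x\<^sub>2" using that by (simp add: inv_mult_group m_assoc)
    then show ?thesis
      using V_slice[OF z that(2), of g] V_slice[OF z that(2), of h] that(1) by (simp add: left_slice_def)
  qed
  have F_fourier: "F (\<lambda>i\<in>?RR. fourier ?GG g (?\<tau> i)) p = g p" if "p \<in> carrier ?GG" for g p
    unfolding F_def by (rule GG.inv_fourier_fourier[OF that])
  have U_fourier: "U (\<lambda>i\<in>?RR. fourier ?GG g (?\<tau> i)) = V g" for g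
    unfolding U_def by (rule V_cong) (rule F_fourier)
  have "bij_betw U ?S ?T"
    unfolding bij_betw_def
  proof
    show "inj_on U ?S"
    proof (rule inj_onI)
      fix A B assume AB: "A \<in> ?S" "B \<in> ?S" "U A = U B"
      have "F A p = F B p" if "p \<in> carrier ?GG" for p
        using V_inj[of "F A" "F B"] AB(3) that by (auto simp: U_def car)
      then have "fourier ?GG (F A) \<sigma> = fourier ?GG (F B) \<sigma>" for \<sigma> by (rule fourier_cong)
      then have "A i = B i" if "i \<in> ?RR" for i
        using GG.fourier_inv_fourier[OF AB(1) that] GG.fourier_inv_fourier[OF AB(2) that]
        by (simp add: F_def)
      then show "A = B" by (rule spectral_space_eqI[OF AB(1,2)])
    qed
    show "U ` ?S = ?T"
    proof
      show "U ` ?S \<subseteq> ?T" using V_T by (auto simp: U_def)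
      show "?T \<subseteq> U ` ?S"
      proof
        fix Q assume Q: "Q \<in> ?T"
        define q where "q z = (\<lambda>\<rho>\<in>R. Q (z, \<rho>))" for z
        have q: "q z \<in> spectral_space G R (\<lambda>\<rho>. \<rho>)" if "z \<in> carrier G" for z
          using Q that by (auto simp: q_def spectral_space_def)
        \<comment> \<open>Glues the prescribed slices together: the point (x1, x2) lies on the slice
          with index x1 x2^-1, and its value is taken from the inverse transform of the
          corresponding \<open>q\<close>.\<close>
        define g where "g = (\<lambda>(x\<^sub>1, x\<^sub>2). inv_fourier G R (\<lambda>\<rho>. \<rho>) (q (x\<^sub>1 \<otimes>\<^bsub>G\<^esub> inv\<^bsub>G\<^esub> x\<^sub>2)) x\<^sub>1)"
        have slice: "left_slice G (inv\<^bsub>G\<^esub> z) g x = inv_fourier G R (\<lambda>\<rho>. \<rho>) (q z) x"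
          if "z \<in> carrier G" "x \<in> carrier G" for z x
        proof -
          have "x \<otimes>\<^bsub>G\<^esub> inv\<^bsub>G\<^esub> (inv\<^bsub>G\<^esub> z \<otimes>\<^bsub>G\<^esub> x) = z"
            using that by (simp add: inv_mult_group m_assoc[symmetric])
          then show ?thesis by (simp add: left_slice_def g_def)
        qed
        have "V g (z, \<rho>) = Q (z, \<rho>)" if z: "z \<in> carrier G" and \<rho>: "\<rho> \<in> R" for z \<rho>
        proof -
          have "V g (z, \<rho>) = fourier G (inv_fourier G R (\<lambda>\<rho>. \<rho>) (q z)) \<rho>"
            unfolding V_apply[OF z \<rho>] by (rule fourier_cong) (rule slice[OF z])
          also have "\<dots> = Q (z, \<rho>)" unfolding G.fourier_inv_fourier[OF q[OF z] \<rho>] by (simp add: q_def \<rho>)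
          finally show ?thesis .
        qed
        then have "V g = Q" by (intro spectral_space_eqI[OF V_T Q]) auto
        then have "Q = U (\<lambda>i\<in>?RR. fourier ?GG g (?\<tau> i))" by (simp add: U_fourier)
        then show "Q \<in> U ` ?S" using GG.fourier_in_spectral_space by blast
      qed
    qed
  qed
  moreover have "U (\<lambda>i\<in>?RR. A i + B i) = (\<lambda>j\<in>carrier G \<times> R. U A j + U B j)" if "A \<in> ?S" "B \<in> ?S" for A B
  proof -
    have "F (\<lambda>i\<in>?RR. A i + B i) = (\<lambda>p. F A p + F B p)"
      unfolding F_def using inv_fourier_add[OF that] by (rule ext)
    then show ?thesis
      unfolding U_def V_def by (auto simp: left_slice_add fourier_add intro!: restrict_ext)
  qed
  moreover have "U (\<lambda>i\<in>?RR. c \<cdot>\<^sub>m A i) = (\<lambda>j\<in>carrier G \<times> R. c \<cdot>\<^sub>m U A j)" if "A \<in> ?S" for c A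
  proof -
    have "F (\<lambda>i\<in>?RR. c \<cdot>\<^sub>m A i) = (\<lambda>p. c * F A p)"
      unfolding F_def using inv_fourier_smult[OF that] by (rule ext)
    then show ?thesis
      unfolding U_def V_def by (auto simp: left_slice_smult fourier_smult intro!: restrict_ext)
  qed
  moreover have "slices_norm_sq G R (U A) = spectral_norm_sq ?GG ?RR ?\<tau> A" if A: "A \<in> ?S" for A
  proof -
    let ?N = "real (card (carrier G))"
    have "spectral_norm_sq G R (\<lambda>\<rho>. \<rho>) (\<lambda>\<rho>. U A (z, \<rho>))
        = 1 / ?N * (\<Sum>x\<in>carrier G. (cmod (left_slice G (inv\<^bsub>G\<^esub> z) (F A) x))\<^sup>2)" if z: "z \<in> carrier G" for z
      unfolding G.spectral_norm_sq_fourier[symmetric]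
      using V_apply[OF z] by (simp add: spectral_norm_sq_def U_def)
    \<comment> \<open>One factor 1/|G| comes from Plancherel on each slice, the other from averaging
      over \<open>z\<close>; their product is the normalisation on the product group.\<close>
    then have "slices_norm_sq G R (U A) = 1 / ?N * (1 / ?N *
        (\<Sum>z\<in>carrier G. \<Sum>x\<in>carrier G. (cmod (left_slice G (inv\<^bsub>G\<^esub> z) (F A) x))\<^sup>2))"
      by (simp add: slices_norm_sq_def Coset.order_def sum_distrib_left)
    also have "\<dots> = 1 / ?N * (1 / ?N * (\<Sum>p\<in>carrier ?GG. (cmod (F A p))\<^sup>2))"
      unfolding sum_left_slices[OF \<open>group G\<close>, of "\<lambda>c. (cmod c)\<^sup>2"] ..
    also have "\<dots> = spectral_norm_sq ?GG ?RR ?\<tau> A"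
      unfolding GG.spectral_norm_sq_inv_fourier[OF A] F_def by (simp add: car card_cartesian_product)
    finally show ?thesis .
  qed
  ultimately have "unitary_map ?RR ?S (spectral_norm_sq ?GG ?RR ?\<tau>) (carrier G \<times> R) ?T (slices_norm_sq G R) U"
    unfolding unitary_map_def by blast
  moreover have "U (\<lambda>(\<rho>\<^sub>1, \<rho>\<^sub>2)\<in>?RR. fourier ?GG g (tensor_rep \<rho>\<^sub>1 \<rho>\<^sub>2)) = V g" for g
    using U_fourier[of g] by (simp add: case_prod_unfold)
  ultimately show thesis using that[of U] unfolding V_def by blast
qed

text \<open>\<open>U\<close> is quantified before \<open>f\<close>, so a single unitary map relates
  all spectra. The clause on arbitrary \<open>g\<close> determines it on the whole space, since
  every family of matrices over \<open>R \<times> R\<close> is a transform, and identifies it as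
  passage to slices.\<close>

theorem mainTheorem3:
  fixes G :: "('a, 'b) monoid_scheme"
    and R :: "'a mrep set"
    and Rs :: "'a mrep list"
    and m :: "'a mrep \<Rightarrow> 'a mrep \<Rightarrow> 'a mrep \<Rightarrow> nat"
    and C :: "'a mrep \<Rightarrow> 'a mrep \<Rightarrow> complex mat"
  assumes "group G" and "finite (carrier G)"
    and "complete_unitary_irreps G R"
    and "distinct Rs" and "set Rs = R"
    and "clebsch_gordan G Rs m C"
  shows "\<exists>U.
    unitary_map
      (R \<times> R)
      (spectral_space (G \<times>\<times> G) (R \<times> R) (\<lambda>(\<rho>\<^sub>1, \<rho>\<^sub>2). tensor_rep \<rho>\<^sub>1 \<rho>\<^sub>2))
      (spectral_norm_sq (G \<times>\<times> G) (R \<times> R) (\<lambda>(\<rho>\<^sub>1, \<rho>\<^sub>2). tensor_rep \<rho>\<^sub>1 \<rho>\<^sub>2))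
      (carrier G \<times> R)
      (spectral_space G (carrier G \<times> R) (\<lambda>(z, \<rho>). \<rho>))
      (slices_norm_sq G R)
      U \<and>
    (\<forall>g :: 'a \<times> 'a \<Rightarrow> complex.
      U (\<lambda>(\<rho>\<^sub>1, \<rho>\<^sub>2)\<in>R \<times> R. fourier (G \<times>\<times> G) g (tensor_rep \<rho>\<^sub>1 \<rho>\<^sub>2)) =
        (\<lambda>(z, \<rho>)\<in>carrier G \<times> R. fourier G (left_slice G (inv\<^bsub>G\<^esub> z) g) \<rho>)) \<and>
    (\<forall>f :: 'a \<Rightarrow> complex.
      U (\<lambda>(\<rho>\<^sub>1, \<rho>\<^sub>2)\<in>R \<times> R. bispectrum G Rs m C f \<rho>\<^sub>1 \<rho>\<^sub>2) =
        (\<lambda>(z, \<rho>)\<in>carrier G \<times> R. skew_spectrum G f z \<rho>) \<and>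
      (\<forall>z\<in>carrier G. \<forall>\<rho>\<in>R. skew_spectrum G f z \<rho> = fourier G (skew_correlation G f z) \<rho>) \<and>
      (\<forall>z\<in>carrier G. \<forall>x\<in>carrier G.
        skew_correlation G f z x = triple_correlation G f (x, inv\<^bsub>G\<^esub> z \<otimes>\<^bsub>G\<^esub> x) \<and>
        triple_correlation G f (x, inv\<^bsub>G\<^esub> z \<otimes>\<^bsub>G\<^esub> x) =
          left_slice G (inv\<^bsub>G\<^esub> z) (triple_correlation G f) x) \<and>
      (\<forall>\<rho>\<^sub>1\<in>R. \<forall>\<rho>\<^sub>2\<in>R.
        fourier (G \<times>\<times> G) (triple_correlation G f) (tensor_rep \<rho>\<^sub>1 \<rho>\<^sub>2) =
          bispectrum G Rs m C f \<rho>\<^sub>1 \<rho>\<^sub>2) \<and>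
      (\<forall>x\<^sub>1\<in>carrier G. \<forall>x\<^sub>2\<in>carrier G.
        \<exists>!(z, x). z \<in> carrier G \<and> x \<in> carrier G \<and> (x\<^sub>1, x\<^sub>2) = (x, z \<otimes>\<^bsub>G\<^esub> x) \<and>
          triple_correlation G f (x\<^sub>1, x\<^sub>2) = left_slice G z (triple_correlation G f) x))"
proof -
  interpret group G by fact
  let ?GG = "G \<times>\<times> G"
  \<comment> \<open>The list \<open>Rs\<close> enumerates \<open>R\<close>, which supplies the
    finiteness behind the sums over \<open>R\<close>.\<close>
  have "finite R" using assms(5) by auto
  have unit: "unitary_rep G \<rho>" if "\<rho> \<in> R" for \<rho>
    using assms(3) that by (simp add: complete_unitary_irreps_def)
  obtain U where U: "unitary_map
      (R \<times> R)
      (spectral_space (G \<times>\<times> G) (R \<times> R) (\<lambda>(\<rho>\<^sub>1, \<rho>\<^sub>2). tensor_rep \<rho>\<^sub>1 \<rho>\<^sub>2))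
      (spectral_norm_sq (G \<times>\<times> G) (R \<times> R) (\<lambda>(\<rho>\<^sub>1, \<rho>\<^sub>2). tensor_rep \<rho>\<^sub>1 \<rho>\<^sub>2))
      (carrier G \<times> R)
      (spectral_space G (carrier G \<times> R) (\<lambda>(z, \<rho>). \<rho>))
      (slices_norm_sq G R)
      U"
    and U_fourier: "\<And>g. U (\<lambda>(\<rho>\<^sub>1, \<rho>\<^sub>2)\<in>R \<times> R. fourier ?GG g (tensor_rep \<rho>\<^sub>1 \<rho>\<^sub>2)) =
        (\<lambda>(z, \<rho>)\<in>carrier G \<times> R. fourier G (left_slice G (inv\<^bsub>G\<^esub> z) g) \<rho>)"
    by (rule slices_unitary_map[OF assms(1-3) \<open>finite R\<close>]) (rule that)
  have bisp: "fourier ?GG (triple_correlation G f) (tensor_rep \<rho>\<^sub>1 \<rho>\<^sub>2) = bispectrum G Rs m C f \<rho>\<^sub>1 \<rho>\<^sub>2"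
    if "\<rho>\<^sub>1 \<in> R" "\<rho>\<^sub>2 \<in> R" for f \<rho>\<^sub>1 \<rho>\<^sub>2
    using bispectrum_eq_fourier[OF assms(1,2) _ assms(6)] unit that assms(5) by metis
  have skew: "skew_spectrum G f z \<rho> = fourier G (skew_correlation G f z) \<rho>" if "\<rho> \<in> R" for f z \<rho>
    by (rule skew_spectrum_eq_fourier[OF assms(1) unit[OF that]])
  have slice: "skew_correlation G f z x = left_slice G (inv\<^bsub>G\<^esub> z) (triple_correlation G f) x"
    if "z \<in> carrier G" "x \<in> carrier G" for f z x
    unfolding left_slice_def by (rule skew_correlation_eq_triple_correlation[OF assms(1) that])
  have U_bisp: "U (\<lambda>(\<rho>\<^sub>1, \<rho>\<^sub>2)\<in>R \<times> R. bispectrum G Rs m C f \<rho>\<^sub>1 \<rho>\<^sub>2)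
      = (\<lambda>(z, \<rho>)\<in>carrier G \<times> R. skew_spectrum G f z \<rho>)" for f
  proof -
    \<comment> \<open>Both families are restricted to \<open>R \<times> R\<close>, so agreement
      there makes them equal and the Fourier clause for \<open>U\<close> applies to the triple
      correlation.\<close>
    have "(\<lambda>(\<rho>\<^sub>1, \<rho>\<^sub>2)\<in>R \<times> R. bispectrum G Rs m C f \<rho>\<^sub>1 \<rho>\<^sub>2)
        = (\<lambda>(\<rho>\<^sub>1, \<rho>\<^sub>2)\<in>R \<times> R. fourier ?GG (triple_correlation G f) (tensor_rep \<rho>\<^sub>1 \<rho>\<^sub>2))"
      by (intro restrict_ext) (auto simp: bisp)
    then have "U (\<lambda>(\<rho>\<^sub>1, \<rho>\<^sub>2)\<in>R \<times> R. bispectrum G Rs m C f \<rho>\<^sub>1 \<rho>\<^sub>2)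
        = (\<lambda>(z, \<rho>)\<in>carrier G \<times> R. fourier G (left_slice G (inv\<^bsub>G\<^esub> z) (triple_correlation G f)) \<rho>)"
      by (simp only: U_fourier)
    also have "\<dots> = (\<lambda>(z, \<rho>)\<in>carrier G \<times> R. skew_spectrum G f z \<rho>)"
      by (intro restrict_ext) (auto simp: skew slice intro!: fourier_cong)
    finally show ?thesis .
  qed
  have cover: "\<exists>!(z, x). z \<in> carrier G \<and> x \<in> carrier G \<and> (x\<^sub>1, x\<^sub>2) = (x, z \<otimes>\<^bsub>G\<^esub> x) \<and>
      triple_correlation G f (x\<^sub>1, x\<^sub>2) = left_slice G z (triple_correlation G f) x"
    if x: "x\<^sub>1 \<in> carrier G" "x\<^sub>2 \<in> carrier G" for f x\<^sub>1 x\<^sub>2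
  \<comment> \<open>The first coordinate forces \<open>x\<close>, and then z x = x2 forces z = x2
    x1^-1.\<close>
  proof (rule ex1I[of _ "(x\<^sub>2 \<otimes>\<^bsub>G\<^esub> inv\<^bsub>G\<^esub> x\<^sub>1, x\<^sub>1)"])
    show "case (x\<^sub>2 \<otimes>\<^bsub>G\<^esub> inv\<^bsub>G\<^esub> x\<^sub>1, x\<^sub>1) of (z, x) \<Rightarrow> z \<in> carrier G \<and> x \<in> carrier G \<and>
      (x\<^sub>1, x\<^sub>2) = (x, z \<otimes>\<^bsub>G\<^esub> x) \<and>
      triple_correlation G f (x\<^sub>1, x\<^sub>2) = left_slice G z (triple_correlation G f) x"
      using x by (simp add: m_assoc left_slice_def)
    show "p = (x\<^sub>2 \<otimes>\<^bsub>G\<^esub> inv\<^bsub>G\<^esub> x\<^sub>1, x\<^sub>1)"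
      if "case p of (z, x) \<Rightarrow> z \<in> carrier G \<and> x \<in> carrier G \<and> (x\<^sub>1, x\<^sub>2) = (x, z \<otimes>\<^bsub>G\<^esub> x) \<and>
        triple_correlation G f (x\<^sub>1, x\<^sub>2) = left_slice G z (triple_correlation G f) x" for p
      using that x by (auto simp: m_assoc)
  qed
  have "skew_correlation G f z x = triple_correlation G f (x, inv\<^bsub>G\<^esub> z \<otimes>\<^bsub>G\<^esub> x) \<and>
      triple_correlation G f (x, inv\<^bsub>G\<^esub> z \<otimes>\<^bsub>G\<^esub> x) = left_slice G (inv\<^bsub>G\<^esub> z) (triple_correlation G f) x"
    if "z \<in> carrier G" "x \<in> carrier G" for f z x
    using slice[OF that] by (simp add: left_slice_def)
  with U U_fourier U_bisp skew bisp cover show ?thesis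
    by (intro exI[of _ U] conjI allI ballI) auto
qed

end
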